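(* Every infinite frieze is realizable in the infinite strip $\mathbb{V}$. That is, if $(a_i)_{i\in\mathbb{Z}}$ is the quiddity row of an infinite frieze, then there exist a set $M_2=\{(q,1)\mid q\in A\}$ with $A\subseteq\mathbb{Q}$ and an admissible triangulation of $\mathbb{V}(M_1,M_2)$ such that for every $i\in\mathbb{Z}$ the number of triangles incident with $(i,0)$ is equal to $a_i$.
   Context: An infinite frieze (of positive integers) is an array $(m_{ij})_{i,j\in\mathbb{Z},\,j\ge i-2}$ such that $m_{i,i-2}=0$, $m_{i,i-1}=1$ for all $i$, $m_{ij}\in\mathbb{Z}_{>0}$ for all $i\le j$, and $m_{ij}m_{i+1,j+1}-m_{i+1,j}m_{i,j+1}=1$ for all $i,j$ with $j\ge i-1$. Its quiddity row is $(a_i)_{i\in\mathbb{Z}}$, $a_i=m_{ii}$. $\mathbb{V}=\mathbb{V}(M_1,M_2)$ denotes an infinite strip of height one in the plane with lower boundary $\{(x,0)\mid x\in\mathbb{R}\}$ and upper boundary $\{(x,1)\mid x\in\mathbb{R}\}$, with vertices (marked points) $M_1=\{(i,0)\mid i\in\mathbb{Z}\}$ on the lower boundary and $M_2=\{(q,1)\mid q\in A\}$, $A\subseteq\mathbb{Q}$ (possibly empty), on the upper boundary, together with two limit points $+\infty$ and $-\infty$ at the right and left extremities of the strip. Arcs are curves in $\mathbb{V}$ without self-intersections, up to isotopy fixing endpoints, of the following types (boundary segments between neighbouring vertices are not arcs): bridging arcs, joining vertices on different boundaries; peripheral arcs, joining two vertices on the same boundary; asymptotic arcs, starting at a vertex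 on a boundary and tending to $+\infty$ or $-\infty$; and the generic arc, connecting the two limit points. Two arcs are compatible if they have representatives which do not cross. A triangulation of $\mathbb{V}$ is a maximal collection of pairwise compatible arcs. It is admissible if every vertex on the lower boundary is incident with only finitely many arcs of it. The triangles of a triangulation are the three-sided regions into which the arcs cut the strip, where limit points are allowed as vertices. *)

theory Defs
  imports "HOL-Analysis.Analysis"
begin

section \<open>Infinite friezes\<close>

text \<open>An array indexed by \<open>j \<ge> i - 2\<close> is represented by a total function whose values at
  \<open>j < i - 2\<close> are irrelevant.\<close>

definition infinite_frieze :: "(int \<Rightarrow> int \<Rightarrow> int) \<Rightarrow> bool" where
  "infinite_frieze m \<longleftrightarrow>
     (\<forall>i. m i (i - 2) = 0) \<and>
     (\<forall>i. m i (i - 1) = 1) \<and>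
     (\<forall>i j. i \<le> j \<longrightarrow> m i j > 0) \<and>
     (\<forall>i j. i - 1 \<le> j \<longrightarrow> m i j * m (i + 1) (j + 1) - m (i + 1) j * m i (j + 1) = 1)"

definition quiddity_row :: "(int \<Rightarrow> int \<Rightarrow> int) \<Rightarrow> int \<Rightarrow> int" where
  "quiddity_row m i = m i i"


section \<open>The infinite strip and its curves\<close>

definition lower_vertices :: "(real \<times> real) set" where
  "lower_vertices = {(of_int i, 0) | i. True}"

definition upper_vertices :: "rat set \<Rightarrow> (real \<times> real) set" where
  "upper_vertices A = {(of_rat q, 1) | q. q \<in> A}"

definition open_strip :: "(real \<times> real) set" where
  "open_strip = UNIV \<times> {0<..<1}"

datatype endpoint = Vertex "real \<times> real" | Plus_Infinity | Minus_Infinity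

text \<open>A curve tends to a limit point of the strip iff its first coordinate tends to
  plus or minus infinity.\<close>

fun end_filter :: "endpoint \<Rightarrow> (real \<times> real) filter" where
  "end_filter (Vertex p) = nhds p"
| "end_filter Plus_Infinity = filtercomap fst at_top"
| "end_filter Minus_Infinity = filtercomap fst at_bot"

text \<open>Curves are taken without their endpoints, so that curves ending at a vertex and curves
  ending at a limit point are treated uniformly; apart from its endpoints a curve lies in the
  interior of the strip.\<close>

definition simple_curve :: "endpoint \<Rightarrow> endpoint \<Rightarrow> (real \<Rightarrow> real \<times> real) \<Rightarrow> bool" where
  "simple_curve e e' g \<longleftrightarrow>
     continuous_on {0<..<1} g \<and> inj_on g {0<..<1} \<and> g ` {0<..<1} \<subseteq> open_strip \<and>
     filterlim g (end_filter e) (at_right 0) \<and> filterlim g (end_filter e') (at_left 1)"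

text \<open>A curve is identified with its image, so it carries no orientation.\<close>

definition joins :: "(real \<times> real) set \<Rightarrow> endpoint \<Rightarrow> endpoint \<Rightarrow> bool" where
  "joins C e e' \<longleftrightarrow> (\<exists>g. simple_curve e e' g \<and> C = g ` {0<..<1})"

text \<open>An isotopy fixing the endpoints is a continuous family of simple curves; the two limits,
  uniform in the isotopy parameter, express continuity of the family at the fixed endpoints.\<close>

definition isotopy :: "endpoint \<Rightarrow> endpoint \<Rightarrow> (real \<times> real \<Rightarrow> real \<times> real) \<Rightarrow> bool" where
  "isotopy e e' H \<longleftrightarrow>
     continuous_on ({0..1} \<times> {0<..<1}) H \<and>
     (\<forall>s\<in>{0..1}. simple_curve e e' (\<lambda>t. H (s, t))) \<and>
     filterlim H (end_filter e) (principal {0..1} \<times>\<^sub>F at_right 0) \<and>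
     filterlim H (end_filter e') (principal {0..1} \<times>\<^sub>F at_left 1)"

definition isotopic :: "(real \<times> real) set \<Rightarrow> (real \<times> real) set \<Rightarrow> bool" where
  "isotopic C D \<longleftrightarrow>
     (\<exists>e e' H. isotopy e e' H \<and>
        C = (\<lambda>t. H (0, t)) ` {0<..<1} \<and> D = (\<lambda>t. H (1, t)) ` {0<..<1})"


section \<open>Arcs and triangulations\<close>

text \<open>\<open>V\<close> is the set of vertices on one of the two boundaries.\<close>

definition neighbouring :: "(real \<times> real) set \<Rightarrow> real \<times> real \<Rightarrow> real \<times> real \<Rightarrow> bool" where
  "neighbouring V p q \<longleftrightarrow>
     p \<in> V \<and> q \<in> V \<and> fst p < fst q \<and> \<not> (\<exists>r\<in>V. fst p < fst r \<and> fst r < fst q)"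

definition bridging_ends :: "rat set \<Rightarrow> endpoint set set" where
  "bridging_ends A =
     {{Vertex p, Vertex q} | p q. p \<in> lower_vertices \<and> q \<in> upper_vertices A}"

text \<open>A curve joining two neighbouring vertices of a boundary is isotopic to a boundary segment,
  hence not an arc.\<close>

definition peripheral_ends :: "(real \<times> real) set \<Rightarrow> endpoint set set" where
  "peripheral_ends V =
     {{Vertex p, Vertex q} | p q. p \<in> V \<and> q \<in> V \<and> fst p < fst q \<and> \<not> neighbouring V p q}"

definition asymptotic_ends :: "rat set \<Rightarrow> endpoint set set" where
  "asymptotic_ends A =
     {{Vertex p, l} | p l. p \<in> lower_vertices \<union> upper_vertices A \<and>
                           l \<in> {Plus_Infinity, Minus_Infinity}}"

definition arc_ends :: "rat set \<Rightarrow> endpoint set set" where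
  "arc_ends A =
     bridging_ends A \<union>
     peripheral_ends lower_vertices \<union> peripheral_ends (upper_vertices A) \<union>
     asymptotic_ends A \<union>
     {{Minus_Infinity, Plus_Infinity}}"

text \<open>An arc is an isotopy class of curves.\<close>

definition arcs :: "rat set \<Rightarrow> (real \<times> real) set set set" where
  "arcs A = {{D. isotopic C D} | C e e'. joins C e e' \<and> {e, e'} \<in> arc_ends A}"

definition incident_arc :: "(real \<times> real) set set \<Rightarrow> endpoint \<Rightarrow> bool" where
  "incident_arc a e \<longleftrightarrow> (\<exists>C\<in>a. \<exists>e'. joins C e e')"

definition compatible :: "(real \<times> real) set set \<Rightarrow> (real \<times> real) set set \<Rightarrow> bool" where
  "compatible a b \<longleftrightarrow> (\<exists>C\<in>a. \<exists>D\<in>b. C \<inter> D = {})"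

definition strip_triangulation :: "rat set \<Rightarrow> (real \<times> real) set set set \<Rightarrow> bool" where
  "strip_triangulation A T \<longleftrightarrow>
     T \<subseteq> arcs A \<and> pairwise compatible T \<and>
     (\<forall>T'. T \<subseteq> T' \<and> T' \<subseteq> arcs A \<and> pairwise compatible T' \<longrightarrow> T' = T)"

definition admissible :: "(real \<times> real) set set set \<Rightarrow> bool" where
  "admissible T \<longleftrightarrow> (\<forall>p\<in>lower_vertices. finite {a \<in> T. incident_arc a (Vertex p)})"


section \<open>Triangles\<close>

text \<open>To cut the strip along the arcs of \<open>T\<close>, each arc \<open>a\<close> is drawn as a curve \<open>R a\<close> in such a
  way that no two of these curves meet.\<close>

definition drawing :: "(real \<times> real) set set set \<Rightarrow> ((real \<times> real) set set \<Rightarrow> (real \<times> real) set) \<Rightarrow> bool"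
  where
  "drawing T R \<longleftrightarrow>
     (\<forall>a\<in>T. R a \<in> a) \<and> (\<forall>a\<in>T. \<forall>b\<in>T. a \<noteq> b \<longrightarrow> R a \<inter> R b = {})"

definition regions ::
  "(real \<times> real) set set set \<Rightarrow> ((real \<times> real) set set \<Rightarrow> (real \<times> real) set) \<Rightarrow> (real \<times> real) set set"
  where
  "regions T R = components (open_strip - (\<Union>a\<in>T. R a))"

definition side ::
  "rat set \<Rightarrow> (real \<times> real) set set set \<Rightarrow> ((real \<times> real) set set \<Rightarrow> (real \<times> real) set) \<Rightarrow>
     endpoint \<Rightarrow> endpoint \<Rightarrow> (real \<times> real) set \<Rightarrow> bool" where
  "side A T R e e' S \<longleftrightarrow>
     (\<exists>a\<in>T. S = R a \<and> joins S e e') \<or>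
     (\<exists>p q. {e, e'} = {Vertex p, Vertex q} \<and>
        (neighbouring lower_vertices p q \<or> neighbouring (upper_vertices A) p q) \<and>
        S = open_segment p q)"

text \<open>The closure adds the vertices among the corners of the region to its three sides.\<close>

definition triangle ::
  "rat set \<Rightarrow> (real \<times> real) set set set \<Rightarrow> ((real \<times> real) set set \<Rightarrow> (real \<times> real) set) \<Rightarrow>
     endpoint \<Rightarrow> endpoint \<Rightarrow> endpoint \<Rightarrow> (real \<times> real) set \<Rightarrow> bool" where
  "triangle A T R e1 e2 e3 D \<longleftrightarrow>
     D \<in> regions T R \<and> distinct [e1, e2, e3] \<and>
     (\<exists>S1 S2 S3. side A T R e1 e2 S1 \<and> side A T R e2 e3 S2 \<and> side A T R e3 e1 S3 \<and>
        frontier D = closure (S1 \<union> S2 \<union> S3))"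

definition triangles_at ::
  "rat set \<Rightarrow> (real \<times> real) set set set \<Rightarrow> ((real \<times> real) set set \<Rightarrow> (real \<times> real) set) \<Rightarrow>
     endpoint \<Rightarrow> (real \<times> real) set set" where
  "triangles_at A T R e = {D. \<exists>e2 e3. triangle A T R e e2 e3 D}"

end

theory Submission
  imports Defs "HOL-Complex_Analysis.Riemann_Mapping"
begin

text \<open>A frieze is the array of the determinants of a sequence of primitive vectors in \<open>\<int>\<^sup>2\<close>, and this
  sequence is a path \<open>v\<close> in the Farey graph. The lower vertices of the strip correspond to the
  points of the path, the upper vertices to the Farey neighbours of the path beyond both of its
  ends, and the arcs to the Farey edges between all these points. The neighbours of \<open>v i\<close> from
  \<open>v (i - 1)\<close> to \<open>v (i + 1)\<close> bound a fan of \<open>a i\<close> Farey triangles. The Farey edges are pairwise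
  compatible, and enlarging them by Zorn's lemma to a maximal family leaves the fans unchanged.

  The strip is identified with the unit disc, its vertices and limit points with points of the
  circle, and the arcs are drawn as straight chords. That every curve is isotopic to the chord
  between its ends follows from the Schoenflies theorem (obtained from the Riemann map and
  Caratheodory's extension, which rests on the length-area inequality) and Alexander's trick; that
  curves with interleaved ends cross follows from the Jordan curve theorem.\<close>

section \<open>Boundary behaviour of conformal maps\<close>

text \<open>The obstacle is that arcs are isotopy classes of arbitrary curves, while a triangulation
  has to be maximal among all of them. A curve determines the pair of its ends, however it is
  parametrized, and the pair determines the isotopy class; two different classes are then compatible
  exactly when their chords are disjoint, and only the order of points on a circle is left.

  Positivity of the frieze says that the path turns by less than a half turn, which leaves the rest
  of the projective line free for the upper boundary. A Farey neighbour of \<open>v i\<close> in the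
  fan that is not on the path lies beyond both ends, since an edge from \<open>v i\<close> cannot
  cross the path.

  The Farey edges alone need not be maximal: if all \<open>a i\<close> are 2, there is one upper
  vertex, joined to all lower ones, and the arcs from it to the two limit points are missing.
  Enlarging the family does no harm at a lower vertex because its fan is already closed: a further
  arc there would cross an outer side of the fan.\<close>

lemma holomorphic_area_rectangle:
  fixes F :: "complex \<Rightarrow> complex"
  assumes hol: "F holomorphic_on S" and "open S" and inj: "inj_on F S"
    and bnd: "F ` S \<subseteq> cball 0 M"
    and sub: "\<And>u v. u \<in> {a..b} \<Longrightarrow> v \<in> {c..d} \<Longrightarrow> Complex u v \<in> S"
  shows "integral {a..b} (\<lambda>u. integral {c..d} (\<lambda>v. (cmod (deriv F (Complex u v)))\<^sup>2)) \<le> (2 * M)\<^sup>2"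
proof (cases "a \<le> b \<and> c \<le> d")
  case False
  then have "integral {a..b} (\<lambda>u. integral {c..d} (\<lambda>v. (cmod (deriv F (Complex u v)))\<^sup>2)) = 0"
    by auto
  then show ?thesis by (metis zero_le_power2)
next
  case True
  have ex2: "(\<exists>i::2. P i) \<longleftrightarrow> P 1 \<or> P 2" for P by (metis exhaust_2)
  have M0: "M \<ge> 0"
    using sub[of a c] bnd True by (force simp: dist_norm intro: order_trans[OF norm_ge_zero])
  \<comment> \<open>The change of variables is done in \<open>real^2\<close>, the iterated
    integration in \<open>real \<times> real\<close>, and \<open>F\<close> lives on
    \<open>complex\<close>; these maps translate among the three.\<close>
  define vc :: "complex \<Rightarrow> real^2" where "vc z = (\<chi> i. if i = 1 then Re z else Im z)" for z
  define cv :: "real^2 \<Rightarrow> complex" where "cv x = Complex (x$1) (x$2)" for x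
  define pv :: "real \<times> real \<Rightarrow> real^2" where "pv p = vc (Complex (fst p) (snd p))" for p
  define vp :: "real^2 \<Rightarrow> real \<times> real" where "vp x = (x$1, x$2)" for x
  have vc_simps [simp]: "vc z $ 1 = Re z" "vc z $ 2 = Im z" for z by (auto simp: vc_def)
  have cv_vc [simp]: "cv (vc z) = z" for z by (simp add: cv_def)
  have vc_cv [simp]: "vc (cv x) = x" for x by (simp add: cv_def vec_eq_iff forall_2)
  have pv_vp [simp]: "pv (vp x) = x" for x by (simp add: pv_def vp_def vec_eq_iff forall_2)
  have vp_pv [simp]: "vp (pv x) = x" for x by (simp add: pv_def vp_def)
  have cv_pv: "cv (pv p) = Complex (fst p) (snd p)" for p by (simp add: pv_def)
  have lin_vc: "linear vc" by (rule linearI) (simp_all add: vec_eq_iff forall_2)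
  have lin_cv: "linear cv" by (rule linearI) (simp_all add: cv_def complex_eq_iff)
  have bl_vc: "bounded_linear vc" and bl_cv: "bounded_linear cv"
    using lin_vc lin_cv by (simp_all add: linear_conv_bounded_linear)
  define lo hi where "lo = vc (Complex a c)" and "hi = vc (Complex b d)"
  have cb: "cbox (vc z) (vc w) = {x. Re z \<le> x$1 \<and> x$1 \<le> Re w \<and> Im z \<le> x$2 \<and> x$2 \<le> Im w}" for z w
    by (auto simp: mem_box_cart forall_2)
  have inS: "cv x \<in> S" if "x \<in> cbox lo hi" for x
    using that sub by (auto simp: lo_def hi_def cb cv_def)
  define G where "G x = vc (F (cv x))" for x
  define G' where "G' x h = vc (deriv F (cv x) * cv h)" for x h
  have G': "(G has_derivative G' x) (at x within cbox lo hi)" if "x \<in> cbox lo hi" for x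
  proof -
    have "(F has_derivative (*) (deriv F (cv x))) (at (cv x))"
      using holomorphic_derivI[OF hol \<open>open S\<close> inS[OF that]] by (simp add: has_field_derivative_def)
    moreover have "(cv has_derivative cv) (at x within cbox lo hi)"
      using bl_cv bounded_linear_imp_has_derivative by blast
    ultimately have "((\<lambda>x. F (cv x)) has_derivative (\<lambda>h. deriv F (cv x) * cv h)) (at x within cbox lo hi)"
      using has_derivative_compose by blast
    then show ?thesis
      unfolding G_def G'_def using bounded_linear.has_derivative[OF bl_vc] by blast
  qed
  have injG: "inj_on G (cbox lo hi)"
  proof (rule inj_onI)
    fix x y assume *: "x \<in> cbox lo hi" "y \<in> cbox lo hi" "G x = G y"
    then have "F (cv x) = F (cv y)" unfolding G_def by (metis cv_vc)
    then have "cv x = cv y" using inj inS * by (auto dest: inj_onD)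
    then show "x = y" by (metis vc_cv)
  qed
  \<comment> \<open>By the Cauchy-Riemann equations the Jacobian determinant is the squared modulus
    of the derivative, so its integral is the area of the injective image.\<close>
  have detG: "\<bar>det (matrix (G' x))\<bar> = (cmod (deriv F (cv x)))\<^sup>2" for x
    unfolding cmod_power2 by (simp add: det_2 matrix_def G'_def cv_def axis_def power2_eq_square)
  have contd: "continuous_on S (deriv F)"
    using hol \<open>open S\<close> by (simp add: holomorphic_deriv holomorphic_on_imp_continuous_on)
  have cont1: "continuous_on (cbox lo hi) (\<lambda>x. (cmod (deriv F (cv x)))\<^sup>2)"
    by (intro continuous_intros continuous_on_compose2[OF contd] linear_continuous_on bl_cv) (use inS in auto)
  have intg: "(\<lambda>x. (cmod (deriv F (cv x)))\<^sup>2) integrable_on cbox lo hi"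
    using cont1 integrable_continuous by blast
  define I where "I = integral (cbox lo hi) (\<lambda>x. (cmod (deriv F (cv x)))\<^sup>2)"
  have hasI: "((\<lambda>x. (cmod (deriv F (cv x)))\<^sup>2) has_integral I) (cbox lo hi)"
    using intg I_def by blast
  have "G ` cbox lo hi \<in> lmeasurable \<and> measure lebesgue (G ` cbox lo hi) = I"
    by (subst has_measure_differentiable_image[OF _ G' injG]) (use hasI detG in auto)
  \<comment> \<open>The image is enclosed in a square instead of a disc, whence the constant
    \<open>(2 * M)\<^sup>2\<close>.\<close>
  moreover have "G ` cbox lo hi \<subseteq> cbox (vc (Complex (-M) (-M))) (vc (Complex M M))"
  proof clarify
    fix x assume "x \<in> cbox lo hi"
    then have "cmod (F (cv x)) \<le> M" using inS bnd by (force simp: dist_norm)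
    then show "G x \<in> cbox (vc (Complex (-M) (-M))) (vc (Complex M M))"
      using abs_Re_le_cmod[of "F (cv x)"] abs_Im_le_cmod[of "F (cv x)"]
      by (auto simp: cb G_def)
  qed
  ultimately have "I \<le> measure lebesgue (cbox (vc (Complex (-M) (-M))) (vc (Complex M M)))"
    by (metis measure_mono_fmeasurable fmeasurableD lmeasurable_cbox)
  also have "\<dots> = (2 * M)\<^sup>2"
  proof -
    have "vc 0 \<in> cbox (vc (Complex (-M) (-M))) (vc (Complex M M))" using M0 by (simp add: cb)
    then show ?thesis
      using M0 by (subst measure_completion)
        (auto simp: content_cbox_if_cart UNIV_2 power2_eq_square)
  qed
  finally have I_le: "I \<le> (2 * M)\<^sup>2" .
  have cbp: "cbox (p::real\<times>real) q = {x. fst p \<le> fst x \<and> fst x \<le> fst q \<and> snd p \<le> snd x \<and> snd x \<le> snd q}" for p q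
    by (cases p; cases q) auto
  have vpim: "vp ` cbox u v = cbox (vp u) (vp v)" for u v
  proof -
    have "x \<in> vp ` cbox u v \<longleftrightarrow> pv x \<in> cbox u v" for x
      by (metis image_iff pv_vp vp_pv)
    then show ?thesis
      by (auto simp: cbp vp_def pv_def mem_box_cart forall_2)
  qed
  have pvim: "pv ` cbox u v = cbox (pv u) (pv v)" for u v
    by (metis (no_types, lifting) image_cong image_ident image_image pv_vp vp_pv vpim)
  have "((\<lambda>x. (cmod (deriv F (cv (pv x))))\<^sup>2) has_integral (1 / 1) *\<^sub>R I) (vp ` cbox lo hi)"
  proof (rule has_integral_twiddle[where h = vp and g = pv])
    show "continuous (at x) pv" for x
    proof -
      have "linear pv" by (rule linearI) (simp_all add: pv_def vec_eq_iff forall_2)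
      then show ?thesis by (simp add: linear_continuous_at linear_conv_bounded_linear)
    qed
    show "\<exists>w z. pv ` cbox u v = cbox w z" "\<exists>w z. vp ` cbox u' v' = cbox w z" for u v u' v'
      using vpim pvim by blast+
    show "measure lborel (pv ` cbox u v) = 1 * measure lborel (cbox u v)" for u v
    proof -
      obtain u1 u2 v1 v2 where uv: "u = (u1,u2)" "v = (v1,v2)" by (metis surj_pair)
      show ?thesis
        unfolding pvim unfolding uv
        by (cases "u1 \<le> v1"; cases "u2 \<le> v2")
           (auto simp: content_Pair content_cbox_if_cart UNIV_2 interval_eq_empty_cart ex2 pv_def)
    qed
  qed (use hasI in auto)
  then have "integral (cbox (a,c) (b,d)) (\<lambda>x. (cmod (deriv F (Complex (fst x) (snd x))))\<^sup>2) = I"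
    unfolding vpim by (simp add: lo_def hi_def vp_def cv_pv integral_unique)
  moreover have "continuous_on (cbox (a,c) (b,d)) (\<lambda>x. (cmod (deriv F (Complex (fst x) (snd x))))\<^sup>2)"
    by (intro continuous_intros continuous_on_compose2[OF contd]) (use sub in auto)
  ultimately have "integral (cbox a b) (\<lambda>u. integral (cbox c d) (\<lambda>v. (cmod (deriv F (Complex u v)))\<^sup>2)) = I"
    using integral_prod_continuous by fastforce
  with I_le show ?thesis by simp
qed


text \<open>The length-area inequality: the energies of the vertical segments, that is, the
  integrals of the squared modulus of the derivative, have a bounded integral over \<open>u\<close>.
  Hence in a long interval some segment has energy at most \<epsilon>, and Cauchy-Schwarz turns
  energy into length.\<close>

lemma length_area_strip:
  fixes F :: "complex \<Rightarrow> complex"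
  assumes hol: "F holomorphic_on {w. 0 < Im w \<and> Im w < pi}"
    and inj: "inj_on F {w. 0 < Im w \<and> Im w < pi}"
    and bnd: "bounded (F ` {w. 0 < Im w \<and> Im w < pi})"
    and "\<epsilon> > 0"
  obtains u where "u < u1"
    "\<And>s t. \<lbrakk>0 < s; s \<le> t; t < pi\<rbrakk> \<Longrightarrow> cmod (F (Complex u t) - F (Complex u s)) \<le> sqrt (\<epsilon> * (t - s))"
proof -
  define S where "S = {w. 0 < Im w \<and> Im w < pi}"
  have "open S"
    unfolding S_def by (intro open_Collect_conj open_Collect_less continuous_intros)
  obtain M where M: "F ` S \<subseteq> cball 0 M"
    using bnd bounded_subset_ballD[of "F ` S" 0] ball_subset_cball unfolding S_def by blast
  have contd: "continuous_on S (deriv F)"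
    using hol \<open>open S\<close> S_def by (simp add: holomorphic_deriv holomorphic_on_imp_continuous_on)
  define E where "E u v = (cmod (deriv F (Complex u v)))\<^sup>2" for u v
  have contE: "continuous_on (X \<times> Y) (\<lambda>(u,v). E u v)" if "Y \<subseteq> {0<..<pi}" for X Y
    unfolding E_def case_prod_unfold
    by (intro continuous_intros continuous_on_compose2[OF contd]) (use that in \<open>auto simp: S_def\<close>)
  have contE1: "continuous_on Y (E u)" if "Y \<subseteq> {0<..<pi}" for Y u
    unfolding E_def
    by (intro continuous_intros continuous_on_compose2[OF contd]) (use that in \<open>auto simp: S_def\<close>)
  have E_nonneg: "E u v \<ge> 0" for u v by (simp add: E_def)
  \<comment> \<open>The interval \<open>{u0..u1 - 1}\<close> is longer than
    \<open>(2 * M)\<^sup>2 / \<epsilon>\<close>: if all its segments had energy at least \<epsilon>,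
    the area bound would fail.\<close>
  define u0 where "u0 = u1 - 1 - (2 * M)\<^sup>2 / \<epsilon> - 1"
  define d where "d n = 1 / (real n + 2)" for n
  have d: "0 < d n" "d n < pi - d n" "d n \<le> 1" for n
  proof -
    show "0 < d n" by (simp add: d_def)
    have "d n \<le> 1 / 2" by (simp add: d_def field_simps)
    then show "d n < pi - d n" "d n \<le> 1" using pi_gt3 by auto
  qed
  have dmono: "d m \<le> d n" if "n \<le> m" for m n using that by (simp add: d_def frac_le)
  define I where "I n u = integral {d n..pi - d n} (E u)" for n u
  have intE: "E u integrable_on {s..t}" if "0 < s" "t < pi" for s t u
    using that by (intro integrable_continuous_real contE1) auto
  have contI: "continuous_on {u0..u1 - 1} (I n)" for n
  proof -
    have "continuous_on (cbox u0 (u1 - 1)) (\<lambda>u. integral (cbox (d n) (pi - d n)) (E u))"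
    proof (rule integral_continuous_on_param, rule contE)
      show "cbox (d n) (pi - d n) \<subseteq> {0<..<pi}" using d(1)[of n] by auto
    qed
    then show ?thesis unfolding I_def by simp
  qed
  \<comment> \<open>The segments are open, so the energy is first bounded on the compact pieces
    \<open>{d n..pi - d n}\<close>. The sets of good \<open>u\<close> are compact and decrease with
    \<open>n\<close>, which yields one \<open>u\<close> for all \<open>n\<close>.\<close>
  define U where "U n = {u \<in> {u0..u1 - 1}. I n u \<le> \<epsilon>}" for n
  have Une: "U n \<noteq> {}" for n
  proof
    assume "U n = {}"
    then have gt: "I n u \<ge> \<epsilon>" if "u \<in> {u0..u1 - 1}" for u using that unfolding U_def by force
    have "integral {u0..u1 - 1} (\<lambda>u. \<epsilon>) \<le> integral {u0..u1 - 1} (I n)"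
      by (rule integral_le) (auto intro: gt integrable_continuous_real contI)
    moreover have "integral {u0..u1 - 1} (I n) \<le> (2 * M)\<^sup>2"
      unfolding I_def E_def
      by (rule holomorphic_area_rectangle[OF hol[folded S_def] \<open>open S\<close> inj[folded S_def] M])
         (use d(1)[of n] in \<open>auto simp: S_def\<close>)
    moreover have "u1 - 1 - u0 > (2 * M)\<^sup>2 / \<epsilon>" by (simp add: u0_def)
    then have "\<epsilon> * (u1 - 1 - u0) > (2 * M)\<^sup>2" using \<open>\<epsilon> > 0\<close> by (simp add: field_simps)
    moreover have "u0 \<le> u1 - 1" 
      unfolding u0_def using divide_nonneg_pos[OF zero_le_power2[of "2 * M"] \<open>\<epsilon> > 0\<close>] by linarith
    ultimately show False by (simp add: mult.commute)
  qed
  have Ucomp: "compact (U n)" for n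
  proof -
    have "U n = {u0..u1 - 1} \<inter> I n -` {..\<epsilon>}" by (auto simp: U_def)
    moreover have "closed ({u0..u1 - 1} \<inter> I n -` {..\<epsilon>})"
      by (intro continuous_closed_preimage contI) auto
    ultimately show ?thesis
      by (metis bounded_Int bounded_closed_interval compact_eq_bounded_closed)
  qed
  have Udec: "U m \<subseteq> U n" if "n \<le> m" for m n
  proof -
    have "I n u \<le> I m u" for u
      unfolding I_def using d(1)[of n] d(1)[of m] dmono[OF that] E_nonneg
      by (intro integral_subset_le intE) auto
    then show ?thesis unfolding U_def by (blast intro: order_trans)
  qed
  have "\<Inter>(range U) \<noteq> {}"
    by (rule compact_nest[OF Ucomp Une Udec])
  then obtain u where u: "\<And>n. u \<in> U n" by blast
  have u_lt: "u < u1" using u[of 0] by (auto simp: U_def)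
  show thesis
  proof (rule that[OF u_lt])
    fix s t :: real assume st: "0 < s" "s \<le> t" "t < pi"
    show "cmod (F (Complex u t) - F (Complex u s)) \<le> sqrt (\<epsilon> * (t - s))"
    proof (cases "s = t")
      case False
      then have "s < t" using st by simp
      obtain n where n: "d n \<le> s" "t \<le> pi - d n"
      proof -
        obtain n where "inverse (real (Suc n)) < min s (pi - t)"
          using reals_Archimedean[of "min s (pi - t)"] st by auto
        moreover have "d n \<le> inverse (real (Suc n))" by (simp add: d_def field_simps)
        ultimately show thesis using that[of n] by (smt (verit))
      qed
      have "integral {s..t} (E u) \<le> I n u"
        unfolding I_def using n d(1)[of n] E_nonneg st
        by (intro integral_subset_le intE) auto
      also have "\<dots> \<le> \<epsilon>" using u[of n] by (auto simp: U_def)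
      finally have Eb: "integral {s..t} (E u) \<le> \<epsilon>" .
      \<comment> \<open>For this \<open>k\<close> the two terms of
        \<open>x \<le> (x\<^sup>2 / k + k) / 2\<close> contribute equally to the bound, and the
        elementary inequality yields the Cauchy-Schwarz estimate.\<close>
      define k where "k = sqrt (\<epsilon> / (t - s))"
      have k: "k > 0" "k\<^sup>2 = \<epsilon> / (t - s)" using \<open>\<epsilon> > 0\<close> \<open>s < t\<close> by (auto simp: k_def)
      define D where "D v = deriv F (Complex u v) * \<i>" for v
      have "((\<lambda>v. F (Complex u v)) has_vector_derivative D v) (at v within {s..t})" if "v \<in> {s..t}" for v
      proof -
        have "Complex u v \<in> S" using that st by (auto simp: S_def)
        then have "(F has_field_derivative deriv F (Complex u v)) (at (Complex u v))"
          using holomorphic_derivI[OF hol[folded S_def] \<open>open S\<close>] by blast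
        moreover have "(Complex u has_vector_derivative \<i>) (at v within {s..t})"
        proof -
          have "Complex u = (\<lambda>v. of_real u + of_real v * \<i>)" by (auto simp: complex_eq_iff)
          then show ?thesis by (auto intro!: derivative_eq_intros)
        qed
        ultimately show ?thesis
          using field_vector_diff_chain_within[of "Complex u" \<i> v "{s..t}" F]
          by (auto simp: D_def o_def mult.commute[of _ \<i>] intro: has_field_derivative_at_within)
      qed
      then have ftc: "(D has_integral (F (Complex u t) - F (Complex u s))) {s..t}"
        using st by (intro fundamental_theorem_of_calculus)
      have "cmod (F (Complex u t) - F (Complex u s)) = norm (integral {s..t} D)"
        using ftc by (simp add: integral_unique)
      also have "\<dots> \<le> integral {s..t} (\<lambda>v. (E u v / k + k) / 2)"
      proof (rule integral_norm_bound_integral)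
        show "D integrable_on {s..t}" using ftc by blast
        show "(\<lambda>v. (E u v / k + k) / 2) integrable_on {s..t}"
          using st by (intro integrable_continuous_real continuous_intros contE1) (use k in auto)
        show "cmod (D v) \<le> (E u v / k + k) / 2" for v
        proof -
          have "0 \<le> (cmod (D v) - k)\<^sup>2" by simp
          then have "2 * cmod (D v) * k \<le> E u v + k\<^sup>2"
            by (simp add: D_def E_def norm_mult power2_eq_square algebra_simps)
          then show ?thesis using k by (simp add: field_simps power2_eq_square)
        qed
      qed
      also have "\<dots> = (integral {s..t} (E u) / k + k * (t - s)) / 2"
      proof (rule integral_unique)
        have "((\<lambda>v. k) has_integral (k * (t - s))) {s..t}"
          using has_integral_const_real[of k s t] st by (simp add: mult.commute)
        then show "((\<lambda>v. (E u v / k + k) / 2) has_integral (integral {s..t} (E u) / k + k * (t - s)) / 2) {s..t}"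
          using integrable_integral[OF intE[of s t u]] st by (intro has_integral_divide has_integral_add) auto
      qed
      also have "\<dots> \<le> (\<epsilon> / k + k * (t - s)) / 2"
        using Eb k by (simp add: divide_right_mono)
      also have "\<dots> = k * (t - s)"
      proof -
        have "\<epsilon> = k * k * (t - s)" using k(2) \<open>s < t\<close> by (simp add: power2_eq_square)
        then show ?thesis using k(1) by simp
      qed
      also have "\<dots> = sqrt (\<epsilon> * (t - s))"
      proof -
        have "sqrt ((k * (t - s))\<^sup>2) = k * (t - s)"
          using k(1) \<open>s < t\<close> by (simp add: real_sqrt_abs abs_mult)
        moreover have "(k * (t - s))\<^sup>2 = \<epsilon> * (t - s)"
          using \<open>s < t\<close> unfolding power_mult_distrib k(2) by (simp add: power2_eq_square)
        ultimately show ?thesis by metis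
      qed
      finally show ?thesis .
    qed simp
  qed
qed

text \<open>A Lebesgue number of a cover by small connected neighbourhoods makes local connectedness
  uniform; taking closures makes the connecting sets compact.\<close>

lemma locally_connected_compact_small_connected:
  fixes J :: "'a::metric_space set"
  assumes "compact J" "locally connected J" "0 < \<eta>"
  obtains \<delta> where "0 < \<delta>"
    "\<And>x y. \<lbrakk>x \<in> J; y \<in> J; dist x y < \<delta>\<rbrakk> \<Longrightarrow>
       \<exists>K. K \<subseteq> J \<and> compact K \<and> connected K \<and> x \<in> K \<and> y \<in> K \<and> K \<subseteq> cball x \<eta>"
proof -
  have "\<exists>W V. open W \<and> connected V \<and> x \<in> W \<and> J \<inter> W \<subseteq> V \<and> V \<subseteq> J \<inter> ball x (\<eta>/2)" if "x \<in> J" for x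
  proof -
    have "openin (top_of_set J) (J \<inter> ball x (\<eta>/2))" "x \<in> J \<inter> ball x (\<eta>/2)"
      using that \<open>0 < \<eta>\<close> by auto
    then obtain U V where UV: "openin (top_of_set J) U" "connected V" "x \<in> U" "U \<subseteq> V" "V \<subseteq> J \<inter> ball x (\<eta>/2)"
      using \<open>locally connected J\<close> unfolding locally_def by metis
    then obtain W where "open W" "U = J \<inter> W" by (auto simp: openin_open)
    with UV show ?thesis by (intro exI[of _ W] exI[of _ V]) auto
  qed
  then obtain W V where WV: "\<And>x. x \<in> J \<Longrightarrow> open (W x) \<and> connected (V x) \<and> x \<in> W x \<and> J \<inter> W x \<subseteq> V x \<and> V x \<subseteq> J \<inter> ball x (\<eta>/2)"
    by metis
  obtain \<delta> where "0 < \<delta>" and \<delta>: "\<And>x. x \<in> J \<Longrightarrow> \<exists>G\<in>W ` J. ball x \<delta> \<subseteq> G"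
  proof -
    have "J \<subseteq> \<Union>(W ` J)" "\<And>G. G \<in> W ` J \<Longrightarrow> open G" using WV by blast+
    then show thesis using Heine_Borel_lemma[OF \<open>compact J\<close>] that by metis
  qed
  show thesis
  proof (rule that[OF \<open>0 < \<delta>\<close>])
    fix x y assume xy: "x \<in> J" "y \<in> J" "dist x y < \<delta>"
    then obtain z where z: "z \<in> J" "ball x \<delta> \<subseteq> W z" using \<delta> by blast
    have "x \<in> ball x \<delta>" "y \<in> ball x \<delta>" using xy \<open>0 < \<delta>\<close> by auto
    then have in_V: "x \<in> V z" "y \<in> V z" using xy(1,2) z(2) WV[OF z(1)] by blast+
    have clV: "closure (V z) \<subseteq> J" "closure (V z) \<subseteq> cball z (\<eta>/2)"
      using WV[OF z(1)] \<open>compact J\<close> compact_imp_closed ball_subset_cball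
      by (meson closed_cball closure_minimal le_infE order_trans)+
    have "dist z x \<le> \<eta>/2" using in_V(1) WV[OF z(1)] by auto
    then have "closure (V z) \<subseteq> cball x \<eta>"
      using clV(2) by (auto simp: subset_iff) (smt (verit) dist_commute dist_triangle field_sum_of_halves)
    moreover have "compact (closure (V z))" "connected (closure (V z))"
      using clV(1) \<open>compact J\<close> WV[OF z(1)] closed_closure compact_Int_closed connected_imp_connected_closure
      by (metis inf.absorb2, blast)
    ultimately show "\<exists>K. K \<subseteq> J \<and> compact K \<and> connected K \<and> x \<in> K \<and> y \<in> K \<and> K \<subseteq> cball x \<eta>"
      using clV(1) in_V closure_subset by (intro exI[of _ "closure (V z)"]) blast
  qed
qed

lemma connected_subset_inside_Jordan:
  fixes c :: "real \<Rightarrow> complex"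
  assumes "simple_path c" "pathfinish c = pathstart c"
    and "connected Q" "Q \<inter> path_image c = {}" "Q \<inter> inside (path_image c) \<noteq> {}"
  shows "Q \<subseteq> inside (path_image c)"
proof (rule ccontr)
  assume "\<not> Q \<subseteq> inside (path_image c)"
  then have "Q \<inter> frontier (inside (path_image c)) \<noteq> {}"
    using assms connected_Int_frontier[of Q "inside (path_image c)"] by blast
  then show False using Jordan_inside_outside[OF assms(1,2)] assms(4) by auto
qed

text \<open>Some vertical crosscut has a short image, whose ends on the Jordan curve
  \<open>J\<close> are joined by a small continuum \<open>K\<close> in \<open>J\<close>. If a point
  left of the crosscut had its image outside a small disc around both, Janiszewski's theorem would
  join this image to that of the base point \<open>w0\<close> off \<open>J\<close> and off the
  crosscut, which separates the two points in the strip.\<close>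

lemma conformal_strip_end_small:
  fixes F :: "complex \<Rightarrow> complex" and c :: "real \<Rightarrow> complex"
  assumes c: "simple_path c" "pathfinish c = pathstart c"
    and hol: "F holomorphic_on {w. 0 < Im w \<and> Im w < pi}"
    and hom: "homeomorphism {w. 0 < Im w \<and> Im w < pi} (inside (path_image c)) F G"
    and "0 < \<epsilon>"
  obtains u where "\<And>w w'. \<lbrakk>0 < Im w; Im w < pi; Re w < u; 0 < Im w'; Im w' < pi; Re w' < u\<rbrakk>
     \<Longrightarrow> dist (F w) (F w') < \<epsilon>"
proof -
  define S where "S = {w. 0 < Im w \<and> Im w < pi}"
  define J where "J = path_image c"
  define \<Omega> where "\<Omega> = inside J"
  note Jord = Jordan_inside_outside[OF c, folded J_def, folded \<Omega>_def]
  have "open \<Omega>" "connected \<Omega>" "bounded \<Omega>" "frontier \<Omega> = J" using Jord by auto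
  have J\<Omega>: "J \<inter> \<Omega> = {}" using \<open>open \<Omega>\<close> \<open>frontier \<Omega> = J\<close> by (auto simp: frontier_def interior_open)
  have hom': "homeomorphism S \<Omega> F G" using hom by (simp add: S_def \<Omega>_def J_def)
  have FS: "F ` S = \<Omega>" and GF: "\<And>w. w \<in> S \<Longrightarrow> G (F w) = w" and contG: "continuous_on \<Omega> G" and FG: "\<And>x. x \<in> \<Omega> \<Longrightarrow> F (G x) = x"
    and G\<Omega>: "G ` \<Omega> = S"
    using hom' by (auto simp: homeomorphism_def)
  have inj: "inj_on F S" using GF by (metis inj_onI)
  have "compact J" unfolding J_def using c by (simp add: compact_simple_path_image)
  have "J homeomorphic sphere (0::complex) 1"
    unfolding J_def using c homeomorphic_simple_path_image_circle by (metis zero_less_one)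
  then have "locally connected J"
    using homeomorphic_locally[of J _ connected connected] homeomorphic_connectedness locally_connected_sphere by metis
  define w0 where "w0 = Complex 0 (pi/2)"
  have "w0 \<in> S" by (simp add: w0_def S_def)
  then have "F w0 \<in> \<Omega>" using FS by blast
  then obtain d0 where "d0 > 0" and d0: "ball (F w0) d0 \<subseteq> \<Omega>"
    using \<open>open \<Omega>\<close> openE by blast
  \<comment> \<open>Two points of a disc of radius \<eta> have distance less than \<epsilon>, and
    \<eta> < \<open>d0\<close> keeps \<open>F w0\<close> out of every such disc centred on
    \<open>J\<close>.\<close>
  define \<eta> where "\<eta> = min (\<epsilon>/3) (d0/2)"
  have \<eta>: "\<eta> > 0" "2 * \<eta> < \<epsilon>" "\<eta> < d0" using \<open>0 < \<epsilon>\<close> \<open>0 < d0\<close> by (auto simp: \<eta>_def)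
  obtain \<delta> where "0 < \<delta>" and \<delta>: "\<And>x y. \<lbrakk>x \<in> J; y \<in> J; dist x y < \<delta>\<rbrakk> \<Longrightarrow>
       \<exists>K. K \<subseteq> J \<and> compact K \<and> connected K \<and> x \<in> K \<and> y \<in> K \<and> K \<subseteq> cball x \<eta>"
    using locally_connected_compact_small_connected[OF \<open>compact J\<close> \<open>locally connected J\<close> \<open>0 < \<eta>\<close>] by blast
  \<comment> \<open>Oscillation below \<delta> brings the ends of the crosscut within reach of a
    small \<open>K\<close>; oscillation below \<eta> keeps the crosscut in the disc around
    \<open>g 0\<close>.\<close>
  define \<kappa> where "\<kappa> = min \<delta> \<eta> / 2"
  have \<kappa>: "\<kappa> > 0" "\<kappa> < \<delta>" "\<kappa> < \<eta>" using \<open>0 < \<delta>\<close> \<eta> by (auto simp: \<kappa>_def)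
  have bF: "bounded (F ` S)" using FS \<open>bounded \<Omega>\<close> by simp
  \<comment> \<open>The factor \<open>1 / pi\<close> makes the oscillation bound on the full
    segment, which has length \<open>pi\<close>, equal to \<kappa>.\<close>
  have "0 < \<kappa>\<^sup>2 / pi" using \<kappa> by simp
  obtain u where "u < 0" and u: "\<And>s t. \<lbrakk>0 < s; s \<le> t; t < pi\<rbrakk> \<Longrightarrow>
      cmod (F (Complex u t) - F (Complex u s)) \<le> sqrt (\<kappa>\<^sup>2 / pi * (t - s))"
    using length_area_strip[OF hol inj[unfolded S_def] bF[unfolded S_def] \<open>0 < \<kappa>\<^sup>2 / pi\<close>, of 0] by blast
  define h where "h t = F (Complex u t)" for t
  have h_dist: "dist (h s) (h t) \<le> \<kappa> / sqrt pi * sqrt \<bar>t - s\<bar>" if "s \<in> {0<..<pi}" "t \<in> {0<..<pi}" for s t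
  proof -
    have "sqrt (\<kappa>\<^sup>2 / pi * x) = \<kappa> / sqrt pi * sqrt x" for x
      using \<kappa> by (simp add: real_sqrt_mult real_sqrt_divide)
    then show ?thesis
      using u[of s t] u[of t s] that unfolding h_def
      by (cases "s \<le> t") (auto simp: dist_norm norm_minus_commute abs_if)
  qed
  have h_dist': "dist (h s) (h t) \<le> \<kappa>" if "s \<in> {0<..<pi}" "t \<in> {0<..<pi}" for s t
  proof -
    have "sqrt \<bar>t - s\<bar> \<le> sqrt pi" using that by auto
    then have "\<kappa> / sqrt pi * sqrt \<bar>t - s\<bar> \<le> \<kappa> / sqrt pi * sqrt pi" using \<kappa> by (intro mult_left_mono) auto
    also have "\<dots> = \<kappa>" by simp
    finally show ?thesis using h_dist[OF that] by simp
  qed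
  have "uniformly_continuous_on {0<..<pi} h"
    unfolding uniformly_continuous_on_def
  proof (intro allI impI)
    fix e :: real assume "e > 0"
    define d where "d = (e * sqrt pi / \<kappa>)\<^sup>2"
    have "d > 0" using \<open>e > 0\<close> \<kappa> by (simp add: d_def)
    moreover have "dist (h t) (h s) < e" if "s \<in> {0<..<pi}" "t \<in> {0<..<pi}" "dist t s < d" for s t
    proof -
      have "sqrt \<bar>t - s\<bar> < sqrt d" using that by (simp add: dist_real_def)
      also have "\<dots> = e * sqrt pi / \<kappa>" using \<open>e > 0\<close> \<kappa> by (simp add: d_def)
      finally have "\<kappa> / sqrt pi * sqrt \<bar>t - s\<bar> < e" using \<kappa> by (simp add: field_simps)
      then show ?thesis using h_dist[OF that(1,2)] by (simp add: dist_commute)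
    qed
    ultimately show "\<exists>d>0. \<forall>x\<in>{0<..<pi}. \<forall>x'\<in>{0<..<pi}. dist x' x < d \<longrightarrow> dist (h x') (h x) < e"
      by blast
  qed
  then obtain g where g: "uniformly_continuous_on (closure {0<..<pi}) g" "\<And>x. x \<in> {0<..<pi} \<Longrightarrow> h x = g x"
    using uniformly_continuous_on_extension_on_closure by metis
  then have contg: "continuous_on {0..pi} g" by (simp add: uniformly_continuous_imp_continuous)
  have h\<Omega>: "h t \<in> \<Omega>" if "t \<in> {0<..<pi}" for t using that FS by (auto simp: h_def S_def)
  \<comment> \<open>If the limit lay inside, continuity of \<open>G\<close> there would make the
    vertical segment converge to a point of the open strip, whereas its imaginary part tends to 0 or
    \<open>pi\<close>.\<close>
  have gJ: "g s \<in> J" if "s = 0 \<or> s = pi" for s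
  proof -
    have nontriv: "at s within {0<..<pi} \<noteq> bot"
      using that by (auto simp: trivial_limit_within islimpt_greaterThanLessThan1 islimpt_greaterThanLessThan2)
    have lim: "(g \<longlongrightarrow> g s) (at s within {0<..<pi})"
      using contg that unfolding continuous_on_def
      by (metis atLeastAtMost_iff greaterThanLessThan_subseteq_atLeastAtMost_iff order_refl pi_ge_zero tendsto_within_subset)
    have ev: "eventually (\<lambda>t. t \<in> {0<..<pi}) (at s within {0<..<pi})"
      by (simp add: eventually_at_filter)
    have limh: "(h \<longlongrightarrow> g s) (at s within {0<..<pi})"
      using lim by (rule Lim_transform_eventually) (use ev g(2) in \<open>auto elim: eventually_mono\<close>)
    have "g s \<in> closure \<Omega>"
      by (rule Lim_in_closed_set[OF closed_closure _ nontriv limh])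
         (use ev h\<Omega> closure_subset in \<open>auto elim!: eventually_mono\<close>)
    moreover have False if gs: "g s \<in> \<Omega>"
    proof -
      have "isCont G (g s)" using contG \<open>open \<Omega>\<close> gs continuous_on_eq_continuous_at by blast
      then have "((\<lambda>t. G (h t)) \<longlongrightarrow> G (g s)) (at s within {0<..<pi})"
        using limh isCont_tendsto_compose by blast
      then have "((\<lambda>t. Complex u t) \<longlongrightarrow> G (g s)) (at s within {0<..<pi})"
        by (rule Lim_transform_eventually) (use ev in \<open>auto elim!: eventually_mono simp: h_def GF S_def\<close>)
      then have "((\<lambda>t. Im (Complex u t)) \<longlongrightarrow> Im (G (g s))) (at s within {0<..<pi})"
        by (rule tendsto_Im)
      moreover have "((\<lambda>t. Im (Complex u t)) \<longlongrightarrow> s) (at s within {0<..<pi})" by simp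
      ultimately have "Im (G (g s)) = s" using tendsto_unique nontriv by blast
      moreover have "G (g s) \<in> S" using G\<Omega> gs by blast
      ultimately show False using \<open>s = 0 \<or> s = pi\<close> by (auto simp: S_def)
    qed
    ultimately show ?thesis using \<open>frontier \<Omega> = J\<close> \<open>open \<Omega>\<close> by (auto simp: frontier_def interior_open)
  qed
  have g_dist: "dist (g 0) (g t) \<le> \<kappa>" if "t \<in> {0..pi}" for t
  proof -
    have "t \<in> closure {0<..<pi}" "0 \<in> closure {0<..<pi}" using that by auto
    have half: "dist (g s) (g t) \<le> \<kappa>" if "s \<in> {0<..<pi}" for s
    proof (rule continuous_ge_on_closure[of "{0<..<pi}" "\<lambda>t. \<kappa> - dist (g s) (g t)" t 0, simplified])
      show "continuous_on {0..pi} (\<lambda>t. \<kappa> - dist (g s) (g t))"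
        by (intro continuous_intros contg)
      show "0 \<le> t \<and> t \<le> pi" using \<open>t \<in> {0..pi}\<close> by simp
      show "\<And>x. 0 < x \<and> x < pi \<Longrightarrow> dist (g s) (g x) \<le> \<kappa>"
        using h_dist' g(2) that by (metis greaterThanLessThan_iff)
    qed
    show ?thesis
    proof (rule continuous_ge_on_closure[of "{0<..<pi}" "\<lambda>s. \<kappa> - dist (g s) (g t)" 0 0, simplified])
      show "continuous_on {0..pi} (\<lambda>s. \<kappa> - dist (g s) (g t))"
        by (intro continuous_intros contg)
      show "\<And>x. 0 < x \<and> x < pi \<Longrightarrow> dist (g x) (g t) \<le> \<kappa>" using half by auto
    qed
  qed
  have "dist (g 0) (g pi) < \<delta>" using g_dist[of pi] \<kappa> by simp
  then obtain K where K: "K \<subseteq> J" "compact K" "connected K" "g 0 \<in> K" "g pi \<in> K" "K \<subseteq> cball (g 0) \<eta>"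
    using \<delta>[OF gJ[of 0] gJ[of pi]] by auto
  define T where "T = g ` {0..pi} \<union> K"
  have "compact T" unfolding T_def using contg K by (intro compact_Un compact_continuous_image) auto
  have T_sub: "T \<subseteq> cball (g 0) \<eta>" unfolding T_def using g_dist K \<kappa> by force
  \<comment> \<open>Janiszewski's theorem requires a connected intersection.\<close>
  have "J \<inter> T = K"
  proof -
    have "x \<in> K" if "x \<in> J" "x = g t" "t \<in> {0..pi}" for x t
    proof (cases "t = 0 \<or> t = pi")
      case False
      then have "x \<in> \<Omega>" using that h\<Omega>[of t] g(2)[of t] by auto
      then show ?thesis using J\<Omega> that by blast
    qed (use K that in auto)
    then show ?thesis using K unfolding T_def by blast
  qed
  have b0: "F w0 \<notin> cball (g 0) \<eta>"
  proof
    assume "F w0 \<in> cball (g 0) \<eta>"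
    then have "g 0 \<in> ball (F w0) d0" using \<eta> by (simp add: dist_commute)
    then show False using d0 gJ[of 0] J\<Omega> by blast
  qed
  have small: "F w \<in> cball (g 0) \<eta>" if "w \<in> S" "Re w < u" for w
  proof (rule ccontr)
    assume notin: "F w \<notin> cball (g 0) \<eta>"
    have "connected_component (- T) (F w) (F w0)"
      unfolding connected_component_def
    proof (intro exI conjI)
      show "connected (- cball (g 0) \<eta>)" by (rule connected_complement_bounded_convex) auto
    qed (use T_sub notin b0 in auto)
    moreover have "connected_component (- J) (F w) (F w0)"
      unfolding connected_component_def
      using \<open>connected \<Omega>\<close> J\<Omega> FS \<open>w0 \<in> S\<close> that by (intro exI[of _ \<Omega>]) auto
    ultimately have "connected_component (- (J \<union> T)) (F w) (F w0)"
      using Janiszewski[OF \<open>compact J\<close>] \<open>compact T\<close> compact_imp_closed \<open>J \<inter> T = K\<close> K(3) by metis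
    then obtain Q where Q: "connected Q" "Q \<subseteq> - (J \<union> T)" "F w \<in> Q" "F w0 \<in> Q"
      unfolding connected_component_def by blast
    have "F w \<in> \<Omega>" using FS that by blast
    then have "Q \<subseteq> \<Omega>"
      using connected_subset_inside_Jordan[OF c Q(1)] Q unfolding \<Omega>_def J_def by blast
    then have "connected (G ` Q)"
      using Q(1) contG connected_continuous_image continuous_on_subset by blast
    then have "connected (Re ` G ` Q)"
      by (rule connected_continuous_image[OF continuous_on_Re[OF continuous_on_id]])
    moreover have "Re w \<in> Re ` G ` Q" "Re w0 \<in> Re ` G ` Q"
      using Q GF that \<open>w0 \<in> S\<close> by force+
    ultimately have "u \<in> Re ` G ` Q"
      using connectedD_interval[of "Re ` G ` Q" "Re w" "Re w0" u] that \<open>u < 0\<close> by (simp add: w0_def)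
    then obtain x where x: "x \<in> Q" "Re (G x) = u" by auto
    have "G x \<in> S" using x \<open>Q \<subseteq> \<Omega>\<close> G\<Omega> by blast
    then have t: "Im (G x) \<in> {0<..<pi}" by (simp add: S_def)
    have "x = F (Complex u (Im (G x)))"
      using FG[of x] x \<open>Q \<subseteq> \<Omega>\<close> by (metis complex.collapse subsetD)
    then have "x = g (Im (G x))" using g(2)[OF t] by (simp add: h_def)
    then have "x \<in> T" using t unfolding T_def by auto
    then show False using x Q by blast
  qed
  show thesis
  proof (rule that[of u])
    fix w w' assume "0 < Im w" "Im w < pi" "Re w < u" "0 < Im w'" "Im w' < pi" "Re w' < u"
    then have "F w \<in> cball (g 0) \<eta>" "F w' \<in> cball (g 0) \<eta>"
      using small by (auto simp: S_def)
    then show "dist (F w) (F w') < \<epsilon>"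
      using \<eta>(2) dist_triangle2[of "F w" "F w'" "g 0"] by (auto simp: dist_commute)
  qed
qed

section \<open>The extension of the Riemann map to a Jordan domain\<close>

text \<open>Twice the signed area of the triangle \<open>p\<close>, \<open>q\<close>,
  \<open>z\<close>, positive when these corners are in counterclockwise order.\<close>

definition orient :: "complex \<Rightarrow> complex \<Rightarrow> complex \<Rightarrow> real" where
  "orient p q z = Im (cnj (q - p) * (z - p))"

lemma orient_refl [simp]: "orient p q p = 0" "orient p q q = 0" "orient p p z = 0"
  by (simp_all add: orient_def algebra_simps)

lemma orient_swap: "orient q p z = - orient p q z"
  by (simp add: orient_def algebra_simps)

lemma orient_cycle: "orient q r p = orient p q r"
  by (simp add: orient_def algebra_simps)

lemma orient_affine: "orient p q ((1 - u) *\<^sub>R a + u *\<^sub>R b) = (1 - u) * orient p q a + u * orient p q b"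
  by (simp add: orient_def algebra_simps)

lemma continuous_orient [continuous_intros]:
  "continuous_on S f \<Longrightarrow> continuous_on S (\<lambda>x. orient p q (f x))"
  unfolding orient_def by (intro continuous_intros)

lemma open_orient_pos: "open {z. 0 < orient p q z}"
  by (intro open_Collect_less continuous_intros)

lemma convex_orient_pos: "convex {z. 0 < orient p q z}"
  unfolding convex_alt by (auto simp: orient_affine) (metis add_nonneg_pos add_pos_nonneg diff_ge_0_iff_ge
    less_eq_real_def mult_nonneg_nonneg mult_pos_pos mult_zero_left diff_gt_0_iff_gt add.right_neutral mult_1)

lemma orient_eq_0_line:
  assumes "p \<noteq> q" "orient p q z = 0"
  obtains t :: real where "z = p + of_real t * (q - p)"
proof -
  define d where "d = q - p"
  have "d \<noteq> 0" using assms by (simp add: d_def)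
  define t where "t = Re (cnj d * (z - p)) / (norm d)\<^sup>2"
  have "cnj d * (z - p) = of_real (Re (cnj d * (z - p)))"
    using assms(2) by (simp add: complex_eq_iff orient_def d_def)
  also have "\<dots> = of_real t * (cnj d * d)"
    using \<open>d \<noteq> 0\<close> by (simp add: t_def complex_norm_square[symmetric] mult.commute[of "cnj d"] flip: of_real_power)
  finally have "cnj d * (z - p - of_real t * d) = 0" by (simp add: algebra_simps)
  then have "z - p - of_real t * d = 0" using \<open>d \<noteq> 0\<close> by simp
  then have "z = p + of_real t * (q - p)" by (simp add: algebra_simps d_def)
  then show thesis by (rule that)
qed

text \<open>The power of a point on the line through \<open>p\<close> and \<open>q\<close>; for
  \<open>p \<noteq> q\<close> it shows that the line is inside the disc exactly for parameters
  strictly between 0 and 1.\<close>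

lemma norm_sphere_line:
  fixes p q :: complex
  assumes "norm p = 1" "norm q = 1"
  shows "(norm (p + of_real t * (q - p)))\<^sup>2 = 1 - t * (1 - t) * (norm (q - p))\<^sup>2"
proof -
  define d where "d = q - p"
  have "(norm (p + of_real t * d))\<^sup>2 = (norm p)\<^sup>2 + 2 * t * Re (cnj p * d) + t\<^sup>2 * (norm d)\<^sup>2"
    unfolding cmod_power2 by (simp add: power2_eq_square algebra_simps)
  moreover have "(norm q)\<^sup>2 = (norm p)\<^sup>2 + 2 * Re (cnj p * d) + (norm d)\<^sup>2"
    unfolding d_def cmod_power2 by (simp add: power2_eq_square algebra_simps)
  then have "2 * Re (cnj p * d) = - (norm d)\<^sup>2" using assms by simp
  moreover have "2 * t * Re (cnj p * d) = t * (2 * Re (cnj p * d))" by simp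
  ultimately have "(norm (p + of_real t * d))\<^sup>2 = (norm p)\<^sup>2 + t * (- (norm d)\<^sup>2) + t\<^sup>2 * (norm d)\<^sup>2"
    by simp
  also have "\<dots> = 1 - t * (1 - t) * (norm d)\<^sup>2"
    using assms by (simp add: power2_eq_square algebra_simps)
  finally show ?thesis unfolding d_def .
qed

lemma orient_eq_0_ball_imp_open_segment:
  assumes "norm p = 1" "norm q = 1" "p \<noteq> q" "norm z < 1" "orient p q z = 0"
  shows "z \<in> open_segment p q"
proof -
  obtain t :: real where z: "z = p + of_real t * (q - p)" using orient_eq_0_line assms by blast
  have "(norm z)\<^sup>2 < 1" using assms by (simp add: abs_square_less_1)
  then have "t * (1 - t) * (norm (q - p))\<^sup>2 > 0" using norm_sphere_line[OF assms(1,2), of t] z by simp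
  then have "t * (1 - t) > 0" by (simp add: zero_less_mult_iff)
  then have "0 < t" "t < 1" by (auto simp: zero_less_mult_iff)
  then show ?thesis
    using assms(3) unfolding in_segment z by (intro conjI exI[of _ t]) (auto simp: algebra_simps scaleR_conv_of_real)
qed

lemma orient_eq_0_sphere:
  assumes "norm p = 1" "norm q = 1" "norm r = 1" "p \<noteq> q" "orient p q r = 0"
  shows "r = p \<or> r = q"
proof -
  obtain t :: real where r: "r = p + of_real t * (q - p)" using orient_eq_0_line assms by blast
  then have "t * (1 - t) * (norm (q - p))\<^sup>2 = 0" using norm_sphere_line[OF assms(1,2), of t] assms(3) by simp
  then show ?thesis using r assms(4) by auto
qed

lemma orient_open_segment: "z \<in> open_segment p q \<Longrightarrow> orient p q z = 0"
  by (auto simp: in_segment orient_affine)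

lemma open_segment_sphere_subset_ball:
  fixes p q :: complex
  assumes "norm p = 1" "norm q = 1"
  shows "open_segment p q \<subseteq> ball 0 1"
  using assms dist_decreases_open_segment[of _ p q 0] by fastforce


text \<open>\<open>exp\<close> maps the strip onto the upper half plane, and a Cayley transform maps
  this onto the disc and 0 to \<open>\<zeta>\<close>. So the left end of the strip corresponds to
  the boundary point \<open>\<zeta>\<close>.\<close>

lemma homeomorphism_strip_disc:
  assumes "norm \<zeta> = 1"
  shows "homeomorphism {w. 0 < Im w \<and> Im w < pi} (ball 0 1)
     (\<lambda>w. \<zeta> * (\<i> - exp w) / (\<i> + exp w)) (\<lambda>v. Ln (\<i> * (\<zeta> - v) / (\<zeta> + v)))"
proof -
  let ?S = "{w. 0 < Im w \<and> Im w < pi}"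
  have ne: "\<i> + z \<noteq> 0" if "Im z > 0" for z
    using that by (auto simp: complex_eq_iff)
  have Im_exp_pos: "Im (exp w) > 0" if "w \<in> ?S" for w
    using that by (simp add: Im_exp sin_gt_zero)
  have ne2: "\<zeta> + v \<noteq> 0" if "v \<in> ball 0 1" for v
    using that assms by (metis add_eq_0_iff dist_0_norm less_irrefl mem_ball norm_minus_cancel)
  have Im_pos: "Im (\<i> * (\<zeta> - v) / (\<zeta> + v)) > 0" if "v \<in> ball 0 1" for v
  proof -
    have "(\<i> * (\<zeta> - v) / (\<zeta> + v)) = \<i> * ((\<zeta> - v) * cnj (\<zeta> + v)) / of_real ((norm (\<zeta> + v))\<^sup>2)"
      by (subst complex_div_cnj) simp
    also have "Im \<dots> = Re ((\<zeta> - v) * cnj (\<zeta> + v)) / (norm (\<zeta> + v))\<^sup>2"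
      by (simp only: Im_divide_of_real) simp
    also have "Re ((\<zeta> - v) * cnj (\<zeta> + v)) = (norm \<zeta>)\<^sup>2 - (norm v)\<^sup>2"
      unfolding cmod_power2 by (simp add: algebra_simps power2_eq_square)
    finally have *: "Im (\<i> * (\<zeta> - v) / (\<zeta> + v)) = ((norm \<zeta>)\<^sup>2 - (norm v)\<^sup>2) / (norm (\<zeta> + v))\<^sup>2" .
    have "(norm v)\<^sup>2 < 1" using that by (simp add: abs_square_less_1)
    then show ?thesis unfolding * using assms ne2[OF that] by simp
  qed
  show ?thesis
  proof (rule homeomorphismI)
    show "continuous_on ?S (\<lambda>w. \<zeta> * (\<i> - exp w) / (\<i> + exp w))"
      using ne Im_exp_pos by (intro continuous_intros) auto
    show "continuous_on (ball 0 1) (\<lambda>v. Ln (\<i> * (\<zeta> - v) / (\<zeta> + v)))"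
    proof (rule continuous_on_Ln')
      show "continuous_on (ball 0 1) (\<lambda>v. \<i> * (\<zeta> - v) / (\<zeta> + v))"
        using ne2 by (intro continuous_intros) auto
    qed (use Im_pos in \<open>force simp: complex_nonpos_Reals_iff\<close>)
    show "(\<lambda>w. \<zeta> * (\<i> - exp w) / (\<i> + exp w)) ` ?S \<subseteq> ball 0 1"
    proof clarify
      fix w :: complex assume "0 < Im w" "Im w < pi"
      then have "Im (exp w) > 0" using Im_exp_pos by blast
      then have "(norm (\<i> - exp w))\<^sup>2 < (norm (\<i> + exp w))\<^sup>2"
        unfolding cmod_power2 by (simp add: power2_eq_square algebra_simps)
      then have "norm (\<i> - exp w) < norm (\<i> + exp w)" by (simp add: power_less_imp_less_base)
      then show "\<zeta> * (\<i> - exp w) / (\<i> + exp w) \<in> ball 0 1"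
        using assms ne[OF \<open>Im (exp w) > 0\<close>] by (simp add: norm_mult norm_divide)
    qed
    show "(\<lambda>v. Ln (\<i> * (\<zeta> - v) / (\<zeta> + v))) ` ball 0 1 \<subseteq> ?S"
      using Im_pos Im_Ln_pos_lt_imp by blast
    show "Ln (\<i> * (\<zeta> - \<zeta> * (\<i> - exp w) / (\<i> + exp w)) / (\<zeta> + \<zeta> * (\<i> - exp w) / (\<i> + exp w))) = w"
      if "w \<in> ?S" for w
    proof -
      have n: "\<i> + exp w \<noteq> 0" using ne Im_exp_pos that by blast
      have "\<zeta> \<noteq> 0" using assms by auto
      have "\<zeta> - \<zeta> * (\<i> - exp w) / (\<i> + exp w) = \<zeta> * (2 * exp w) / (\<i> + exp w)"
        "\<zeta> + \<zeta> * (\<i> - exp w) / (\<i> + exp w) = \<zeta> * (2 * \<i>) / (\<i> + exp w)"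
        using n by (simp_all add: field_simps)
      then have "\<i> * (\<zeta> - \<zeta> * (\<i> - exp w) / (\<i> + exp w)) / (\<zeta> + \<zeta> * (\<i> - exp w) / (\<i> + exp w)) = exp w"
        using n \<open>\<zeta> \<noteq> 0\<close> by simp
      then show ?thesis using that by simp
    qed
    show "\<zeta> * (\<i> - exp (Ln (\<i> * (\<zeta> - v) / (\<zeta> + v)))) / (\<i> + exp (Ln (\<i> * (\<zeta> - v) / (\<zeta> + v)))) = v"
      if "v \<in> ball 0 1" for v
    proof -
      have n: "\<zeta> + v \<noteq> 0" using ne2 that by blast
      have "\<zeta> \<noteq> 0" using assms by auto
      have nz: "\<i> * (\<zeta> - v) / (\<zeta> + v) \<noteq> 0" using Im_pos[OF that] by force
      have "\<i> - \<i> * (\<zeta> - v) / (\<zeta> + v) = \<i> * (2 * v) / (\<zeta> + v)"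
        "\<i> + \<i> * (\<zeta> - v) / (\<zeta> + v) = \<i> * (2 * \<zeta>) / (\<zeta> + v)"
        using n by (simp_all add: field_simps)
      then show ?thesis using n \<open>\<zeta> \<noteq> 0\<close> by (simp add: exp_Ln[OF nz])
    qed
  qed
qed

lemma conformal_disc_boundary_small:
  fixes f :: "complex \<Rightarrow> complex" and c :: "real \<Rightarrow> complex"
  assumes c: "simple_path c" "pathfinish c = pathstart c"
    and hol: "f holomorphic_on ball 0 1"
    and hom: "homeomorphism (ball 0 1) (inside (path_image c)) f g"
    and \<zeta>: "norm \<zeta> = 1" and "0 < \<epsilon>"
  obtains \<delta> where "0 < \<delta>"
    "\<And>v v'. \<lbrakk>v \<in> ball 0 1 \<inter> ball \<zeta> \<delta>; v' \<in> ball 0 1 \<inter> ball \<zeta> \<delta>\<rbrakk> \<Longrightarrow> dist (f v) (f v') < \<epsilon>"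
proof -
  define S where "S = {w. 0 < Im w \<and> Im w < pi}"
  define M where "M w = \<zeta> * (\<i> - exp w) / (\<i> + exp w)" for w
  define N where "N v = Ln (\<i> * (\<zeta> - v) / (\<zeta> + v))" for v
  have MN: "homeomorphism S (ball 0 1) M N"
    using homeomorphism_strip_disc[OF \<zeta>] unfolding S_def M_def N_def .
  have hom': "homeomorphism S (inside (path_image c)) (f \<circ> M) (N \<circ> g)"
    using homeomorphism_compose[OF MN hom] .
  have "M holomorphic_on S"
  proof -
    have "\<i> + exp w \<noteq> 0" if "w \<in> S" for w
    proof -
      have "Im (\<i> + exp w) > 0" using that by (simp add: S_def Im_exp sin_gt_zero add_pos_pos)
      then show ?thesis by force
    qed
    then show ?thesis unfolding M_def by (intro holomorphic_intros) auto
  qed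
  moreover have "M ` S \<subseteq> ball 0 1" using MN by (auto simp: homeomorphism_def)
  ultimately have hol': "(f \<circ> M) holomorphic_on S"
    using hol holomorphic_on_compose_gen by blast
  obtain u where u0: "\<And>w w'. \<lbrakk>0 < Im w; Im w < pi; Re w < u; 0 < Im w'; Im w' < pi; Re w' < u\<rbrakk>
     \<Longrightarrow> dist ((f \<circ> M) w) ((f \<circ> M) w') < \<epsilon>"
    using conformal_strip_end_small[OF c hol'[unfolded S_def] hom'[unfolded S_def] \<open>0 < \<epsilon>\<close>] by metis
  have u: "dist ((f \<circ> M) w) ((f \<circ> M) w') < \<epsilon>" if "w \<in> S" "Re w < u" "w' \<in> S" "Re w' < u" for w w'
    using u0[of w w'] that by (simp add: S_def)
  \<comment> \<open>The bound 1 forces \<open>norm (\<zeta> + v) > 1\<close>; then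
    \<open>norm (\<zeta> - v) < exp u\<close> pushes \<open>N v\<close> to the left of
    \<open>u\<close>.\<close>
  define \<delta> where "\<delta> = min 1 (exp u)"
  have "\<delta> > 0" by (simp add: \<delta>_def)
  moreover have N: "N v \<in> S \<and> Re (N v) < u \<and> M (N v) = v" if "v \<in> ball 0 1 \<inter> ball \<zeta> \<delta>" for v
  proof -
    have v: "v \<in> ball 0 1" "norm (\<zeta> - v) < 1" "norm (\<zeta> - v) < exp u"
      using that by (auto simp: \<delta>_def dist_norm)
    have "v \<noteq> \<zeta>" using v(1) \<zeta> by auto
    have "2 = norm ((\<zeta> + v) + (\<zeta> - v))" using \<zeta> by (simp add: norm_mult)
    also have "\<dots> \<le> norm (\<zeta> + v) + norm (\<zeta> - v)" by (rule norm_triangle_ineq)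
    finally have "norm (\<zeta> + v) > 1" using v by linarith
    moreover have "norm (\<zeta> - v) \<le> norm (\<zeta> - v) * norm (\<zeta> + v)"
      using \<open>norm (\<zeta> + v) > 1\<close> by (intro mult_le_cancel_left1[THEN iffD2]) auto
    ultimately have "norm (\<zeta> - v) / norm (\<zeta> + v) \<le> norm (\<zeta> - v)" by (simp add: divide_le_eq)
    then have *: "norm (\<i> * (\<zeta> - v) / (\<zeta> + v)) < exp u"
      using v(3) by (simp add: norm_divide norm_mult)
    have nz: "\<i> * (\<zeta> - v) / (\<zeta> + v) \<noteq> 0" using \<open>v \<noteq> \<zeta>\<close> \<open>norm (\<zeta> + v) > 1\<close> by auto
    have "ln (norm (\<i> * (\<zeta> - v) / (\<zeta> + v))) < u"
      using * nz by (metis exp_less_cancel_iff exp_ln zero_less_norm_iff)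
    then have "Re (N v) < u" unfolding N_def using Re_Ln[OF nz] by simp
    then show ?thesis using MN v(1) unfolding homeomorphism_def by blast
  qed
  ultimately show thesis
  proof (intro that[of \<delta>])
    fix v v' assume "v \<in> ball 0 1 \<inter> ball \<zeta> \<delta>" "v' \<in> ball 0 1 \<inter> ball \<zeta> \<delta>"
    then show "dist (f v) (f v') < \<epsilon>" using N[of v] N[of v'] u[of "N v" "N v'"] by simp
  qed
qed

text \<open>Small oscillation near every point of the closed disc becomes uniform continuity by a
  Lebesgue number, and a uniformly continuous map extends to the closure. A circle point cannot be
  sent inside because the inverse \<open>g\<close> is continuous there.\<close>

theorem Caratheodory_extension:
  fixes f :: "complex \<Rightarrow> complex" and c :: "real \<Rightarrow> complex"
  assumes c: "simple_path c" "pathfinish c = pathstart c"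
    and hol: "f holomorphic_on ball 0 1"
    and hom: "homeomorphism (ball 0 1) (inside (path_image c)) f g"
  obtains h where "continuous_on (cball 0 1) h" "\<And>z. z \<in> ball 0 1 \<Longrightarrow> h z = f z"
    "h ` sphere 0 1 = path_image c"
proof -
  define \<Omega> where "\<Omega> = inside (path_image c)"
  note Jord = Jordan_inside_outside[OF c]
  have fg: "f ` ball 0 1 = \<Omega>" "g ` \<Omega> = ball 0 1" "continuous_on (ball 0 1) f" "continuous_on \<Omega> g"
    "\<And>z. z \<in> ball 0 1 \<Longrightarrow> g (f z) = z" "\<And>w. w \<in> \<Omega> \<Longrightarrow> f (g w) = w"
    using hom by (auto simp: homeomorphism_def \<Omega>_def)
  have "open \<Omega>" "frontier \<Omega> = path_image c" using Jord by (auto simp: \<Omega>_def)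
  have "uniformly_continuous_on (ball 0 1) f"
    unfolding uniformly_continuous_on_def
  proof (intro allI impI)
    fix e :: real assume "e > 0"
    have "\<exists>\<delta>>0. \<forall>v\<in>ball 0 1 \<inter> ball \<zeta> \<delta>. \<forall>v'\<in>ball 0 1 \<inter> ball \<zeta> \<delta>. dist (f v) (f v') < e"
      if "\<zeta> \<in> cball 0 1" for \<zeta>
    proof (cases "norm \<zeta> = 1")
      case True
      then show ?thesis using conformal_disc_boundary_small[OF c hol hom True \<open>e > 0\<close>] by metis
    next
      case False
      then have "\<zeta> \<in> ball 0 1" using that by simp
      then have "isCont f \<zeta>" using fg(3) continuous_on_eq_continuous_at open_ball by blast
      then obtain \<delta> where "\<delta> > 0" and \<delta>: "\<And>v. dist v \<zeta> < \<delta> \<Longrightarrow> dist (f v) (f \<zeta>) < e/2"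
        unfolding continuous_at_eps_delta using \<open>e > 0\<close> by (metis half_gt_zero)
      have "dist (f v) (f v') < e" if "v \<in> ball \<zeta> \<delta>" "v' \<in> ball \<zeta> \<delta>" for v v'
        using \<delta>[of v] \<delta>[of v'] that dist_triangle_half_r by (metis dist_commute mem_ball)
      then show ?thesis using \<open>\<delta> > 0\<close> by (intro exI[of _ \<delta>]) auto
    qed
    then obtain \<delta> where \<delta>: "\<And>\<zeta>. \<zeta> \<in> cball 0 1 \<Longrightarrow> 0 < \<delta> \<zeta> \<and>
        (\<forall>v\<in>ball 0 1 \<inter> ball \<zeta> (\<delta> \<zeta>). \<forall>v'\<in>ball 0 1 \<inter> ball \<zeta> (\<delta> \<zeta>). dist (f v) (f v') < e)"
      by metis
    have "cball 0 1 \<subseteq> \<Union>((\<lambda>\<zeta>. ball \<zeta> (\<delta> \<zeta>)) ` cball 0 1)" using \<delta> by force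
    then obtain d where "d > 0" and d: "\<And>x. x \<in> cball 0 1 \<Longrightarrow> \<exists>G\<in>(\<lambda>\<zeta>. ball \<zeta> (\<delta> \<zeta>)) ` cball 0 1. ball x d \<subseteq> G"
      using Heine_Borel_lemma[OF compact_cball, of 0 1 "(\<lambda>\<zeta>. ball \<zeta> (\<delta> \<zeta>)) ` cball 0 1"] by blast
    have "dist (f x') (f x) < e" if "x \<in> ball 0 1" "x' \<in> ball 0 1" "dist x' x < d" for x x'
    proof -
      have "x \<in> cball 0 1" using that(1) ball_subset_cball by blast
      then obtain \<zeta> where \<zeta>: "\<zeta> \<in> cball 0 1" "ball x d \<subseteq> ball \<zeta> (\<delta> \<zeta>)"
        using d by blast
      moreover have "x \<in> ball x d" "x' \<in> ball x d" using that \<open>d > 0\<close> by (auto simp: dist_commute)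
      ultimately show ?thesis using \<delta>[OF \<zeta>(1)] that by blast
    qed
    then show "\<exists>d>0. \<forall>x\<in>ball 0 1. \<forall>x'\<in>ball 0 1. dist x' x < d \<longrightarrow> dist (f x') (f x) < e"
      using \<open>d > 0\<close> by blast
  qed
  then obtain h where h: "uniformly_continuous_on (closure (ball 0 1)) h" "\<And>z. z \<in> ball 0 1 \<Longrightarrow> f z = h z"
    using uniformly_continuous_on_extension_on_closure by metis
  have conth: "continuous_on (cball 0 1) h"
    using h(1) by (simp add: uniformly_continuous_imp_continuous)
  have hball: "h ` ball 0 1 = \<Omega>" using fg(1) h(2) by force
  have im: "h ` cball 0 1 = closure \<Omega>"
  proof
    show "h ` cball 0 1 \<subseteq> closure \<Omega>"
      using image_closure_subset[of "ball 0 1" h "closure \<Omega>"] conth hball closure_subset[of \<Omega>] by simp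
    have "closed (h ` cball 0 1)" by (intro compact_imp_closed compact_continuous_image conth compact_cball)
    then show "closure \<Omega> \<subseteq> h ` cball 0 1" using hball ball_subset_cball by (metis closure_minimal image_mono)
  qed
  have "h \<zeta> \<notin> \<Omega>" if "norm \<zeta> = 1" for \<zeta>
  proof
    assume h\<Omega>: "h \<zeta> \<in> \<Omega>"
    have nontriv: "at \<zeta> within ball 0 1 \<noteq> bot"
    proof -
      have "\<zeta> islimpt ball 0 1" using that by (simp add: islimpt_ball)
      then show ?thesis using trivial_limit_within by blast
    qed
    have lim: "(h \<longlongrightarrow> h \<zeta>) (at \<zeta> within ball 0 1)"
      using conth that unfolding continuous_on_def
      by (metis ball_subset_cball mem_cball_0 order_refl tendsto_within_subset)
    have ev: "eventually (\<lambda>t. t \<in> ball 0 1) (at \<zeta> within ball 0 1)"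
      by (simp add: eventually_at_filter)
    have "isCont g (h \<zeta>)" using fg(4) \<open>open \<Omega>\<close> h\<Omega> continuous_on_eq_continuous_at by blast
    then have "((\<lambda>t. g (h t)) \<longlongrightarrow> g (h \<zeta>)) (at \<zeta> within ball 0 1)"
      using lim isCont_tendsto_compose by blast
    then have "((\<lambda>t. t) \<longlongrightarrow> g (h \<zeta>)) (at \<zeta> within ball 0 1)"
      by (rule Lim_transform_eventually) (use ev fg(5) h(2) in \<open>auto elim!: eventually_mono\<close>)
    then have "g (h \<zeta>) = \<zeta>"
      using tendsto_unique[OF nontriv] tendsto_ident_at by blast
    moreover have "g (h \<zeta>) \<in> ball 0 1" using fg(2) h\<Omega> by blast
    ultimately show False using that by simp
  qed
  then have disj: "h ` sphere 0 1 \<inter> \<Omega> = {}" by auto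
  have "cball 0 1 = ball 0 1 \<union> sphere (0::complex) 1" by auto
  then have 1: "\<Omega> \<union> h ` sphere 0 1 = closure \<Omega>" using im hball by (metis image_Un)
  have "h ` sphere 0 1 = (\<Omega> \<union> h ` sphere 0 1) - \<Omega>" using disj by auto
  also have "\<dots> = path_image c"
    unfolding 1 using \<open>frontier \<Omega> = path_image c\<close> \<open>open \<Omega>\<close> by (simp add: frontier_def interior_open)
  finally have "h ` sphere 0 1 = path_image c" .
  then show thesis using that[OF conth h(2)[symmetric]] by blast
qed

section \<open>Injectivity of the extended map on the circle\<close>

lemma norm_cis_diff_le: "norm (cis a - cis b) \<le> \<bar>a - b\<bar>"
proof -
  have "cis a - cis b = cis b * (exp (\<i> * of_real (a - b)) - 1)"
    by (simp add: cis_conv_exp algebra_simps flip: exp_add)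
  then have "norm (cis a - cis b) = 2 * \<bar>sin ((a - b) / 2)\<bar>"
    by (simp only: norm_mult norm_cis dist_exp_i_1 mult_1)
  also have "\<dots> \<le> 2 * \<bar>(a - b) / 2\<bar>"
    by (rule mult_left_mono[OF abs_sin_x_le_abs_x]) simp
  finally show ?thesis by simp
qed

text \<open>The product of finitely many rotated copies of \<open>h - w\<close> vanishes on the whole circle.\<close>

lemma holomorphic_disc_const_on_arc:
  fixes h :: "complex \<Rightarrow> complex"
  assumes hol: "h holomorphic_on ball 0 1" and cont: "continuous_on (cball 0 1) h"
    and \<zeta>: "norm \<zeta> = 1" "0 < \<epsilon>"
    and const: "\<And>z. \<lbrakk>norm z = 1; dist z \<zeta> < \<epsilon>\<rbrakk> \<Longrightarrow> h z = w"
  shows "h 0 = w"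
proof -
  obtain n :: nat where n: "n > 0" "2 * pi / n < \<epsilon>"
  proof -
    obtain n :: nat where n: "2 * pi / \<epsilon> < n" using reals_Archimedean2 by blast
    moreover have "0 < 2 * pi / \<epsilon>" using \<zeta>(2) by simp
    ultimately have "0 < real n" by linarith
    then show thesis using n that[of n] \<zeta>(2) by (simp add: field_simps)
  qed
  define \<omega> where "\<omega> k = cis (2 * pi * real k / real n)" for k :: nat
  have [simp]: "norm (\<omega> k) = 1" for k by (simp add: \<omega>_def)
  define P where "P z = (\<Prod>k<n. h (\<omega> k * z) - w)" for z
  have "(*) (\<omega> k) ` ball 0 1 \<subseteq> ball 0 1" for k by (auto simp: norm_mult)
  then have "(\<lambda>z. h (\<omega> k * z)) holomorphic_on ball 0 1" for k
    using holomorphic_on_compose_gen[of "\<lambda>z. \<omega> k * z" "ball 0 1" h "ball 0 1"] hol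
    by (simp add: o_def holomorphic_intros)
  then have "P holomorphic_on interior (cball 0 1)"
    unfolding P_def by (auto intro!: holomorphic_intros)
  moreover have "continuous_on (closure (cball 0 1)) P"
    unfolding P_def
    by (auto intro!: continuous_intros continuous_on_compose2[OF cont] simp: norm_mult)
  moreover have "norm (P z) \<le> 0" if "z \<in> frontier (cball 0 1)" for z
  proof -
    have z: "norm z = 1" using that by simp
    define \<theta> where "\<theta> = Arg2pi (\<zeta> / z)"
    have \<theta>: "0 \<le> \<theta>" "\<theta> < 2 * pi" unfolding \<theta>_def using Arg2pi by auto
    have "\<zeta> / z = exp (\<i> * of_real \<theta>)"
      using Arg2pi_eq[of "\<zeta> / z"] z \<zeta>(1) unfolding \<theta>_def by (auto simp: norm_divide)
    moreover have "z \<noteq> 0" using z by auto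
    ultimately have \<zeta>z: "\<zeta> = cis \<theta> * z" by (simp add: cis_conv_exp field_simps)
    \<comment> \<open>The largest multiple of \<open>2 * pi / n\<close> not above \<theta> rotates
      \<open>z\<close> to within \<epsilon> of \<open>\<zeta>\<close>, where the factor with this
      index vanishes.\<close>
    define k where "k = nat \<lfloor>\<theta> * n / (2 * pi)\<rfloor>"
    have "0 \<le> \<theta> * n / (2 * pi)" "\<theta> * n / (2 * pi) < n" using \<theta> n(1) by (auto simp: field_simps)
    then have k: "k < n" "real k \<le> \<theta> * n / (2 * pi)" "\<theta> * n / (2 * pi) < real k + 1"
      unfolding k_def by linarith+
    have "2 * pi * k / n \<le> \<theta>" "\<theta> < 2 * pi * k / n + 2 * pi / n"
      using k n(1) by (auto simp: field_simps)
    then have "\<bar>2 * pi * k / n - \<theta>\<bar> < \<epsilon>" using n(2) by linarith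
    moreover have "dist (\<omega> k * z) \<zeta> = norm (\<omega> k - cis \<theta>)"
      unfolding \<zeta>z dist_norm by (metis left_diff_distrib mult.right_neutral norm_mult z)
    ultimately have "dist (\<omega> k * z) \<zeta> < \<epsilon>"
      using norm_cis_diff_le[of "2 * pi * k / n" \<theta>] unfolding \<omega>_def by linarith
    then have "h (\<omega> k * z) = w" by (intro const) (auto simp: norm_mult z)
    then show ?thesis using k(1) unfolding P_def by auto
  qed
  ultimately have "norm (P 0) \<le> 0"
    using maximum_modulus_frontier[of P "cball 0 1" 0 0] by auto
  \<comment> \<open>The rotations fix 0, so all \<open>n\<close> factors of \<open>P 0\<close> are
    equal.\<close>
  then have "(h 0 - w) ^ n = 0" unfolding P_def by simp
  then show ?thesis by simp
qed

lemma connected_simple_loop_minus_point: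
  fixes c :: "real \<Rightarrow> 'a::topological_space"
  assumes "simple_path c" "pathfinish c = pathstart c"
  shows "connected (path_image c - {w})"
proof (cases "w \<in> path_image c")
  case True
  then obtain a where a: "a \<in> {0..1}" "c a = w" by (auto simp: path_image_def)
  have "simple_path (shiftpath a c)" "path_image (shiftpath a c) = path_image c"
    "pathstart (shiftpath a c) = w" "pathfinish (shiftpath a c) = w"
    using a assms by (auto simp: simple_path_shiftpath path_image_shiftpath pathstart_shiftpath pathfinish_shiftpath)
  then show ?thesis using connected_simple_path_endless[of "shiftpath a c"] by simp
next
  case False
  then show ?thesis using assms by (simp add: connected_simple_path_image)
qed

text \<open>If \<open>p\<close> and \<open>q\<close> had the same image \<open>w\<close>, the chord
  between them would be mapped to a closed curve \<open>X\<close> that meets the boundary curve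
  \<open>J\<close> only at \<open>w\<close>. It separates the images of the two sides of the chord,
  and the connected set \<open>J - {w}\<close> can accompany at most one of them. So the circle arc
  on the other side is sent to \<open>w\<close> alone, which forces \<open>h 0 = w\<close>, although
  \<open>h 0\<close> lies inside \<open>J\<close>.\<close>

lemma Caratheodory_inj:
  fixes h :: "complex \<Rightarrow> complex" and c :: "real \<Rightarrow> complex"
  assumes c: "simple_path c" "pathfinish c = pathstart c"
    and hol: "h holomorphic_on ball 0 1" and cont: "continuous_on (cball 0 1) h"
    and hom: "homeomorphism (ball 0 1) (inside (path_image c)) h g"
    and sph: "h ` sphere 0 1 = path_image c"
  shows "inj_on h (sphere 0 1)"
proof (rule inj_onI, rule ccontr)
  fix p q :: complex assume "p \<in> sphere 0 1" "q \<in> sphere 0 1" "h p = h q" "p \<noteq> q"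
  then have pq: "norm p = 1" "norm q = 1" "p \<noteq> q" by auto
  define J where "J = path_image c"
  define \<Omega> where "\<Omega> = inside J"
  define w where "w = h p"
  note Jord = Jordan_inside_outside[OF c, folded J_def, folded \<Omega>_def]
  have J\<Omega>: "J \<inter> \<Omega> = {}" unfolding \<Omega>_def using inside_no_overlap by blast
  have "compact J" unfolding J_def using c by (simp add: compact_simple_path_image)
  have "w \<in> J" using pq sph unfolding w_def J_def by force
  have hg: "h ` ball 0 1 = \<Omega>" "g ` \<Omega> = ball 0 1" "continuous_on \<Omega> g"
    "\<And>z. z \<in> ball 0 1 \<Longrightarrow> g (h z) = z" "\<And>w. w \<in> \<Omega> \<Longrightarrow> h (g w) = w"
    using hom by (auto simp: homeomorphism_def \<Omega>_def J_def)
  have op_sub: "open_segment p q \<subseteq> ball 0 1" using open_segment_sphere_subset_ball pq by blast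
  define X where "X = h ` closed_segment p q"
  have cs_sub: "closed_segment p q \<subseteq> cball 0 1"
    using pq by (intro closed_segment_subset) auto
  have X: "compact X" "connected X" unfolding X_def
    using cont cs_sub by (auto intro!: compact_continuous_image connected_continuous_image
        intro: continuous_on_subset)
  have X_eq: "X = insert w (h ` open_segment p q)"
    unfolding X_def closed_segment_eq_open using \<open>h p = h q\<close> by (auto simp: w_def)
  have JX: "J \<inter> X = {w}"
    unfolding X_eq using op_sub hg(1) J\<Omega> \<open>w \<in> J\<close> by blast
  define D where "D s = {z \<in> ball 0 1. 0 < s * orient p q z}" for s :: real
  have D_alt: "D 1 = ball 0 1 \<inter> {z. 0 < orient p q z}" "D (-1) = ball 0 1 \<inter> {z. 0 < orient q p z}"
    by (auto simp: D_def orient_swap[of q p])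
  have convD: "convex (D s)" if "s = 1 \<or> s = -1" for s
    using that D_alt by (auto intro!: convex_Int convex_orient_pos)
  text \<open>The two points of the circle on the perpendicular bisector of the chord.\<close>
  define P where "P s = of_real s * (\<i> * ((q - p) / of_real (norm (q - p))))" for s :: real
  have nP: "norm (P s) = 1" and oP: "0 < s * orient p q (P s)" if "s = 1 \<or> s = -1" for s
  proof -
    have "q - p \<noteq> 0" using pq by simp
    then show "norm (P s) = 1" using that unfolding P_def by (auto simp: norm_mult norm_divide)
    have "cnj (q - p) * P s = of_real s * \<i> * (cnj (q - p) * (q - p) / of_real (norm (q - p)))"
      by (simp add: P_def)
    also have "cnj (q - p) * (q - p) / of_real (norm (q - p)) = of_real (norm (q - p))"
    proof -
      have "cnj (q - p) * (q - p) = of_real (norm (q - p)) * of_real (norm (q - p))"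
        by (metis complex_norm_square mult.commute of_real_power power2_eq_square)
      then show ?thesis using \<open>q - p \<noteq> 0\<close> by simp
    qed
    finally have P: "cnj (q - p) * P s = of_real s * \<i> * of_real (norm (q - p))" .
    have "Re (cnj (q - p) * p) < 0"
    proof -
      have "(norm (q - p))\<^sup>2 = (norm p)\<^sup>2 + (norm q)\<^sup>2 - 2 * Re (cnj q * p)"
        unfolding cmod_power2 by (simp add: algebra_simps power2_eq_square)
      moreover have "(norm (q - p))\<^sup>2 > 0" using pq by simp
      moreover have "Re (cnj (q - p) * p) = Re (cnj q * p) - (norm p)\<^sup>2"
        unfolding cmod_power2 by (simp add: algebra_simps power2_eq_square)
      ultimately show ?thesis using pq by simp
    qed
    moreover have "norm (cnj (q - p) * p) = norm (q - p)"
      using pq by (simp add: norm_mult flip: complex_cnj_diff)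
    then have "(Re (cnj (q - p) * p))\<^sup>2 + (Im (cnj (q - p) * p))\<^sup>2 = (norm (q - p))\<^sup>2"
      by (metis cmod_power2)
    ultimately have "(Im (cnj (q - p) * p))\<^sup>2 < (norm (q - p))\<^sup>2" by (smt (verit) zero_less_power2)
    then have "\<bar>Im (cnj (q - p) * p)\<bar> < norm (q - p)" by (metis norm_ge_zero power2_abs power2_less_imp_less)
    moreover have "orient p q (P s) = s * norm (q - p) - Im (cnj (q - p) * p)"
      unfolding orient_def right_diff_distrib P by simp
    ultimately show "0 < s * orient p q (P s)"
      using that by auto
  qed
  have P_closure: "z \<in> closure (D s)" if "norm z = 1" "0 < s * orient p q z" "s = 1 \<or> s = -1" for z s
  proof -
    have "open {z. 0 < s * orient p q z}"
      by (intro open_Collect_less continuous_intros)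
    moreover have "D s = {z. 0 < s * orient p q z} \<inter> ball 0 1" by (auto simp: D_def)
    moreover have "z \<in> closure (ball 0 1)" using that by simp
    ultimately show ?thesis
      using that open_Int_closure_subset[of "{z. 0 < s * orient p q z}" "ball 0 1"] by auto
  qed
  have D_ne: "D s \<noteq> {}" if "s = 1 \<or> s = -1" for s
    using P_closure[OF nP oP] that by force
  obtain a b where ab: "a \<in> D 1" "b \<in> D (-1)" using D_ne by blast
  have ab_ball: "a \<in> ball 0 1" "b \<in> ball 0 1" using ab by (auto simp: D_def)
  \<comment> \<open>A connected set joining the two images inside \<open>J\<close> pulls back to a
    connected set that meets both sides of the chord, hence the chord itself.\<close>
  have "\<not> connected_component (- (J \<union> X)) (h a) (h b)"
  proof
    assume "connected_component (- (J \<union> X)) (h a) (h b)"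
    then obtain Q where Q: "connected Q" "Q \<subseteq> - (J \<union> X)" "h a \<in> Q" "h b \<in> Q"
      unfolding connected_component_def by blast
    have "h a \<in> \<Omega>" using ab_ball hg(1) by blast
    then have "Q \<subseteq> \<Omega>"
      using connected_subset_inside_Jordan[OF c Q(1)] Q unfolding \<Omega>_def J_def by blast
    then have "connected (g ` Q)"
      using Q(1) hg(3) connected_continuous_image continuous_on_subset by blast
    then have "connected (orient p q ` g ` Q)"
      by (rule connected_continuous_image[rotated]) (intro continuous_intros)
    moreover have "orient p q a \<in> orient p q ` g ` Q" "orient p q b \<in> orient p q ` g ` Q"
      using Q hg(4) ab_ball by force+
    ultimately have "0 \<in> orient p q ` g ` Q"
      using connectedD_interval[of "orient p q ` g ` Q" "orient p q b" "orient p q a" 0] ab by (simp add: D_def)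
    then obtain x where x: "x \<in> Q" "orient p q (g x) = 0" by auto
    then have "g x \<in> ball 0 1" using \<open>Q \<subseteq> \<Omega>\<close> hg(2) by blast
    then have "g x \<in> open_segment p q"
      using orient_eq_0_ball_imp_open_segment[OF pq _ x(2)] by simp
    then have "h (g x) \<in> X" unfolding X_eq by blast
    then show False using x(1) Q(2) \<open>Q \<subseteq> \<Omega>\<close> hg(5) by (metis ComplD UnI2 subsetD)
  qed
  moreover have "connected_component (- J) (h a) (h b)"
    unfolding connected_component_def
    using Jord J\<Omega> hg(1) ab_ball by (intro exI[of _ \<Omega>]) auto
  ultimately have nc: "\<not> connected_component (- X) (h a) (h b)"
    using Janiszewski[OF \<open>compact J\<close> compact_imp_closed[OF X(1)], of "h a" "h b"] JX by auto
  have conJ: "connected (J - {w})" "J - {w} \<subseteq> - X"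
    using connected_simple_loop_minus_point[OF c] JX unfolding J_def by blast+
  define K where "K z = connected_component_set (- X) (h z)" for z
  have "(J - {w}) \<inter> K a = {} \<or> (J - {w}) \<inter> K b = {}"
  proof (rule ccontr)
    assume "\<not> ?thesis"
    then obtain x y where "x \<in> J - {w}" "x \<in> K a" "y \<in> J - {w}" "y \<in> K b" by blast
    then have "connected_component (- X) (h a) x" "connected_component (- X) (h b) y" "connected_component (- X) x y"
      using conJ unfolding K_def by (auto simp: connected_component_def)
    then show False using nc by (meson connected_component_sym connected_component_trans)
  qed
  then obtain s z where s: "s = 1 \<or> s = -1" "z \<in> D s" and JK: "(J - {w}) \<inter> K z = {}"
    using ab by metis
  have "connected (K z)" unfolding K_def by simp
  have "K z \<subseteq> - X" unfolding K_def by (simp add: connected_component_subset)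
  have hD_K: "h ` D s \<subseteq> K z"
    unfolding K_def
  proof (rule connected_component_maximal)
    show "h z \<in> h ` D s" using s by blast
    show "connected (h ` D s)"
      using convD[OF s(1)] cont
      by (intro connected_continuous_image convex_connected) (auto simp: D_def intro: continuous_on_subset)
    show "h ` D s \<subseteq> - X"
    proof clarify
      fix x assume x: "x \<in> D s" "h x \<in> X"
      have x1: "x \<in> ball 0 1" using x by (auto simp: D_def)
      have "h x \<in> \<Omega>" using x1 hg(1) by blast
      then have "h x \<in> h ` open_segment p q" using x J\<Omega> \<open>w \<in> J\<close> unfolding X_eq by auto
      then obtain y where y: "y \<in> open_segment p q" "h x = h y" by blast
      then have "x = y" using hg(4) x1 op_sub by (metis subsetD)
      then have "orient p q x = 0" using y orient_open_segment by blast
      then show False using x by (simp add: D_def)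
    qed
  qed
  \<comment> \<open>The point is a limit of the half disc, so its image is in
    \<open>K z \<union> X\<close>; it is also on \<open>J\<close>, of which only \<open>w\<close> is
    left there.\<close>
  have const: "h y = w" if y: "norm y = 1" "0 < s * orient p q y" for y
  proof -
    have "y \<in> closure (D s)" using P_closure y s by blast
    moreover have "closure (D s) \<subseteq> cball 0 1"
      by (rule closure_minimal) (auto simp: D_def)
    ultimately have "h y \<in> closure (h ` D s)"
      using image_closure_subset[of "D s" h "closure (h ` D s)"] cont closure_subset[of "h ` D s"]
      by (metis closed_closure continuous_on_subset image_subset_iff)
    also have "\<dots> \<subseteq> closure (K z)" using hD_K by (rule closure_mono)
    also have "\<dots> \<subseteq> K z \<union> frontier (K z)" using closure_Un_frontier by blast
    also have "\<dots> \<subseteq> K z \<union> X"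
      using frontier_of_connected_component_subset[of "- X" "h z"] X(1)
      by (auto simp: K_def frontier_complement compact_imp_closed frontier_subset_closed dest!: subsetD[OF frontier_subset_closed[OF compact_imp_closed]])
    finally have "h y \<in> K z \<union> X" .
    moreover have "h y \<in> J" using y sph unfolding J_def by force
    ultimately show ?thesis using JK JX by blast
  qed
  have "open {y. 0 < s * orient p q y}" by (intro open_Collect_less continuous_intros)
  then obtain \<epsilon> where "\<epsilon> > 0" "ball (P s) \<epsilon> \<subseteq> {y. 0 < s * orient p q y}"
    using oP[OF s(1)] openE by blast
  then have "h 0 = w"
    using holomorphic_disc_const_on_arc[OF hol cont nP[OF s(1)] \<open>\<epsilon> > 0\<close>] const
    by (metis dist_commute mem_Collect_eq mem_ball subsetD)
  then show False using hg(1) \<open>w \<in> J\<close> J\<Omega> by (metis IntI centre_in_ball emptyE imageI zero_less_one)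
qed

section \<open>The Schoenflies theorem and isotopies of crosscuts\<close>

lemma Schoenflies_disc:
  fixes c :: "real \<Rightarrow> complex"
  assumes c: "simple_path c" "pathfinish c = pathstart c"
  obtains h h' where "homeomorphism (cball (0::complex) 1) (closure (inside (path_image c))) h h'"
    "h ` sphere 0 1 = path_image c" "h ` ball 0 1 = inside (path_image c)"
proof -
  define \<Omega> where "\<Omega> = inside (path_image c)"
  note Jord = Jordan_inside_outside[OF c, folded \<Omega>_def]
  have disj: "path_image c \<inter> \<Omega> = {}" unfolding \<Omega>_def using inside_no_overlap by blast
  have clo: "closure \<Omega> = \<Omega> \<union> path_image c" using Jord closure_Un_frontier by metis
  have "simply_connected \<Omega>" unfolding \<Omega>_def using c simply_connected_inside_simple_path by blast
  moreover have "\<Omega> \<noteq> {}" "\<Omega> \<noteq> UNIV" using Jord by auto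
  ultimately have "\<exists>f g. f holomorphic_on \<Omega> \<and> g holomorphic_on ball 0 1 \<and>
      (\<forall>z\<in>\<Omega>. f z \<in> ball 0 1 \<and> g (f z) = z) \<and> (\<forall>z\<in>ball 0 1. g z \<in> \<Omega> \<and> f (g z) = z)"
    using Riemann_mapping_theorem[of \<Omega>] Jord by simp
  then obtain f g where fg: "f holomorphic_on \<Omega>" "g holomorphic_on ball 0 1"
    "\<forall>z\<in>\<Omega>. f z \<in> ball 0 1 \<and> g (f z) = z" "\<forall>z\<in>ball 0 1. g z \<in> \<Omega> \<and> f (g z) = z"
    by blast
  have "homeomorphism (ball 0 1) \<Omega> g f"
    using fg by (intro homeomorphismI) (auto intro: holomorphic_on_imp_continuous_on)
  then obtain h where h: "continuous_on (cball 0 1) h" "\<And>z. z \<in> ball 0 1 \<Longrightarrow> h z = g z"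
    "h ` sphere 0 1 = path_image c"
    using Caratheodory_extension[OF c fg(2)] unfolding \<Omega>_def by metis
  have hball: "h ` ball 0 1 = \<Omega>"
  proof -
    have "h ` ball 0 1 = g ` ball 0 1" using h(2) by (rule image_cong[OF refl])
    also have "\<dots> = \<Omega>" using fg(3,4) by force
    finally show ?thesis .
  qed
  have "homeomorphism (ball 0 1) \<Omega> h f"
  proof (rule homeomorphismI)
    show "continuous_on (ball 0 1) h" using h(1) ball_subset_cball continuous_on_subset by blast
    show "continuous_on \<Omega> f" using fg(1) by (rule holomorphic_on_imp_continuous_on)
    show "h ` ball 0 1 \<subseteq> \<Omega>" using hball by simp
    show "f ` \<Omega> \<subseteq> ball 0 1" using fg(3) by blast
    show "f (h z) = z" if "z \<in> ball 0 1" for z using h(2)[OF that] fg(4) that by simp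
    show "h (f y) = y" if "y \<in> \<Omega>" for y using fg(3) h(2) that by metis
  qed
  moreover have "h holomorphic_on ball 0 1" using fg(2) h(2) holomorphic_cong by metis
  ultimately have "inj_on h (sphere 0 1)"
    using Caratheodory_inj[OF c _ h(1) _ h(3)] unfolding \<Omega>_def by blast
  moreover have "inj_on h (ball 0 1)" using h(2) fg(4) by (metis inj_onI)
  moreover have "cball (0::complex) 1 = ball 0 1 \<union> sphere 0 1" by auto
  ultimately have "inj_on h (cball 0 1)" and im: "h ` cball 0 1 = closure \<Omega>"
    using disj hball h(3) clo by (auto simp: inj_on_Un image_Un)
  then obtain h' where "homeomorphism (cball 0 1) (closure \<Omega>) h h'"
    using homeomorphism_compact[OF compact_cball h(1) im] by blast
  then show thesis unfolding \<Omega>_def by (rule that[OF _ h(3) hball[unfolded \<Omega>_def]])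
qed

lemma homeomorphism_cone_extension:
  fixes s s' :: "complex \<Rightarrow> complex"
  assumes hom: "homeomorphism (sphere 0 1) (sphere 0 1) s s'"
  defines "E \<equiv> \<lambda>s z. norm z *\<^sub>R (s (z /\<^sub>R norm z) :: complex)"
  shows "homeomorphism (cball 0 1) (cball 0 1) (E s) (E s')"
    "\<And>z. z \<in> sphere 0 1 \<Longrightarrow> E s z = s z" "\<And>z. norm z < 1 \<Longrightarrow> norm (E s z) < 1"
proof -
  have norm_E: "norm (E r z) = norm z" if "r ` sphere 0 1 \<subseteq> sphere 0 1" for r z
  proof (cases "z = 0")
    case False
    then have "z /\<^sub>R norm z \<in> sphere 0 1" by simp
    then show ?thesis using that by (force simp: E_def)
  qed (simp add: E_def)
  have cont_E: "continuous_on UNIV (E r)" if r: "continuous_on (sphere 0 1) r" "r ` sphere 0 1 \<subseteq> sphere 0 1" for r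
  proof -
    have "continuous_on (- {0}) (E r)"
      unfolding E_def
      by (intro continuous_intros continuous_on_compose2[OF r(1)]) (auto, metis left_inverse norm_eq_zero)
    then have "isCont (E r) z" if "z \<noteq> 0" for z
      using that continuous_on_eq_continuous_at[of "- {0}" "E r"] by (simp add: open_Compl)
    \<comment> \<open>At 0 the direction \<open>z /\<^sub>R norm z\<close> has no limit, but
      \<open>E r\<close> preserves norms.\<close>
    moreover have "isCont (E r) 0"
    proof -
      have "(E r \<longlongrightarrow> 0) (at 0)"
        by (rule tendsto_norm_zero_cancel) (simp add: norm_E[OF r(2)] tendsto_norm_zero)
      then show ?thesis by (simp add: isCont_def E_def)
    qed
    ultimately show ?thesis by (intro continuous_at_imp_continuous_on ballI) metis
  qed
  have inv_E: "E r (E t z) = z" if "t ` sphere 0 1 \<subseteq> sphere 0 1" "\<And>z. z \<in> sphere 0 1 \<Longrightarrow> r (t z) = z" for r t z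
  proof (cases "z = 0")
    case False
    then have z: "z /\<^sub>R norm z \<in> sphere 0 1" by simp
    have "E t z /\<^sub>R norm (E t z) = t (z /\<^sub>R norm z)"
      unfolding norm_E[OF that(1)] using False by (simp add: E_def)
    moreover have "E r (E t z) = norm (E t z) *\<^sub>R r (E t z /\<^sub>R norm (E t z))" by (simp only: E_def)
    ultimately have "E r (E t z) = norm z *\<^sub>R r (t (z /\<^sub>R norm z))"
      using norm_E[OF that(1)] by simp
    then show ?thesis using that(2)[OF z] False by simp
  qed (simp add: E_def)
  have s: "continuous_on (sphere 0 1) s" "s ` sphere 0 1 \<subseteq> sphere 0 1" "\<And>z. z \<in> sphere 0 1 \<Longrightarrow> s' (s z) = z"
    and s': "continuous_on (sphere 0 1) s'" "s' ` sphere 0 1 \<subseteq> sphere 0 1" "\<And>z. z \<in> sphere 0 1 \<Longrightarrow> s (s' z) = z"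
    using hom by (auto simp: homeomorphism_def)
  show "homeomorphism (cball 0 1) (cball 0 1) (E s) (E s')"
    by (rule homeomorphismI)
      (use norm_E[OF s(2)] norm_E[OF s'(2)] inv_E[OF s(2,3)] inv_E[OF s'(2,3)]
        continuous_on_subset[OF cont_E[OF s(1,2)]] continuous_on_subset[OF cont_E[OF s'(1,2)]] in auto)
  show "E s z = s z" if "z \<in> sphere 0 1" for z using that by (simp add: E_def)
  show "norm (E s z) < 1" if "norm z < 1" for z using that norm_E[OF s(2)] by simp
qed

text \<open>Conjugating \<open>k\<close> with the Schoenflies maps of both domains gives a
  homeomorphism of the circle, which the cone construction extends to the disc.\<close>

theorem Jordan_homeomorphism_extension:
  fixes c d :: "real \<Rightarrow> complex"
  assumes c: "simple_path c" "pathfinish c = pathstart c"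
    and d: "simple_path d" "pathfinish d = pathstart d"
    and k: "homeomorphism (path_image c) (path_image d) k k'"
  obtains K K' where "homeomorphism (closure (inside (path_image c))) (closure (inside (path_image d))) K K'"
    "\<And>x. x \<in> path_image c \<Longrightarrow> K x = k x" "\<And>x. x \<in> path_image d \<Longrightarrow> K' x = k' x"
proof -
  define B where "B = cball (0::complex) 1"
  obtain f f' where f: "homeomorphism B (closure (inside (path_image c))) f f'" "f ` sphere 0 1 = path_image c"
    using Schoenflies_disc[OF c] unfolding B_def by metis
  obtain g g' where g: "homeomorphism B (closure (inside (path_image d))) g g'" "g ` sphere 0 1 = path_image d"
    using Schoenflies_disc[OF d] unfolding B_def by metis
  have sub: "sphere 0 1 \<subseteq> B" by (auto simp: B_def)
  have cl: "path_image c \<subseteq> closure (inside (path_image c))" "path_image d \<subseteq> closure (inside (path_image d))"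
    using Jordan_inside_outside[OF c] Jordan_inside_outside[OF d] by (metis Diff_subset frontier_def)+
  have f1: "homeomorphism (sphere 0 1) (path_image c) f f'"
    using homeomorphism_of_subsets[OF f(1) sub cl(1)] f(2) by blast
  have g1: "homeomorphism (path_image d) (sphere 0 1) g' g"
    using homeomorphism_of_subsets[OF g(1) sub cl(2)] g(2) homeomorphism_symD by blast
  define s where "s = (g' \<circ> k) \<circ> f"
  define s' where "s' = f' \<circ> (k' \<circ> g)"
  have s: "homeomorphism (sphere 0 1) (sphere 0 1) s s'"
    unfolding s_def s'_def by (intro homeomorphism_compose[OF f1] homeomorphism_compose[OF k] g1)
  obtain E E' where E: "homeomorphism B B E E'" "\<And>z. z \<in> sphere 0 1 \<Longrightarrow> E z = s z"
    by (rule that[OF homeomorphism_cone_extension(1)[OF s, folded B_def] homeomorphism_cone_extension(2)[OF s]])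
  define K where "K = (g \<circ> E) \<circ> f'"
  define K' where "K' = f \<circ> (E' \<circ> g')"
  have K: "homeomorphism (closure (inside (path_image c))) (closure (inside (path_image d))) K K'"
    unfolding K_def K'_def
    by (intro homeomorphism_compose[OF homeomorphism_symD[OF f(1)]] homeomorphism_compose[OF E(1)] g(1))
  have 1: "K x = k x" if "x \<in> path_image c" for x
  proof -
    have "f' x \<in> sphere 0 1" "f (f' x) = x" using f1 that by (auto simp: homeomorphism_def)
    moreover have "k x \<in> path_image d" using k that by (auto simp: homeomorphism_def)
    then have "g (g' (k x)) = k x" using g1 by (auto simp: homeomorphism_def)
    ultimately show ?thesis by (simp add: K_def E(2) s_def)
  qed
  have 2: "K' x = k' x" if "x \<in> path_image d" for x
  proof -
    have "k' x \<in> path_image c" "k (k' x) = x" using k that by (auto simp: homeomorphism_def)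
    then show ?thesis using 1[of "k' x"] K cl(1) by (metis homeomorphism_def subsetD)
  qed
  show thesis using that[OF K 1 2] by blast
qed

section \<open>The two Jordan domains cut out by a crosscut of the disc\<close>

lemma theta_crosscut:
  fixes \<gamma> :: "real \<Rightarrow> complex"
  assumes c: "arc c1" "arc c2" "pathstart c1 = p" "pathfinish c1 = q" "pathstart c2 = p" "pathfinish c2 = q"
      "path_image c1 \<inter> path_image c2 = {p,q}" "path_image c1 \<union> path_image c2 = sphere 0 1"
    and \<gamma>: "arc \<gamma>" "pathstart \<gamma> = p" "pathfinish \<gamma> = q" "\<gamma> ` {0<..<1} \<subseteq> ball 0 1"
  defines "D1 \<equiv> closure (inside (path_image c1 \<union> path_image \<gamma>))"
    and "D2 \<equiv> closure (inside (path_image c2 \<union> path_image \<gamma>))"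
  shows "D1 \<union> D2 = cball 0 1" "D1 \<inter> D2 = path_image \<gamma>"
    "path_image c1 \<union> path_image \<gamma> \<subseteq> D1" "path_image c2 \<union> path_image \<gamma> \<subseteq> D2"
    "path_image c1 \<inter> path_image \<gamma> = {p,q}" "path_image c2 \<inter> path_image \<gamma> = {p,q}"
    "simple_path (c1 +++ reversepath \<gamma>)" "simple_path (c2 +++ reversepath \<gamma>)"
    "path_image (c1 +++ reversepath \<gamma>) = path_image c1 \<union> path_image \<gamma>"
    "path_image (c2 +++ reversepath \<gamma>) = path_image c2 \<union> path_image \<gamma>"
    "pathfinish (c1 +++ reversepath \<gamma>) = pathstart (c1 +++ reversepath \<gamma>)"
    "pathfinish (c2 +++ reversepath \<gamma>) = pathstart (c2 +++ reversepath \<gamma>)"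
proof -
  have "p \<noteq> q" using \<gamma> arc_distinct_ends by blast
  have "simple_path \<gamma>" using \<gamma> arc_imp_simple_path by blast
  then have pi: "path_image \<gamma> = \<gamma> ` {0<..<1} \<union> {p,q}" "\<gamma> ` {0<..<1} = path_image \<gamma> - {p,q}"
    using simple_path_endless[of \<gamma>] \<gamma> pathstart_in_path_image[of \<gamma>] pathfinish_in_path_image[of \<gamma>] by auto
  have sub: "path_image c1 \<subseteq> sphere 0 1" "path_image c2 \<subseteq> sphere 0 1" using c by auto
  have disj: "ball 0 1 \<inter> sphere 0 1 = ({} :: complex set)" by auto
  have pq: "p \<in> path_image c1" "q \<in> path_image c1" "p \<in> path_image c2" "q \<in> path_image c2"
    using c pathstart_in_path_image pathfinish_in_path_image by metis+
  show i1: "path_image c1 \<inter> path_image \<gamma> = {p,q}" and i2: "path_image c2 \<inter> path_image \<gamma> = {p,q}"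
    using pi(1) pq sub disj \<gamma>(4) by blast+
  have insph: "inside (sphere 0 1) = ball (0::complex) 1"
    using inside_frontier_eq_interior[of "cball (0::complex) 1"] by simp
  have ne: "path_image \<gamma> \<inter> inside (path_image c1 \<union> path_image c2) \<noteq> {}"
  proof -
    have "\<gamma> (1/2) \<in> \<gamma> ` {0<..<1}" by auto
    then show ?thesis unfolding c(8) insph using \<gamma>(4) pi(1) by blast
  qed
  show loop: "simple_path (c1 +++ reversepath \<gamma>)" "simple_path (c2 +++ reversepath \<gamma>)"
    using c \<gamma> i1 i2 by (auto simp: simple_path_join_loop_eq arc_reversepath)
  show pim: "path_image (c1 +++ reversepath \<gamma>) = path_image c1 \<union> path_image \<gamma>"
    "path_image (c2 +++ reversepath \<gamma>) = path_image c2 \<union> path_image \<gamma>"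
    using c \<gamma> by (auto simp: path_image_join)
  show fin: "pathfinish (c1 +++ reversepath \<gamma>) = pathstart (c1 +++ reversepath \<gamma>)"
    "pathfinish (c2 +++ reversepath \<gamma>) = pathstart (c2 +++ reversepath \<gamma>)"
    using c \<gamma> by simp_all
  define I1 where "I1 = inside (path_image c1 \<union> path_image \<gamma>)"
  define I2 where "I2 = inside (path_image c2 \<union> path_image \<gamma>)"
  have D: "D1 = I1 \<union> (path_image c1 \<union> path_image \<gamma>)" "D2 = I2 \<union> (path_image c2 \<union> path_image \<gamma>)"
    using Jordan_inside_outside[OF loop(1) fin(1)] Jordan_inside_outside[OF loop(2) fin(2)] closure_Un_frontier
    unfolding D1_def D2_def I1_def I2_def pim by metis+
  \<comment> \<open>The theta-curve theorem for the circle and \<gamma>. Closing up the two domains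
    adds only their boundary curves, so the closed halves meet exactly in \<gamma>, as gluing along
    it requires.\<close>
  have "I1 \<inter> I2 = {} \<and> I1 \<union> I2 \<union> (path_image \<gamma> - {p,q}) = ball 0 1"
  proof (rule split_inside_simple_closed_curve[of c1 p q c2 \<gamma>])
    show "simple_path c1" "simple_path c2" "simple_path \<gamma>"
      using c \<gamma> arc_imp_simple_path by blast+
    show "\<lbrakk>inside (path_image c1 \<union> path_image \<gamma>) \<inter> inside (path_image c2 \<union> path_image \<gamma>) = {};
      inside (path_image c1 \<union> path_image \<gamma>) \<union> inside (path_image c2 \<union> path_image \<gamma>) \<union>
      (path_image \<gamma> - {p, q}) = inside (path_image c1 \<union> path_image c2)\<rbrakk>
     \<Longrightarrow> I1 \<inter> I2 = {} \<and> I1 \<union> I2 \<union> (path_image \<gamma> - {p, q}) = ball 0 1"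
      unfolding I1_def I2_def c(8) insph by blast
  qed (use c \<gamma> \<open>p \<noteq> q\<close> i1 i2 ne in auto)
  then have I: "I1 \<inter> I2 = {}" "I1 \<union> I2 \<union> (path_image \<gamma> - {p,q}) = ball 0 1" by blast+
  have Idis: "I1 \<inter> (path_image c1 \<union> path_image \<gamma>) = {}" "I2 \<inter> (path_image c2 \<union> path_image \<gamma>) = {}"
    unfolding I1_def I2_def using inside_no_overlap by blast+
  show "path_image c1 \<union> path_image \<gamma> \<subseteq> D1" "path_image c2 \<union> path_image \<gamma> \<subseteq> D2" using D by auto
  have cb: "cball (0::complex) 1 = ball 0 1 \<union> sphere 0 1" by auto
  show "D1 \<union> D2 = cball 0 1"
    using I(2) c(8) pq unfolding cb D by blast
  have "I1 \<subseteq> ball 0 1" "I2 \<subseteq> ball 0 1" using I(2) by auto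
  then show "D1 \<inter> D2 = path_image \<gamma>"
    unfolding D using I(1) Idis c(7) sub disj pi(1) by blast
qed

lemma crosscut_circle_arcs:
  fixes p q :: complex
  assumes "norm p = 1" "norm q = 1" "p \<noteq> q"
  obtains c1 c2 where "arc c1" "arc c2" "pathstart c1 = p" "pathfinish c1 = q"
    "pathstart c2 = p" "pathfinish c2 = q"
    "path_image c1 \<inter> path_image c2 = {p,q}" "path_image c1 \<union> path_image c2 = sphere 0 1"
proof -
  have "p \<in> path_image (circlepath 0 1)" "q \<in> path_image (circlepath 0 1)" using assms by auto
  then obtain u d where ud: "arc u" "arc d" "pathstart u = p" "pathfinish u = q"
      "pathstart d = q" "pathfinish d = p" "path_image u \<inter> path_image d = {p,q}"
      "path_image u \<union> path_image d = path_image (circlepath 0 1)"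
    using exists_double_arc[of "circlepath 0 1" p q] assms by (metis pathfinish_circlepath pathstart_circlepath simple_path_circlepath zero_neq_one)
  show thesis
    by (rule that[of u "reversepath d"]) (use ud in \<open>auto simp: arc_reversepath\<close>)
qed

text \<open>The two closed pieces overlap only in \<open>p\<close> and \<open>q\<close>, which
  \<theta> fixes, so \<theta> on \<open>G\<close> and the identity on \<open>C\<close> fit
  together.\<close>

lemma homeomorphism_theta_side:
  fixes \<theta> \<theta>' :: "'a::metric_space \<Rightarrow> 'a"
  assumes k: "homeomorphism G H \<theta> \<theta>'" and "compact C" "compact G" "compact H"
    and CG: "C \<inter> G = {p,q}" and CH: "C \<inter> H = {p,q}" and \<theta>: "\<theta> p = p" "\<theta> q = q"
  shows "homeomorphism (C \<union> G) (C \<union> H) (\<lambda>z. if z \<in> G then \<theta> z else z) (\<lambda>z. if z \<in> H then \<theta>' z else z)"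
proof -
  have pq: "p \<in> G" "q \<in> G" "p \<in> H" "q \<in> H" "p \<in> C" "q \<in> C" using CG CH by auto
  have \<theta>': "\<theta>' p = p" "\<theta>' q = q" using k \<theta> pq by (metis homeomorphism_apply1)+
  have cont: "continuous_on (C \<union> G) (\<lambda>z. if z \<in> G then \<theta> z else z)"
    if "continuous_on G \<theta>" "C \<inter> G = {p,q}" "\<theta> p = p" "\<theta> q = q" "compact G" for G and \<theta> :: "'a \<Rightarrow> 'a"
  proof -
    have "continuous_on (G \<union> C) (\<lambda>z. if z \<in> G then \<theta> z else z)"
    proof (rule continuous_on_cases)
      show "closed G" "closed C" using that(5) \<open>compact C\<close> by (simp_all add: compact_imp_closed)
    qed (use that in auto)
    then show ?thesis by (simp add: Un_commute)
  qed
  have im: "\<theta> z \<in> H" "\<theta>' (\<theta> z) = z" if "z \<in> G" for z using k that by (auto simp: homeomorphism_def)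
  have im': "\<theta>' z \<in> G" "\<theta> (\<theta>' z) = z" if "z \<in> H" for z using k that by (auto simp: homeomorphism_def)
  show ?thesis
  proof (rule homeomorphismI)
    show "continuous_on (C \<union> G) (\<lambda>z. if z \<in> G then \<theta> z else z)"
      using cont[OF _ CG \<theta>] k assms(3) by (auto simp: homeomorphism_def)
    show "continuous_on (C \<union> H) (\<lambda>z. if z \<in> H then \<theta>' z else z)"
      using cont[OF _ CH \<theta>'] k assms(4) by (auto simp: homeomorphism_def)
  qed (use im im' CG CH \<theta> \<theta>' in \<open>auto split: if_splits\<close>)
qed

text \<open>The identity on the circle and the matching of \<gamma> with \<delta> by parameters form
  a homeomorphism of theta curves. It extends over each of the two Jordan domains, and the
  extensions agree on the crosscut.\<close>

theorem crosscut_homeomorphism: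
  fixes \<gamma> \<delta> :: "real \<Rightarrow> complex"
  assumes pq: "norm p = 1" "norm q = 1"
    and \<gamma>: "arc \<gamma>" "pathstart \<gamma> = p" "pathfinish \<gamma> = q" "\<gamma> ` {0<..<1} \<subseteq> ball 0 1"
    and \<delta>: "arc \<delta>" "pathstart \<delta> = p" "pathfinish \<delta> = q" "\<delta> ` {0<..<1} \<subseteq> ball 0 1"
  obtains \<Psi> \<Psi>' where "homeomorphism (cball 0 1) (cball 0 1) \<Psi> \<Psi>'"
    "\<And>z. z \<in> sphere 0 1 \<Longrightarrow> \<Psi> z = z" "\<And>t. t \<in> {0..1} \<Longrightarrow> \<Psi> (\<gamma> t) = \<delta> t"
proof -
  have "p \<noteq> q" using \<gamma> arc_distinct_ends by blast
  obtain c1 c2 where c: "arc c1" "arc c2" "pathstart c1 = p" "pathfinish c1 = q"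
    "pathstart c2 = p" "pathfinish c2 = q"
    "path_image c1 \<inter> path_image c2 = {p,q}" "path_image c1 \<union> path_image c2 = sphere 0 1"
    using crosscut_circle_arcs[OF pq \<open>p \<noteq> q\<close>] .
  note G = theta_crosscut[OF c \<gamma>]
  note H = theta_crosscut[OF c \<delta>]
  obtain g where g: "homeomorphism {0..1} (path_image \<gamma>) \<gamma> g"
    using homeomorphism_arc[OF \<gamma>(1)] by blast
  obtain d where d: "homeomorphism {0..1} (path_image \<delta>) \<delta> d"
    using homeomorphism_arc[OF \<delta>(1)] by blast
  have gd: "homeomorphism (path_image \<gamma>) (path_image \<delta>) (\<delta> \<circ> g) (\<gamma> \<circ> d)"
    using homeomorphism_compose[OF homeomorphism_symD[OF g] d] .
  have g\<gamma>: "g (\<gamma> t) = t" if "t \<in> {0..1}" for t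
    using g that by (auto simp: homeomorphism_def)
  have fix_pq: "(\<delta> \<circ> g) p = p" "(\<delta> \<circ> g) q = q"
    using g\<gamma>[of 0] g\<gamma>[of 1] \<gamma> \<delta> by (auto simp: pathstart_def pathfinish_def)
  define k where "k z = (if z \<in> path_image \<gamma> then (\<delta> \<circ> g) z else z)" for z
  define k' where "k' z = (if z \<in> path_image \<delta> then (\<gamma> \<circ> d) z else z)" for z
  have cmp: "compact (path_image c1)" "compact (path_image c2)" "compact (path_image \<gamma>)" "compact (path_image \<delta>)"
    using c \<gamma> \<delta> arc_imp_path compact_path_image by blast+
  have k1: "homeomorphism (path_image c1 \<union> path_image \<gamma>) (path_image c1 \<union> path_image \<delta>) k k'"
    unfolding k_def k'_def
    by (rule homeomorphism_theta_side[OF gd cmp(1,3,4) G(5) H(5) fix_pq])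
  have k2: "homeomorphism (path_image c2 \<union> path_image \<gamma>) (path_image c2 \<union> path_image \<delta>) k k'"
    unfolding k_def k'_def
    by (rule homeomorphism_theta_side[OF gd cmp(2,3,4) G(6) H(6) fix_pq])
  define D1 D2 where "D1 = closure (inside (path_image c1 \<union> path_image \<gamma>))"
    and "D2 = closure (inside (path_image c2 \<union> path_image \<gamma>))"
  define F1 F2 where "F1 = closure (inside (path_image c1 \<union> path_image \<delta>))"
    and "F2 = closure (inside (path_image c2 \<union> path_image \<delta>))"
  obtain K1 K1' where K1: "homeomorphism D1 F1 K1 K1'"
      "\<And>x. x \<in> path_image c1 \<union> path_image \<gamma> \<Longrightarrow> K1 x = k x" "\<And>x. x \<in> path_image c1 \<union> path_image \<delta> \<Longrightarrow> K1' x = k' x"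
    using Jordan_homeomorphism_extension[OF G(7,11) H(7,11), unfolded G(9) H(9), OF k1]
    unfolding D1_def F1_def by metis
  obtain K2 K2' where K2: "homeomorphism D2 F2 K2 K2'"
      "\<And>x. x \<in> path_image c2 \<union> path_image \<gamma> \<Longrightarrow> K2 x = k x" "\<And>x. x \<in> path_image c2 \<union> path_image \<delta> \<Longrightarrow> K2' x = k' x"
    using Jordan_homeomorphism_extension[OF G(8,12) H(8,12), unfolded G(10) H(10), OF k2]
    unfolding D2_def F2_def by metis
  note G' = G(1-4)[folded D1_def D2_def] and H' = H(1-4)[folded F1_def F2_def]
  have agree: "K1 x = K2 x" if "x \<in> D1" "x \<in> D2" for x
    using that G'(2) K1(2) K2(2) by (metis IntI UnI2)
  have agree': "K1' x = K2' x" if "x \<in> F1" "x \<in> F2" for x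
    using that H'(2) K1(3) K2(3) by (metis IntI UnI2)
  define \<Psi> where "\<Psi> z = (if z \<in> D1 then K1 z else K2 z)" for z
  define \<Psi>' where "\<Psi>' z = (if z \<in> F1 then K1' z else K2' z)" for z
  have \<Psi>2: "\<Psi> z = K2 z" if "z \<in> D2" for z using that agree by (simp add: \<Psi>_def)
  have \<Psi>'2: "\<Psi>' z = K2' z" if "z \<in> F2" for z using that agree' by (simp add: \<Psi>'_def)
  have h1: "K1 z \<in> F1 \<and> K1' (K1 z) = z" if "z \<in> D1" for z using K1(1) that by (auto simp: homeomorphism_def)
  have h2: "K2 z \<in> F2 \<and> K2' (K2 z) = z" if "z \<in> D2" for z using K2(1) that by (auto simp: homeomorphism_def)
  have h1': "K1' z \<in> D1 \<and> K1 (K1' z) = z" if "z \<in> F1" for z using K1(1) that by (auto simp: homeomorphism_def)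
  have h2': "K2' z \<in> D2 \<and> K2 (K2' z) = z" if "z \<in> F2" for z using K2(1) that by (auto simp: homeomorphism_def)
  have clo: "closed D1" "closed D2" "closed F1" "closed F2" by (simp_all add: D1_def D2_def F1_def F2_def)
  have "homeomorphism (D1 \<union> D2) (F1 \<union> F2) \<Psi> \<Psi>'"
  proof (rule homeomorphismI)
    show "continuous_on (D1 \<union> D2) \<Psi>" unfolding \<Psi>_def
      by (rule continuous_on_cases) (use clo K1(1) K2(1) agree in \<open>auto simp: homeomorphism_def\<close>)
    show "continuous_on (F1 \<union> F2) \<Psi>'" unfolding \<Psi>'_def
      by (rule continuous_on_cases) (use clo K1(1) K2(1) agree' in \<open>auto simp: homeomorphism_def\<close>)
    show "\<Psi> ` (D1 \<union> D2) \<subseteq> F1 \<union> F2" using h1 h2 by (auto simp: \<Psi>_def)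
    show "\<Psi>' ` (F1 \<union> F2) \<subseteq> D1 \<union> D2" using h1' h2' by (auto simp: \<Psi>'_def)
    show "\<Psi>' (\<Psi> z) = z" if "z \<in> D1 \<union> D2" for z
      using that h1[of z] h2[of z] \<Psi>2[of z] \<Psi>'2 by (cases "z \<in> D1") (auto simp: \<Psi>_def \<Psi>'_def)
    show "\<Psi> (\<Psi>' z) = z" if "z \<in> F1 \<union> F2" for z
      using that h1'[of z] h2'[of z] \<Psi>'2[of z] \<Psi>2 by (cases "z \<in> F1") (auto simp: \<Psi>_def \<Psi>'_def)
  qed
  then have hom: "homeomorphism (cball 0 1) (cball 0 1) \<Psi> \<Psi>'" by (simp add: G' H')
  have \<Psi>k: "\<Psi> z = k z" if "z \<in> path_image c1 \<union> path_image c2 \<union> path_image \<gamma>" for z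
  proof (cases "z \<in> path_image c1 \<union> path_image \<gamma>")
    case True
    then show ?thesis using G'(3) K1(2) by (auto simp: \<Psi>_def)
  next
    case False
    then have "z \<in> path_image c2 \<union> path_image \<gamma>" using that by auto
    then show ?thesis using G'(4) K2(2) \<Psi>2 by auto
  qed
  show thesis
  proof (rule that[OF hom])
    show "\<Psi> z = z" if "z \<in> sphere 0 1" for z
    proof (cases "z \<in> path_image \<gamma>")
      case True
      then have "z = p \<or> z = q" using that c(8) G(5,6) by blast
      then show ?thesis using \<Psi>k[of z] True fix_pq that c(8) by (auto simp: k_def)
    next
      case False
      then show ?thesis using \<Psi>k[of z] that c(8) by (auto simp: k_def)
    qed
    show "\<Psi> (\<gamma> t) = \<delta> t" if "t \<in> {0..1}" for t
    proof -
      have "\<gamma> t \<in> path_image \<gamma>" using that by (auto simp: path_image_def)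
      then show ?thesis using \<Psi>k[of "\<gamma> t"] g\<gamma>[OF that] by (simp add: k_def)
    qed
  qed
qed

section \<open>Isotopy to the identity, and crossing of crosscuts\<close>

lemma disc_homeomorphism_ball:
  fixes \<Psi> \<Psi>' :: "complex \<Rightarrow> complex"
  assumes hom: "homeomorphism (cball 0 1) (cball 0 1) \<Psi> \<Psi>'" and fix_s: "\<And>z. z \<in> sphere 0 1 \<Longrightarrow> \<Psi> z = z"
    and z: "norm z < 1"
  shows "norm (\<Psi> z) < 1"
proof (rule ccontr)
  assume "\<not> norm (\<Psi> z) < 1"
  have \<Psi>: "\<And>z. norm z \<le> 1 \<Longrightarrow> norm (\<Psi> z) \<le> 1" "\<And>z. norm z \<le> 1 \<Longrightarrow> \<Psi>' (\<Psi> z) = z"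
    using hom by (auto simp: homeomorphism_def)
  have 1: "norm (\<Psi> z) = 1" using \<open>\<not> norm (\<Psi> z) < 1\<close> \<Psi>(1)[of z] z by simp
  then have "\<Psi> (\<Psi> z) = \<Psi> z" using fix_s by simp
  then have "\<Psi> z = z" using \<Psi>(2)[of z] \<Psi>(2)[of "\<Psi> z"] z 1 by simp
  then show False using 1 z by simp
qed

text \<open>Alexander's trick: \<open>\<Psi>\<close>, extended by the identity, is rescaled to the disc of radius \<open>s\<close>.\<close>

lemma Alexander_isotopy:
  fixes \<Psi> \<Psi>' :: "complex \<Rightarrow> complex"
  assumes hom: "homeomorphism (cball 0 1) (cball 0 1) \<Psi> \<Psi>'" and fix_sphere: "\<forall>z\<in>sphere 0 1. \<Psi> z = z"
  shows "\<exists>\<Theta> :: real \<Rightarrow> complex \<Rightarrow> complex. continuous_on UNIV (\<lambda>x. \<Theta> (fst x) (snd x)) \<and> (\<forall>s. inj (\<Theta> s)) \<and>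
    (\<forall>s\<in>{0..1}. \<forall>z. norm z = 1 \<longrightarrow> \<Theta> s z = z) \<and>
    (\<forall>s\<in>{0..1}. \<forall>z. norm z < 1 \<longrightarrow> norm (\<Theta> s z) < 1) \<and>
    (\<forall>z. \<Theta> 0 z = z) \<and> (\<forall>z. norm z \<le> 1 \<longrightarrow> \<Theta> 1 z = \<Psi> z)"
proof -
  have fix_s: "\<Psi> z = z" if "z \<in> sphere 0 1" for z using fix_sphere that by blast
  have \<Psi>: "continuous_on (cball 0 1) \<Psi>" "\<And>z. z \<in> cball 0 1 \<Longrightarrow> \<Psi> z \<in> cball 0 1"
    "\<And>z. z \<in> cball 0 1 \<Longrightarrow> \<Psi>' (\<Psi> z) = z"
    using hom by (auto simp: homeomorphism_def)
  have \<Psi>ball: "norm (\<Psi> z) < 1" if "norm z < 1" for z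
    using hom fix_s that by (rule disc_homeomorphism_ball)
  define X where "X z = (if z \<in> cball 0 1 then \<Psi> z else z)" for z
  have contX: "continuous_on UNIV X"
  proof -
    have "continuous_on (cball 0 1 \<union> - ball 0 1) X"
      unfolding X_def by (rule continuous_on_cases) (use \<Psi>(1) fix_s in \<open>auto simp: closed_Compl\<close>)
    moreover have "cball 0 1 \<union> - ball 0 1 = (UNIV :: complex set)" by auto
    ultimately show ?thesis by simp
  qed
  have injX: "inj X"
    by (rule injI) (metis X_def \<Psi>(2,3))
  have Xdist: "norm (X z - z) \<le> 2" for z
  proof (cases "z \<in> cball 0 1")
    case True
    then show ?thesis using \<Psi>(2)[OF True] norm_triangle_ineq4[of "\<Psi> z" z] by (simp add: X_def)
  qed (simp add: X_def)
  \<comment> \<open>The disc on which \<open>\<Theta> s\<close> moves points shrinks to the origin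
    with \<open>s\<close>, so the identity is the continuous choice at 0;
    \<open>\<Theta>dist\<close> gives the bound.\<close>
  define \<Theta> where "\<Theta> s z = (if s = 0 then z else s *\<^sub>R X (z /\<^sub>R s))" for s :: real and z
  have \<Theta>dist: "norm (\<Theta> s z - z) \<le> 2 * \<bar>s\<bar>" for s z
  proof (cases "s = 0")
    case False
    then have "\<Theta> s z - z = s *\<^sub>R (X (z /\<^sub>R s) - z /\<^sub>R s)" by (simp add: \<Theta>_def algebra_simps)
    then have "norm (\<Theta> s z - z) = \<bar>s\<bar> * norm (X (z /\<^sub>R s) - z /\<^sub>R s)" by simp
    also have "\<dots> \<le> \<bar>s\<bar> * 2" by (intro mult_left_mono Xdist) auto
    finally show ?thesis by simp
  qed (simp add: \<Theta>_def)
  have "isCont (\<lambda>x. \<Theta> (fst x) (snd x)) (s, z)" for s z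
  proof (cases "s = 0")
    case False
    have "continuous_on ((- {0}) \<times> UNIV) (\<lambda>x. fst x *\<^sub>R X (snd x /\<^sub>R fst x))"
      by (intro continuous_intros continuous_on_compose2[OF contX]) auto
    then have "continuous_on ((- {0}) \<times> UNIV) (\<lambda>x. \<Theta> (fst x) (snd x))"
      by (rule continuous_on_eq) (auto simp: \<Theta>_def)
    moreover have "open ((- {0::real}) \<times> (UNIV :: complex set))" by (intro open_Times) auto
    ultimately show ?thesis using False continuous_on_eq_continuous_at by blast
  next
    case True
    have lim: "((\<lambda>x. 2 * \<bar>fst x\<bar> + norm (snd x - z)) \<longlongrightarrow> 2 * \<bar>fst (0::real, z)\<bar> + norm (snd (0::real, z) - z)) (at (0, z))"
      by (intro tendsto_intros)
    have "((\<lambda>x. \<Theta> (fst x) (snd x) - z) \<longlongrightarrow> 0) (at (0, z))"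
    proof (rule tendsto_0_le[OF _ always_eventually, where K = 1])
      show "((\<lambda>x. 2 * \<bar>fst x\<bar> + norm (snd x - z)) \<longlongrightarrow> 0) (at (0::real, z))" using lim by simp
      show "\<forall>x. norm (\<Theta> (fst x) (snd x) - z) \<le> norm (2 * \<bar>fst x\<bar> + norm (snd x - z)) * 1"
      proof
        fix x :: "real \<times> complex"
        have "norm (\<Theta> (fst x) (snd x) - z) \<le> norm (\<Theta> (fst x) (snd x) - snd x) + norm (snd x - z)"
          by (rule order_trans[OF _ norm_triangle_ineq]) simp
        then show "norm (\<Theta> (fst x) (snd x) - z) \<le> norm (2 * \<bar>fst x\<bar> + norm (snd x - z)) * 1"
          using \<Theta>dist[of "fst x" "snd x"] by simp
      qed
    qed
    then have "((\<lambda>x. \<Theta> (fst x) (snd x)) \<longlongrightarrow> z) (at (0, z))" using LIM_zero_iff by blast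
    then show ?thesis unfolding isCont_def True by (simp add: \<Theta>_def)
  qed
  then have cont: "continuous_on UNIV (\<lambda>x. \<Theta> (fst x) (snd x))"
    by (simp add: continuous_at_imp_continuous_on)
  show ?thesis
  proof (intro exI[of _ \<Theta>] conjI allI ballI impI cont)
    show "inj (\<Theta> s)" for s
    proof (rule injI)
      fix x y assume "\<Theta> s x = \<Theta> s y"
      then show "x = y" using injD[OF injX] by (cases "s = 0") (fastforce simp: \<Theta>_def)+
    qed
    show "\<Theta> s z = z" if "s \<in> {0..1}" "norm z = 1" for s z
    proof (cases "s = 0 \<or> s = 1")
      case True
      then show ?thesis using that fix_s by (auto simp: \<Theta>_def X_def)
    next
      case False
      then have "norm (z /\<^sub>R s) > 1" using that by (auto simp: field_simps)
      then show ?thesis using False by (simp add: \<Theta>_def X_def)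
    qed
    show "norm (\<Theta> s z) < 1" if "s \<in> {0..1}" "norm z < 1" for s z
    proof (cases "s = 0 \<or> z /\<^sub>R s \<notin> cball 0 1")
      case True
      then have "\<Theta> s z = z" by (auto simp: \<Theta>_def X_def)
      then show ?thesis using that by simp
    next
      case False
      then have *: "\<Theta> s z = s *\<^sub>R \<Psi> (z /\<^sub>R s)" "z /\<^sub>R s \<in> cball 0 1" by (auto simp: \<Theta>_def X_def)
      show ?thesis
      proof (cases "s = 1")
        case True
        then show ?thesis using * \<Psi>ball that by simp
      next
        case s1: False
        have "norm (\<Theta> s z) \<le> s * 1"
          unfolding * norm_scaleR using that \<Psi>(2)[OF *(2)] by (intro mult_mono) auto
        then show ?thesis using that s1 by simp
      qed
    qed
    show "\<Theta> 0 z = z" for z by (simp add: \<Theta>_def)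
    show "\<Theta> 1 z = \<Psi> z" if "norm z \<le> 1" for z using that by (simp add: \<Theta>_def X_def)
  qed
qed

text \<open>Straightening \<gamma> to a chord by a homeomorphism that fixes the circle leaves
  \<open>r\<close> and \<open>s\<close> on opposite sides, so the image of \<delta> meets the chord
  by the intermediate value theorem.\<close>

lemma crosscuts_intersect:
  fixes \<gamma> \<delta> :: "real \<Rightarrow> complex"
  assumes pq: "norm p = 1" "norm q = 1"
    and \<gamma>: "arc \<gamma>" "pathstart \<gamma> = p" "pathfinish \<gamma> = q" "\<gamma> ` {0<..<1} \<subseteq> ball 0 1"
    and rs: "norm r = 1" "norm s = 1"
    and \<delta>: "path \<delta>" "pathstart \<delta> = r" "pathfinish \<delta> = s" "\<delta> ` {0<..<1} \<subseteq> ball 0 1"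
    and sep: "orient p q r > 0" "orient p q s < 0"
  shows "\<gamma> ` {0<..<1} \<inter> \<delta> ` {0<..<1} \<noteq> {}"
proof -
  have "p \<noteq> q" using \<gamma> arc_distinct_ends by blast
  have lin: "linepath p q ` {0<..<1} = open_segment p q"
    using \<open>p \<noteq> q\<close> by (simp add: linepath_def open_segment_image_interval)
  then have "linepath p q ` {0<..<1} \<subseteq> ball 0 1"
    using open_segment_sphere_subset_ball[OF pq] by simp
  then obtain \<Psi> \<Psi>' where hom: "homeomorphism (cball 0 1) (cball 0 1) \<Psi> \<Psi>'"
    and \<Psi>: "\<And>z. z \<in> sphere 0 1 \<Longrightarrow> \<Psi> z = z" "\<And>t. t \<in> {0..1} \<Longrightarrow> \<Psi> (\<gamma> t) = linepath p q t"
    using crosscut_homeomorphism[OF pq \<gamma>, of "linepath p q"] \<open>p \<noteq> q\<close> by (metis arc_linepath pathfinish_linepath pathstart_linepath)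
  have \<Psi>ball: "norm (\<Psi> z) < 1" if "norm z < 1" for z
    using hom \<Psi>(1) that by (rule disc_homeomorphism_ball)
  have \<Psi>c: "continuous_on (cball 0 1) \<Psi>" "\<And>z. z \<in> cball 0 1 \<Longrightarrow> \<Psi>' (\<Psi> z) = z"
    using hom by (auto simp: homeomorphism_def)
  have \<delta>01: "\<delta> 0 = r" "\<delta> 1 = s" using \<delta> by (auto simp: pathstart_def pathfinish_def)
  have \<delta>in: "\<delta> t \<in> cball 0 1" if "t \<in> {0..1}" for t
  proof (cases "t = 0 \<or> t = 1")
    case False
    then have "\<delta> t \<in> \<delta> ` {0<..<1}" using that by auto
    then show ?thesis using \<delta>(4) by (auto dest!: subsetD)
  qed (use \<delta>01 rs in auto)
  have "continuous_on {0..1} (\<lambda>t. orient p q (\<Psi> (\<delta> t)))"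
    using \<delta>(1) \<delta>in unfolding path_def
    by (intro continuous_intros continuous_on_compose2[OF \<Psi>c(1)]) auto
  moreover have "orient p q (\<Psi> (\<delta> 1)) \<le> 0" "0 \<le> orient p q (\<Psi> (\<delta> 0))"
    using sep rs \<Psi>(1) \<delta>01 by auto
  ultimately obtain t where t: "0 \<le> t" "t \<le> 1" "orient p q (\<Psi> (\<delta> t)) = 0"
    using IVT2'[of "\<lambda>t. orient p q (\<Psi> (\<delta> t))" 1 0 0] by auto
  have "t \<noteq> 0" "t \<noteq> 1" using t sep rs \<Psi>(1) \<delta>01 by auto
  then have t01: "t \<in> {0<..<1}" using t by auto
  then have \<delta>t: "norm (\<delta> t) < 1" using \<delta>(4) by (auto simp: image_subset_iff)
  then have "\<Psi> (\<delta> t) \<in> open_segment p q"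
    using orient_eq_0_ball_imp_open_segment[OF pq \<open>p \<noteq> q\<close> \<Psi>ball t(3)] by simp
  then obtain u where u: "u \<in> {0<..<1}" "\<Psi> (\<delta> t) = linepath p q u" using lin by blast
  then have "\<Psi> (\<delta> t) = \<Psi> (\<gamma> u)" using \<Psi>(2)[of u] by simp
  moreover have "norm (\<gamma> u) < 1" using \<gamma>(4) u by (auto simp: image_subset_iff)
  ultimately have "\<delta> t = \<gamma> u" using \<Psi>c(2) \<delta>t by (metis less_imp_le mem_cball_0)
  then show ?thesis using t01 u(1) by blast
qed

section \<open>Curves in the strip and chords of the disc\<close>

text \<open>A homeomorphism from the plane onto a vertical band which maps the strip onto the unit disc
  and its two limit points to \<open>1\<close> and \<open>-1\<close>.\<close>

definition disc_of :: "real \<times> real \<Rightarrow> complex" where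
  "disc_of p = Complex (fst p / sqrt (1 + (fst p)\<^sup>2)) ((2 * snd p - 1) / sqrt (1 + (fst p)\<^sup>2))"

definition strip_of :: "complex \<Rightarrow> real \<times> real" where
  "strip_of z = (Re z / sqrt (1 - (Re z)\<^sup>2), (1 + Im z / sqrt (1 - (Re z)\<^sup>2)) / 2)"

definition band :: "complex set" where
  "band = {z. \<bar>Re z\<bar> < 1}"

lemma one_plus_sq_pos: "0 < 1 + (x::real)\<^sup>2"
  by (simp add: add_pos_nonneg)

lemma disc_of_in_band: "disc_of p \<in> band"
proof -
  have "\<bar>sin (arctan (fst p))\<bar> < 1"
    using sin_monotone_2pi[of "-(pi/2)" "arctan (fst p)"] sin_monotone_2pi[of "arctan (fst p)" "pi/2"]
      arctan_lbound[of "fst p"] arctan_ubound[of "fst p"] by auto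
  then show ?thesis by (simp add: band_def disc_of_def sin_arctan)
qed

lemma strip_of_disc_of [simp]: "strip_of (disc_of p) = p"
proof -
  have "1 - (fst p / sqrt (1 + (fst p)\<^sup>2))\<^sup>2 = 1 / (1 + (fst p)\<^sup>2)"
    using one_plus_sq_pos[of "fst p"] by (simp add: power_divide field_simps)
  then show ?thesis
    using one_plus_sq_pos[of "fst p"]
    by (simp add: strip_of_def disc_of_def prod_eq_iff real_sqrt_divide)
qed

lemma disc_of_strip_of: "z \<in> band \<Longrightarrow> disc_of (strip_of z) = z"
proof -
  assume "z \<in> band"
  then have pos: "0 < 1 - (Re z)\<^sup>2" by (simp add: band_def abs_square_less_1)
  then have "1 + (Re z / sqrt (1 - (Re z)\<^sup>2))\<^sup>2 = 1 / (1 - (Re z)\<^sup>2)"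
    by (simp add: power_divide field_simps)
  then have *: "sqrt (1 + (Re z / sqrt (1 - (Re z)\<^sup>2))\<^sup>2) = 1 / sqrt (1 - (Re z)\<^sup>2)"
    by (simp add: real_sqrt_divide)
  have **: "2 * ((1 + x) / 2) - 1 = x" for x :: real by (simp add: field_simps)
  show ?thesis
    using pos unfolding disc_of_def strip_of_def fst_conv snd_conv * ** by (simp add: complex_eq_iff)
qed

lemma continuous_on_disc_of: "continuous_on UNIV disc_of"
proof -
  have "sqrt (1 + (fst p)\<^sup>2) \<noteq> 0" for p :: "real \<times> real"
    using one_plus_sq_pos[of "fst p"] by simp
  then have "continuous_on UNIV (\<lambda>p. of_real (fst p / sqrt (1 + (fst p)\<^sup>2)) +
      \<i> * of_real ((2 * snd p - 1) / sqrt (1 + (fst p)\<^sup>2)))"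
    by (intro continuous_intros) auto
  then show ?thesis unfolding disc_of_def Complex_eq .
qed

lemma continuous_on_strip_of: "continuous_on band strip_of"
proof -
  have "sqrt (1 - (Re z)\<^sup>2) \<noteq> 0" if "z \<in> band" for z
    using that by (simp add: band_def abs_square_eq_1 less_le)
  then show ?thesis
    unfolding strip_of_def by (intro continuous_intros) auto
qed

lemma open_band: "open band"
  unfolding band_def by (intro open_Collect_less continuous_intros)

lemma inj_disc_of: "inj disc_of"
  by (metis injI strip_of_disc_of)

lemma norm_disc_of: "(norm (disc_of p))\<^sup>2 = 1 - 4 * snd p * (1 - snd p) / (1 + (fst p)\<^sup>2)"
proof -
  have N: "1 + (fst p)\<^sup>2 > 0" by (rule one_plus_sq_pos)
  have "(norm (disc_of p))\<^sup>2 = ((fst p)\<^sup>2 + (2 * snd p - 1)\<^sup>2) / (1 + (fst p)\<^sup>2)"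
    using N unfolding cmod_power2 disc_of_def by (simp add: power_divide add_divide_distrib)
  also have "(fst p)\<^sup>2 + (2 * snd p - 1)\<^sup>2 = (1 + (fst p)\<^sup>2) - 4 * snd p * (1 - snd p)"
    by (simp add: power2_eq_square algebra_simps)
  also have "\<dots> / (1 + (fst p)\<^sup>2) = 1 - 4 * snd p * (1 - snd p) / (1 + (fst p)\<^sup>2)"
    using N by (simp add: diff_divide_distrib)
  finally show ?thesis .
qed

lemma norm_disc_of_less_1: "norm (disc_of p) < 1 \<longleftrightarrow> p \<in> open_strip"
proof -
  have "norm (disc_of p) < 1 \<longleftrightarrow> (norm (disc_of p))\<^sup>2 < 1" by (simp add: abs_square_less_1)
  also have "\<dots> \<longleftrightarrow> 0 < snd p * (1 - snd p)"
    unfolding norm_disc_of using one_plus_sq_pos[of "fst p"] by (simp add: zero_less_divide_iff)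
  also have "\<dots> \<longleftrightarrow> p \<in> open_strip" by (cases p) (auto simp: open_strip_def zero_less_mult_iff)
  finally show ?thesis .
qed

lemma norm_disc_of_eq_1: "snd p \<in> {0,1} \<Longrightarrow> norm (disc_of p) = 1"
  using norm_disc_of[of p] by (auto simp: power2_eq_1_iff) (smt (verit) norm_ge_zero)+

lemma ball_subset_band: "ball 0 1 \<subseteq> band"
  using abs_Re_le_cmod by (force simp: band_def intro: le_less_trans)

fun point_of :: "endpoint \<Rightarrow> complex" where
  "point_of (Vertex p) = disc_of p"
| "point_of Plus_Infinity = 1"
| "point_of Minus_Infinity = -1"

definition boundary_ends :: "endpoint set" where
  "boundary_ends = {Plus_Infinity, Minus_Infinity} \<union> Vertex ` {p. snd p \<in> {0,1}}"

lemma inj_point_of: "inj point_of"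
proof (rule injI)
  fix e f assume *: "point_of e = point_of f"
  have ne: "disc_of p \<noteq> 1" "disc_of p \<noteq> -1" for p
    using disc_of_in_band[of p] by (auto simp: band_def)
  then show "e = f"
    using * by (cases e; cases f) (auto simp: inj_eq[OF inj_disc_of] ne[symmetric])
qed

lemma norm_point_of: "e \<in> boundary_ends \<Longrightarrow> norm (point_of e) = 1"
  unfolding boundary_ends_def using norm_disc_of_eq_1 by force

lemma Re_disc_of: "Re (disc_of p) = sin (arctan (fst p))"
  and Im_disc_of: "Im (disc_of p) = (2 * snd p - 1) * cos (arctan (fst p))"
  by (simp_all add: disc_of_def sin_arctan cos_arctan)

lemma sin_arctan_less_iff: "sin (arctan x) < sin (arctan y) \<longleftrightarrow> x < y"
proof -
  have "sin (arctan x) < sin (arctan y)" if "x < y" for x y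
    using that arctan_lbound[of x] arctan_ubound[of y] by (intro sin_monotone_2pi) (auto simp: arctan_less_iff)
  then show ?thesis by (metis less_asym' linorder_neqE_linordered_idom less_irrefl)
qed

text \<open>The imaginary part is a cosine that tends to 0 times \<open>2 * snd (g x) - 1\<close>,
  which is bounded because the curve stays in the strip.\<close>

lemma tendsto_disc_of_infinity:
  assumes ev: "eventually (\<lambda>x. g x \<in> open_strip) F"
    and lim: "((\<lambda>x. arctan (fst (g x))) \<longlongrightarrow> s * (pi/2)) F" and s: "s = 1 \<or> s = -1"
  shows "((\<lambda>x. disc_of (g x)) \<longlongrightarrow> of_real s) F"
proof -
  have "((\<lambda>x. sin (arctan (fst (g x)))) \<longlongrightarrow> sin (s * (pi/2))) F"
    "((\<lambda>x. cos (arctan (fst (g x)))) \<longlongrightarrow> cos (s * (pi/2))) F"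
    by (rule isCont_tendsto_compose[OF _ lim], simp)+
  then have S: "((\<lambda>x. sin (arctan (fst (g x)))) \<longlongrightarrow> s) F" and C: "((\<lambda>x. cos (arctan (fst (g x)))) \<longlongrightarrow> 0) F"
    using s by auto
  have "((\<lambda>x. (2 * snd (g x) - 1) * cos (arctan (fst (g x)))) \<longlongrightarrow> 0) F"
  proof (rule tendsto_0_le[OF C, where K = 1])
    show "eventually (\<lambda>x. norm ((2 * snd (g x) - 1) * cos (arctan (fst (g x)))) \<le> norm (cos (arctan (fst (g x)))) * 1) F"
      using ev
    proof eventually_elim
      case (elim x)
      then have "\<bar>2 * snd (g x) - 1\<bar> \<le> 1" by (auto simp: open_strip_def mem_Times_iff)
      then have "\<bar>2 * snd (g x) - 1\<bar> * \<bar>cos (arctan (fst (g x)))\<bar> \<le> 1 * \<bar>cos (arctan (fst (g x)))\<bar>"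
        by (intro mult_right_mono) auto
      then show ?case by (simp add: abs_mult)
    qed
  qed
  then have "((\<lambda>x. Complex (sin (arctan (fst (g x)))) ((2 * snd (g x) - 1) * cos (arctan (fst (g x))))) \<longlongrightarrow> Complex s 0) F"
    by (intro tendsto_Complex S)
  moreover have "Complex (sin (arctan (fst (g x)))) ((2 * snd (g x) - 1) * cos (arctan (fst (g x)))) = disc_of (g x)" for x
    by (simp add: complex_eq_iff Re_disc_of Im_disc_of)
  ultimately show ?thesis by (simp add: complex_of_real_def)
qed

text \<open>The disc model makes vertices and limit points ends of the same kind. At a vertex both
  \<open>disc_of\<close> and \<open>strip_of\<close> are continuous; at a limit point, monotonicity
  of the sine of \<open>arctan\<close> recovers the first coordinate.\<close>

lemma filterlim_end_filter_iff:
  assumes ev: "eventually (\<lambda>x. g x \<in> open_strip) F"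
  shows "filterlim g (end_filter e) F \<longleftrightarrow> ((\<lambda>x. disc_of (g x)) \<longlongrightarrow> point_of e) F"
proof (cases e)
  case (Vertex p)
  have 1: "isCont disc_of p"
    using continuous_on_disc_of by (metis UNIV_I continuous_on_eq_continuous_at open_UNIV)
  have "isCont strip_of (disc_of p)"
    using continuous_on_strip_of open_band disc_of_in_band by (simp add: continuous_on_eq_continuous_at)
  then have "((\<lambda>x. strip_of (disc_of (g x))) \<longlongrightarrow> strip_of (disc_of p)) F"
    if "((\<lambda>x. disc_of (g x)) \<longlongrightarrow> disc_of p) F"
    using that isCont_tendsto_compose by blast
  then show ?thesis using Vertex isCont_tendsto_compose[OF 1] by auto
next
  case Plus_Infinity
  have "filterlim (\<lambda>x. fst (g x)) at_top F" if lim: "((\<lambda>x. disc_of (g x)) \<longlongrightarrow> 1) F"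
    unfolding filterlim_at_top
  proof
    fix Z
    have "((\<lambda>x. Re (disc_of (g x))) \<longlongrightarrow> Re 1) F" using lim by (rule tendsto_Re)
    moreover have "sin (arctan Z) < Re 1"
      using disc_of_in_band[of "(Z,0)"] by (simp add: band_def Re_disc_of)
    ultimately have "eventually (\<lambda>x. sin (arctan Z) < Re (disc_of (g x))) F" by (rule order_tendstoD)
    then show "eventually (\<lambda>x. Z \<le> fst (g x)) F"
      by eventually_elim (simp add: Re_disc_of sin_arctan_less_iff)
  qed
  moreover have "((\<lambda>x. disc_of (g x)) \<longlongrightarrow> 1) F" if "filterlim (\<lambda>x. fst (g x)) at_top F"
    using tendsto_disc_of_infinity[OF ev, of 1] filterlim_compose[OF tendsto_arctan_at_top that] by simp
  ultimately show ?thesis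
    using Plus_Infinity by (auto simp: filterlim_filtercomap_iff o_def)
next
  case Minus_Infinity
  have "filterlim (\<lambda>x. fst (g x)) at_bot F" if lim: "((\<lambda>x. disc_of (g x)) \<longlongrightarrow> -1) F"
    unfolding filterlim_at_bot
  proof
    fix Z
    have "((\<lambda>x. Re (disc_of (g x))) \<longlongrightarrow> Re (-1)) F" using lim by (rule tendsto_Re)
    moreover have "Re (-1) < sin (arctan Z)"
      using disc_of_in_band[of "(Z,0)"] by (simp add: band_def Re_disc_of)
    ultimately have "eventually (\<lambda>x. Re (disc_of (g x)) < sin (arctan Z)) F" by (rule order_tendstoD)
    then show "eventually (\<lambda>x. fst (g x) \<le> Z) F"
      by eventually_elim (simp add: Re_disc_of sin_arctan_less_iff)
  qed
  moreover have "((\<lambda>x. disc_of (g x)) \<longlongrightarrow> -1) F" if "filterlim (\<lambda>x. fst (g x)) at_bot F"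
    using tendsto_disc_of_infinity[OF ev, of "-1"] filterlim_compose[OF tendsto_arctan_at_bot that] by simp
  ultimately show ?thesis
    using Minus_Infinity by (auto simp: filterlim_filtercomap_iff o_def)
qed

lemma filterlim_end_filter_strip_of:
  assumes "eventually (\<lambda>x. norm (\<gamma> x) < 1) F" "(\<gamma> \<longlongrightarrow> point_of e) F"
  shows "filterlim (\<lambda>x. strip_of (\<gamma> x)) (end_filter e) F"
proof (subst filterlim_end_filter_iff)
  have *: "disc_of (strip_of z) = z" if "norm z < 1" for z
    using that ball_subset_band by (intro disc_of_strip_of) auto
  show "eventually (\<lambda>x. strip_of (\<gamma> x) \<in> open_strip) F"
    using assms(1) by eventually_elim (metis * norm_disc_of_less_1)
  show "((\<lambda>x. disc_of (strip_of (\<gamma> x))) \<longlongrightarrow> point_of e) F"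
    using assms(2) by (rule Lim_transform_eventually) (use assms(1) in \<open>auto elim!: eventually_mono simp: *\<close>)
qed

text \<open>The values outside the open interval close the curve up, since \<open>g\<close> is
  arbitrary there.\<close>

definition disc_curve :: "endpoint \<Rightarrow> endpoint \<Rightarrow> (real \<Rightarrow> real \<times> real) \<Rightarrow> real \<Rightarrow> complex" where
  "disc_curve e e' g t = (if t \<le> 0 then point_of e else if t \<ge> 1 then point_of e' else disc_of (g t))"

lemma disc_curve:
  assumes g: "simple_curve e e' g" and e: "e \<in> boundary_ends" "e' \<in> boundary_ends" "e \<noteq> e'"
  shows "arc (disc_curve e e' g)" "pathstart (disc_curve e e' g) = point_of e"
    "pathfinish (disc_curve e e' g) = point_of e'" "disc_curve e e' g ` {0<..<1} \<subseteq> ball 0 1"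
    "disc_curve e e' g ` {0<..<1} = disc_of ` g ` {0<..<1}"
proof -
  let ?\<gamma> = "disc_curve e e' g"
  have in01: "?\<gamma> t = disc_of (g t)" if "t \<in> {0<..<1}" for t using that by (simp add: disc_curve_def)
  have strip: "g t \<in> open_strip" if "t \<in> {0<..<1}" for t
    using g that unfolding simple_curve_def by blast
  have ball: "norm (?\<gamma> t) < 1" if "t \<in> {0<..<1}" for t
    using in01[OF that] strip[OF that] norm_disc_of_less_1 by simp
  show "pathstart ?\<gamma> = point_of e" "pathfinish ?\<gamma> = point_of e'"
    by (simp_all add: disc_curve_def pathstart_def pathfinish_def)
  show "?\<gamma> ` {0<..<1} \<subseteq> ball 0 1" using ball by auto
  show "?\<gamma> ` {0<..<1} = disc_of ` g ` {0<..<1}" using in01 by (auto simp: image_image)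
  have ev0: "eventually (\<lambda>t. t \<in> {0<..<1}) (at_right (0::real))"
    by (simp add: eventually_at_right_less eventually_at_right_field) (use zero_less_one in blast)
  have ev1: "eventually (\<lambda>t. t \<in> {0<..<1}) (at_left (1::real))"
    by (simp add: eventually_at_left_field) (use zero_less_one in blast)
  have "continuous_on {0..1} ?\<gamma>"
  proof (rule continuous_on_IccI)
    have "eventually (\<lambda>t. g t \<in> open_strip) (at_right 0)" using ev0 by eventually_elim (rule strip)
    then have "((\<lambda>t. disc_of (g t)) \<longlongrightarrow> point_of e) (at_right 0)"
      using g filterlim_end_filter_iff unfolding simple_curve_def by blast
    then have "(?\<gamma> \<longlongrightarrow> point_of e) (at_right 0)"
      by (rule Lim_transform_eventually) (use ev0 in \<open>auto elim!: eventually_mono simp: in01\<close>)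
    then show "(?\<gamma> \<longlongrightarrow> ?\<gamma> 0) (at_right 0)" by (simp add: disc_curve_def)
    have "eventually (\<lambda>t. g t \<in> open_strip) (at_left 1)" using ev1 by eventually_elim (rule strip)
    then have "((\<lambda>t. disc_of (g t)) \<longlongrightarrow> point_of e') (at_left 1)"
      using g filterlim_end_filter_iff unfolding simple_curve_def by blast
    then have "(?\<gamma> \<longlongrightarrow> point_of e') (at_left 1)"
      by (rule Lim_transform_eventually) (use ev1 in \<open>auto elim!: eventually_mono simp: in01\<close>)
    then show "(?\<gamma> \<longlongrightarrow> ?\<gamma> 1) (at_left 1)" by (simp add: disc_curve_def)
    have "continuous_on {0<..<1} (\<lambda>t. disc_of (g t))"
      using g unfolding simple_curve_def by (intro continuous_on_compose2[OF continuous_on_disc_of]) auto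
    then have "continuous_on {0<..<1} ?\<gamma>" using in01 by (metis (no_types, lifting) continuous_on_cong)
    then show "?\<gamma> \<midarrow>x\<rightarrow> ?\<gamma> x" if "0 < x" "x < 1" for x
      using that by (simp add: continuous_on_eq_continuous_at isCont_def)
  qed simp
  moreover have "inj_on ?\<gamma> {0..1}"
  proof -
    have "inj_on ?\<gamma> {0<..<1}"
      using g inj_disc_of in01 unfolding simple_curve_def inj_on_def by (metis UNIV_I)
    moreover have "?\<gamma> 0 \<noteq> ?\<gamma> 1"
      using e inj_point_of by (auto simp: disc_curve_def dest: injD)
    moreover have "norm (?\<gamma> 0) = 1" "norm (?\<gamma> 1) = 1" using e norm_point_of by (auto simp: disc_curve_def)
    then have "?\<gamma> 0 \<notin> ?\<gamma> ` {0<..<1}" "?\<gamma> 1 \<notin> ?\<gamma> ` {0<..<1}" using ball by force+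
    moreover have "{0..1} = insert 0 (insert 1 {0<..<1::real})" by auto
    ultimately show ?thesis by simp
  qed
  ultimately show "arc ?\<gamma>" by (simp add: arc_def path_def)
qed

lemma simple_curve_strip_of:
  assumes \<gamma>: "arc \<gamma>" "pathstart \<gamma> = point_of e" "pathfinish \<gamma> = point_of e'" "\<gamma> ` {0<..<1} \<subseteq> ball 0 1"
  shows "simple_curve e e' (\<lambda>t. strip_of (\<gamma> t))"
proof -
  have band: "\<gamma> t \<in> band" "norm (\<gamma> t) < 1" if "t \<in> {0<..<1}" for t
    using that \<gamma>(4) ball_subset_band by (auto simp: image_subset_iff)
  have cont: "continuous_on {0..1} \<gamma>" and inj: "inj_on \<gamma> {0..1}" using \<gamma>(1) by (auto simp: arc_def path_def)
  have c: "continuous_on {0<..<1} \<gamma>" by (rule continuous_on_subset[OF cont]) auto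
  have i: "inj_on \<gamma> {0<..<1}" by (rule inj_on_subset[OF inj]) auto
  have lim: "(\<gamma> \<longlongrightarrow> \<gamma> 0) (at_right 0)" "(\<gamma> \<longlongrightarrow> \<gamma> 1) (at_left 1)"
    using cont continuous_on_Icc_at_rightD continuous_on_Icc_at_leftD by (metis zero_less_one)+
  have ev0: "eventually (\<lambda>t. norm (\<gamma> t) < 1) (at_right 0)"
    unfolding eventually_at_right_field by (rule exI[of _ 1]) (use band in auto)
  have ev1: "eventually (\<lambda>t. norm (\<gamma> t) < 1) (at_left 1)"
    unfolding eventually_at_left_field by (rule exI[of _ 0]) (use band in auto)
  show ?thesis
    unfolding simple_curve_def
  proof (intro conjI)
    show "continuous_on {0<..<1} (\<lambda>t. strip_of (\<gamma> t))"
      by (rule continuous_on_compose2[OF continuous_on_strip_of c]) (use band in auto)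
    show "inj_on (\<lambda>t. strip_of (\<gamma> t)) {0<..<1}"
      using i band unfolding inj_on_def by (metis disc_of_strip_of)
    show "(\<lambda>t. strip_of (\<gamma> t)) ` {0<..<1} \<subseteq> open_strip"
      using band norm_disc_of_less_1 disc_of_strip_of by (metis image_subsetI)
    show "filterlim (\<lambda>t. strip_of (\<gamma> t)) (end_filter e) (at_right 0)"
      using filterlim_end_filter_strip_of[OF ev0] lim(1) \<gamma>(2) by (simp add: pathstart_def)
    show "filterlim (\<lambda>t. strip_of (\<gamma> t)) (end_filter e') (at_left 1)"
      using filterlim_end_filter_strip_of[OF ev1] lim(2) \<gamma>(3) by (simp add: pathfinish_def)
  qed
qed

section \<open>Curves with given ends as crosscuts of the disc\<close>

lemma joins_arc:
  assumes "joins C e e'" "e \<in> boundary_ends" "e' \<in> boundary_ends" "e \<noteq> e'"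
  obtains \<gamma> where "arc \<gamma>" "pathstart \<gamma> = point_of e" "pathfinish \<gamma> = point_of e'"
    "\<gamma> ` {0<..<1} \<subseteq> ball 0 1" "disc_of ` C = \<gamma> ` {0<..<1}"
proof -
  obtain g where g: "simple_curve e e' g" "C = g ` {0<..<1}" using assms(1) unfolding joins_def by blast
  show thesis using that[OF disc_curve(1-4)[OF g(1) assms(2-4)]] disc_curve(5)[OF g(1) assms(2-4)] g(2) by simp
qed

lemma arc_joins:
  assumes "arc \<gamma>" "pathstart \<gamma> = point_of e" "pathfinish \<gamma> = point_of e'"
    "\<gamma> ` {0<..<1} \<subseteq> ball 0 1" "disc_of ` C = \<gamma> ` {0<..<1}"
  shows "joins C e e'"
proof -
  have "C = strip_of ` disc_of ` C" by (simp add: image_image)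
  also have "\<dots> = (\<lambda>t. strip_of (\<gamma> t)) ` {0<..<1}" by (simp add: assms(5) image_image)
  finally show ?thesis using simple_curve_strip_of[OF assms(1-4)] unfolding joins_def by blast
qed

lemma joins_sym:
  assumes "joins C e e'" "e \<in> boundary_ends" "e' \<in> boundary_ends" "e \<noteq> e'"
  shows "joins C e' e"
proof -
  obtain \<gamma> where \<gamma>: "arc \<gamma>" "pathstart \<gamma> = point_of e" "pathfinish \<gamma> = point_of e'"
    "\<gamma> ` {0<..<1} \<subseteq> ball 0 1" "disc_of ` C = \<gamma> ` {0<..<1}"
    using joins_arc[OF assms] .
  have "reversepath \<gamma> ` {0<..<1} = \<gamma> ` (\<lambda>t. 1 - t) ` {0<..<1}"
    by (simp add: reversepath_def image_image)
  also have "(\<lambda>t. 1 - t) ` {0<..<1} = {0<..<1::real}"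
  proof -
    have "t \<in> (\<lambda>t. 1 - t) ` {0<..<1}" if "t \<in> {0<..<1}" for t :: real
      using that by (intro image_eqI[of _ _ "1 - t"]) auto
    then show ?thesis by auto
  qed
  finally have "reversepath \<gamma> ` {0<..<1} = \<gamma> ` {0<..<1}" .
  then show ?thesis
    using \<gamma> by (intro arc_joins[of "reversepath \<gamma>"]) (auto simp: arc_reversepath)
qed

text \<open>Alexander's trick deforms the identity, with the circle fixed, into the homeomorphism
  that carries one crosscut to the other. What it does to the first crosscut, read in the strip, is
  the isotopy.\<close>

lemma joins_imp_isotopic:
  assumes C: "joins C e e'" and D: "joins D e e'"
    and e: "e \<in> boundary_ends" "e' \<in> boundary_ends" "e \<noteq> e'"
  shows "isotopic C D"
proof -
  obtain \<gamma> where \<gamma>: "arc \<gamma>" "pathstart \<gamma> = point_of e" "pathfinish \<gamma> = point_of e'"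
    "\<gamma> ` {0<..<1} \<subseteq> ball 0 1" "disc_of ` C = \<gamma> ` {0<..<1}"
    using joins_arc[OF C e] .
  obtain \<delta> where \<delta>: "arc \<delta>" "pathstart \<delta> = point_of e" "pathfinish \<delta> = point_of e'"
    "\<delta> ` {0<..<1} \<subseteq> ball 0 1" "disc_of ` D = \<delta> ` {0<..<1}"
    using joins_arc[OF D e] .
  obtain \<Psi> \<Psi>' where hom: "homeomorphism (cball 0 1) (cball 0 1) \<Psi> \<Psi>'"
    and fix_s: "\<And>z. z \<in> sphere 0 1 \<Longrightarrow> \<Psi> z = z" and \<Psi>: "\<And>t. t \<in> {0..1} \<Longrightarrow> \<Psi> (\<gamma> t) = \<delta> t"
    using crosscut_homeomorphism[OF norm_point_of[OF e(1)] norm_point_of[OF e(2)] \<gamma>(1-4) \<delta>(1-4)] by metis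
  have "\<forall>z\<in>sphere 0 1. \<Psi> z = z" using fix_s by blast
  from Alexander_isotopy[OF hom this] obtain \<Theta> :: "real \<Rightarrow> complex \<Rightarrow> complex" where
    iso: "continuous_on UNIV (\<lambda>x. \<Theta> (fst x) (snd x))" "\<forall>s. inj (\<Theta> s)"
    "\<forall>s\<in>{0..1}. \<forall>z. norm z = 1 \<longrightarrow> \<Theta> s z = z"
    "\<forall>s\<in>{0..1}. \<forall>z. norm z < 1 \<longrightarrow> norm (\<Theta> s z) < 1"
    "\<forall>z. \<Theta> 0 z = z" "\<forall>z. norm z \<le> 1 \<longrightarrow> \<Theta> 1 z = \<Psi> z"
    by (elim exE conjE) (rule that)
  note \<Theta> = iso(1) iso(2-6)[rule_format]
  define G where "G x = \<Theta> (fst x) (\<gamma> (snd x))" for x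
  have cont\<gamma>: "continuous_on {0..1} \<gamma>" and inj\<gamma>: "inj_on \<gamma> {0..1}" using \<gamma>(1) by (auto simp: arc_def path_def)
  have contG: "continuous_on ({0..1} \<times> {0..1}) G"
  proof -
    have "continuous_on ({0..1} \<times> {0..1}) (\<lambda>x. (fst x, \<gamma> (snd x)))"
      by (intro continuous_intros continuous_on_compose2[OF cont\<gamma>]) auto
    then show ?thesis unfolding G_def
      using continuous_on_compose2[OF \<Theta>(1)] by fastforce
  qed
  have G_end: "G (s, 0) = point_of e" "G (s, 1) = point_of e'" if "s \<in> {0..1}" for s
    using \<gamma>(2,3) \<Theta>(3)[OF that] norm_point_of e by (simp_all add: G_def pathstart_def pathfinish_def)
  have G_ball: "norm (G (s, t)) < 1" if "s \<in> {0..1}" "t \<in> {0<..<1}" for s t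
    using \<gamma>(4) that \<Theta>(4) by (auto simp: G_def image_subset_iff)
  have arcG: "arc (\<lambda>t. G (s, t))" if "s \<in> {0..1}" for s
    unfolding arc_def path_def
  proof
    show "continuous_on {0..1} (\<lambda>t. G (s, t))"
      by (rule continuous_on_compose2[OF contG]) (use that in \<open>auto intro!: continuous_intros\<close>)
    show "inj_on (\<lambda>t. G (s, t)) {0..1}"
      using inj\<gamma> \<Theta>(2)[of s] by (auto simp: G_def inj_on_def dest: injD)
  qed
  \<comment> \<open>The limit is uniform in the isotopy parameter because \<open>G\<close> is
    uniformly continuous on the compact square and \<open>G (s, a)\<close> does not depend on
    \<open>s\<close>.\<close>
  have lim: "(G \<longlongrightarrow> G (0, a)) (principal {0..1} \<times>\<^sub>F F)"
    if a: "a \<in> {0,1}" and F: "eventually (\<lambda>t. t \<in> {0<..<1}) F" "((\<lambda>t. t) \<longlongrightarrow> a) F" for a :: real and F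
  proof (rule tendstoI)
    fix \<epsilon> :: real assume "\<epsilon> > 0"
    have "uniformly_continuous_on ({0..1} \<times> {0..1}) G"
      by (rule compact_uniformly_continuous[OF contG]) (intro compact_Times compact_Icc)
    then obtain d where "d > 0" and d: "\<And>x x'. x \<in> {0..1} \<times> {0..1} \<Longrightarrow> x' \<in> {0..1} \<times> {0..1} \<Longrightarrow> dist x' x < d \<Longrightarrow> dist (G x') (G x) < \<epsilon>"
      using \<open>\<epsilon> > 0\<close> unfolding uniformly_continuous_on_def by metis
    have ev: "eventually (\<lambda>t. t \<in> {0<..<1} \<and> dist t a < d) F"
      using F(1) tendstoD[OF F(2) \<open>d > 0\<close>] by eventually_elim simp
    have "dist (G (s, t)) (G (0, a)) < \<epsilon>" if "s \<in> {0..1}" "t \<in> {0<..<1} \<and> dist t a < d" for s t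
    proof -
      have "dist (s, t) (s, a) < d" using that by (simp add: dist_Pair_Pair)
      then have "dist (G (s, t)) (G (s, a)) < \<epsilon>" using that a by (intro d) auto
      moreover have "G (s, a) = G (0, a)" using G_end[OF that(1)] G_end[of 0] a by auto
      ultimately show ?thesis by simp
    qed
    then show "eventually (\<lambda>x. dist (G x) (G (0, a)) < \<epsilon>) (principal {0..1} \<times>\<^sub>F F)"
      unfolding eventually_prod_filter eventually_principal using ev by blast
  qed
  have lim': "filterlim (\<lambda>x. strip_of (G x)) (end_filter f) (principal {0..1} \<times>\<^sub>F F)"
    if a: "a \<in> {0,1}" and F: "eventually (\<lambda>t. t \<in> {0<..<1}) F" "((\<lambda>t. t) \<longlongrightarrow> a) F" and f: "G (0, a) = point_of f" for a F f
  proof (rule filterlim_end_filter_strip_of)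
    show "eventually (\<lambda>x. norm (G x) < 1) (principal {0..1} \<times>\<^sub>F F)"
      unfolding eventually_prod_filter eventually_principal using F(1) G_ball by blast
    show "(G \<longlongrightarrow> point_of f) (principal {0..1} \<times>\<^sub>F F)" using lim[OF a F] f by simp
  qed
  have ev0: "eventually (\<lambda>t. t \<in> {0<..<1}) (at_right (0::real))"
    unfolding eventually_at_right_field by (rule exI[of _ 1]) auto
  have ev1: "eventually (\<lambda>t. t \<in> {0<..<1}) (at_left (1::real))"
    unfolding eventually_at_left_field by (rule exI[of _ 0]) auto
  have "isotopy e e' (\<lambda>x. strip_of (G x))"
    unfolding isotopy_def
  proof (intro conjI ballI)
    show "continuous_on ({0..1} \<times> {0<..<1}) (\<lambda>x. strip_of (G x))"
    proof (rule continuous_on_compose2[OF continuous_on_strip_of])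
      show "continuous_on ({0..1} \<times> {0<..<1}) G"
        by (rule continuous_on_subset[OF contG]) auto
      show "G ` ({0..1} \<times> {0<..<1}) \<subseteq> band" using G_ball ball_subset_band by force
    qed
    show "simple_curve e e' (\<lambda>t. strip_of (G (s, t)))" if "s \<in> {0..1}" for s
      by (rule simple_curve_strip_of[OF arcG[OF that]])
        (use G_end[OF that] G_ball[OF that] in \<open>auto simp: pathstart_def pathfinish_def\<close>)
    show "filterlim (\<lambda>x. strip_of (G x)) (end_filter e) (principal {0..1} \<times>\<^sub>F at_right 0)"
      by (rule lim'[of 0]) (use ev0 G_end in auto)
    show "filterlim (\<lambda>x. strip_of (G x)) (end_filter e') (principal {0..1} \<times>\<^sub>F at_left 1)"
      by (rule lim'[of 1]) (use ev1 G_end in auto)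
  qed
  moreover have "C = (\<lambda>t. strip_of (G (0, t))) ` {0<..<1}"
  proof -
    have "C = strip_of ` disc_of ` C" by (simp add: image_image)
    then show ?thesis unfolding \<gamma>(5) by (simp add: image_image G_def \<Theta>(5))
  qed
  moreover have "D = (\<lambda>t. strip_of (G (1, t))) ` {0<..<1}"
  proof -
    have "D = strip_of ` disc_of ` D" by (simp add: image_image)
    moreover have "G (1, t) = \<delta> t" if "t \<in> {0<..<1}" for t
      using that \<gamma>(4) \<Theta>(6)[of "\<gamma> t"] \<Psi>[of t] by (auto simp: G_def image_subset_iff less_imp_le)
    ultimately show ?thesis unfolding \<delta>(5) by (simp add: image_image)
  qed
  ultimately show ?thesis unfolding isotopic_def by blast
qed

section \<open>Independence of the ends from the parametrization\<close>

lemma continuous_inj_real_monotone: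
  fixes h :: "real \<Rightarrow> real"
  assumes cont: "continuous_on {0<..<1} h" and inj: "inj_on h {0<..<1}"
  shows "strict_mono_on {0<..<1} h \<or> strict_mono_on {0<..<1} (\<lambda>t. - h t)"
proof -
  have sub: "h a < h x \<and> h x < h b \<or> h b < h x \<and> h x < h a" if "0 < a" "a < x" "x < b" "b < 1" for a x b
    using that by (intro continuous_inj_imp_mono continuous_on_subset[OF cont] inj_on_subset[OF inj]) auto
  \<comment> \<open>Both pairs are compared with one pair \<open>a < b\<close> that encloses them;
    by \<open>sub\<close>, values at intermediate points are strictly between \<open>h a\<close> and
    \<open>h b\<close>.\<close>
  have key: "h x < h y \<longleftrightarrow> h u < h v" if xy: "0 < x" "x < y" "y < 1" and uv: "0 < u" "u < v" "v < 1" for x y u v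
  proof -
    define a b where "a = min x u / 2" and "b = (1 + max y v) / 2"
    have ab: "0 < a" "a < x" "a < u" "y < b" "v < b" "b < 1" using xy uv by (auto simp: a_def b_def)
    have "h p < h q \<longleftrightarrow> h a < h b" if "a < p" "p < q" "q < b" for p q
      using sub[of a p b] sub[of a p q] sub[of a q b] that ab by linarith
    then show ?thesis using ab xy uv by simp
  qed
  show ?thesis
  proof (cases "h (1/3) < h (2/3)")
    case True
    then have "strict_mono_on {0<..<1} h" using key[of "1/3" "2/3"] by (auto simp: strict_mono_on_def)
    then show ?thesis ..
  next
    case False
    then have "\<not> h x < h y" if "0 < x" "x < y" "y < 1" for x y using key[of "1/3" "2/3" x y] that by auto
    moreover have "h x \<noteq> h y" if "0 < x" "x < y" "y < 1" for x y
      using inj_onD[OF inj, of x y] that by auto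
    ultimately have "strict_mono_on {0<..<1} (\<lambda>t. - h t)"
      by (auto simp: strict_mono_on_def) (metis linorder_neqE_linordered_idom)
    then show ?thesis ..
  qed
qed

lemma strict_mono_onto_limits:
  fixes h :: "real \<Rightarrow> real"
  assumes mono: "strict_mono_on {0<..<1} h" and onto: "h ` {0<..<1} = {0<..<1}"
  shows "(h \<longlongrightarrow> 0) (at_right 0)" "(h \<longlongrightarrow> 1) (at_left 1)"
proof -
  have h01: "0 < h t \<and> h t < 1" if "0 < t" "t < 1" for t using onto that by (auto dest: equalityD1)
  have pre: "\<exists>t. 0 < t \<and> t < 1 \<and> h t = y" if "0 < y" "y < 1" for y
    using onto that by (metis greaterThanLessThan_iff imageE)
  show "(h \<longlongrightarrow> 0) (at_right 0)"
  proof (rule tendstoI)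
    fix \<epsilon> :: real assume "\<epsilon> > 0"
    then obtain t0 where t0: "0 < t0" "t0 < 1" "h t0 = min \<epsilon> (1/2)" using pre[of "min \<epsilon> (1/2)"] by (auto simp: min_less_iff_disj)
    have "dist (h t) 0 < \<epsilon>" if "0 < t" "t < t0" for t
      using strict_mono_onD[OF mono, of t t0] h01[of t] that t0 by (auto simp: dist_real_def)
    then show "eventually (\<lambda>t. dist (h t) 0 < \<epsilon>) (at_right 0)"
      unfolding eventually_at_right_field using t0 by blast
  qed
  show "(h \<longlongrightarrow> 1) (at_left 1)"
  proof (rule tendstoI)
    fix \<epsilon> :: real assume "\<epsilon> > 0"
    then obtain t0 where t0: "0 < t0" "t0 < 1" "h t0 = 1 - min \<epsilon> (1/2)" using pre[of "1 - min \<epsilon> (1/2)"] by (auto simp: min_less_iff_disj)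
    have "dist (h t) 1 < \<epsilon>" if "t0 < t" "t < 1" for t
      using strict_mono_onD[OF mono, of t0 t] h01[of t] that t0 by (auto simp: dist_real_def)
    then show "eventually (\<lambda>t. dist (h t) 1 < \<epsilon>) (at_left 1)"
      unfolding eventually_at_left_field using t0 by blast
  qed
qed

text \<open>Two parametrizations of a curve differ by a continuous injective map of the open unit
  interval onto itself. Such a map is monotone, so it takes ends to ends.\<close>

lemma joins_ends_unique:
  assumes C: "joins C e e'" and e: "e \<in> boundary_ends" "e' \<in> boundary_ends" "e \<noteq> e'"
    and f: "joins C f f'"
  shows "{f, f'} = {e, e'}"
proof -
  obtain \<gamma> where \<gamma>: "arc \<gamma>" "pathstart \<gamma> = point_of e" "pathfinish \<gamma> = point_of e'"
    "\<gamma> ` {0<..<1} \<subseteq> ball 0 1" "disc_of ` C = \<gamma> ` {0<..<1}"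
    using joins_arc[OF C e] .
  obtain g where g: "simple_curve f f' g" "C = g ` {0<..<1}" using f unfolding joins_def by blast
  obtain d where d: "homeomorphism {0..1} (path_image \<gamma>) \<gamma> d" using homeomorphism_arc[OF \<gamma>(1)] by blast
  have cont\<gamma>: "continuous_on {0..1} \<gamma>" and inj\<gamma>: "inj_on \<gamma> {0..1}" using \<gamma>(1) by (auto simp: arc_def path_def)
  have contd: "continuous_on (path_image \<gamma>) d" and d\<gamma>: "\<And>t. t \<in> {0..1} \<Longrightarrow> d (\<gamma> t) = t"
    using d by (auto simp: homeomorphism_def)
  define h where "h t = d (disc_of (g t))" for t
  have im: "(\<lambda>t. disc_of (g t)) ` {0<..<1} = \<gamma> ` {0<..<1}" using \<gamma>(5) g(2) by (simp add: image_image)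
  have \<gamma>h: "\<gamma> (h t) = disc_of (g t)" "h t \<in> {0<..<1}" if "t \<in> {0<..<1}" for t
  proof -
    have "disc_of (g t) \<in> \<gamma> ` {0<..<1}" using im that by blast
    then obtain u where u: "u \<in> {0<..<1}" "disc_of (g t) = \<gamma> u" by blast
    then show "\<gamma> (h t) = disc_of (g t)" "h t \<in> {0<..<1}" using d\<gamma>[of u] by (auto simp: h_def)
  qed
  have "continuous_on {0<..<1} h"
    unfolding h_def
  proof (rule continuous_on_compose2[OF contd])
    show "continuous_on {0<..<1} (\<lambda>t. disc_of (g t))"
      using g(1) unfolding simple_curve_def by (intro continuous_on_compose2[OF continuous_on_disc_of]) auto
    show "(\<lambda>t. disc_of (g t)) ` {0<..<1} \<subseteq> path_image \<gamma>" unfolding im path_image_def by auto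
  qed
  moreover have "inj_on h {0<..<1}"
    using g(1) \<gamma>h(1) inj_disc_of unfolding simple_curve_def inj_on_def by (metis UNIV_I)
  ultimately consider "strict_mono_on {0<..<1} h" | "strict_mono_on {0<..<1} (\<lambda>t. - h t)"
    using continuous_inj_real_monotone by blast
  moreover have onto: "h ` {0<..<1} = {0<..<1}"
  proof
    show "{0<..<1} \<subseteq> h ` {0<..<1}"
    proof
      fix u :: real assume u: "u \<in> {0<..<1}"
      then obtain t where "t \<in> {0<..<1}" "\<gamma> u = disc_of (g t)" using im by (metis (no_types, lifting) imageE image_eqI)
      then show "u \<in> h ` {0<..<1}" using d\<gamma>[of u] u by (auto simp: h_def)
    qed
  qed (use \<gamma>h(2) in auto)
  \<comment> \<open>\<open>a\<close> is 0 if the two parametrizations have the same direction and 1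
    otherwise.\<close>
  ultimately obtain a where a: "a = 0 \<or> a = (1::real)" "(h \<longlongrightarrow> a) (at_right 0)" "(h \<longlongrightarrow> 1 - a) (at_left 1)"
  proof cases
    case 1
    then show thesis using that[of 0] strict_mono_onto_limits[OF 1 onto] by simp
  next
    case 2
    have "strict_mono_on {0<..<1} (\<lambda>t. 1 - h t)" using 2 by (auto simp: strict_mono_on_def)
    moreover have "(\<lambda>t. 1 - h t) ` {0<..<1} = {0<..<1}"
    proof -
      have "(\<lambda>t. 1 - h t) ` {0<..<1} = (\<lambda>t. 1 - t) ` h ` {0<..<1}" by (simp add: image_image)
      also have "\<dots> = {0<..<1}"
        unfolding onto by (auto intro!: image_eqI[of _ _ "1 - x" for x])
      finally show ?thesis .
    qed
    ultimately have "((\<lambda>t. 1 - h t) \<longlongrightarrow> 0) (at_right 0)" "((\<lambda>t. 1 - h t) \<longlongrightarrow> 1) (at_left 1)"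
      by (rule strict_mono_onto_limits)+
    from this[THEN tendsto_diff[OF tendsto_const[of 1]]]
    show thesis using that[of 1] by simp
  qed
  have strip: "g t \<in> open_strip" if "t \<in> {0<..<1}" for t
    using g(1) that unfolding simple_curve_def by blast
  have lims: "point_of k = \<gamma> b"
    if F: "eventually (\<lambda>t. t \<in> {0<..<1}) F" "F \<noteq> bot" and gk: "filterlim g (end_filter k) F"
      and hb: "(h \<longlongrightarrow> b) F" and b: "b \<in> {0..1}" for F k b
  proof -
    have "eventually (\<lambda>t. g t \<in> open_strip) F" using F(1) by eventually_elim (rule strip)
    then have 1: "((\<lambda>t. disc_of (g t)) \<longlongrightarrow> point_of k) F"
      using gk filterlim_end_filter_iff by blast
    have "eventually (\<lambda>t. h t \<in> {0..1}) F" using F(1) by eventually_elim (use \<gamma>h(2) in force)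
    then have "((\<lambda>t. \<gamma> (h t)) \<longlongrightarrow> \<gamma> b) F"
      using continuous_on_tendsto_compose[OF cont\<gamma> hb b] by blast
    then have "((\<lambda>t. disc_of (g t)) \<longlongrightarrow> \<gamma> b) F"
      by (rule Lim_transform_eventually) (use F(1) \<gamma>h(1) in \<open>auto elim!: eventually_mono\<close>)
    then show ?thesis using 1 tendsto_unique F(2) by blast
  qed
  have ev0: "eventually (\<lambda>t. t \<in> {0<..<1}) (at_right (0::real))"
    unfolding eventually_at_right_field by (rule exI[of _ 1]) auto
  have ev1: "eventually (\<lambda>t. t \<in> {0<..<1}) (at_left (1::real))"
    unfolding eventually_at_left_field by (rule exI[of _ 0]) auto
  have "point_of f = \<gamma> a"
    using lims[OF ev0 _ _ a(2)] g(1) a(1) unfolding simple_curve_def by auto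
  moreover have "point_of f' = \<gamma> (1 - a)"
    using lims[OF ev1 _ _ a(3)] g(1) a(1) unfolding simple_curve_def by auto
  ultimately show ?thesis
    using a(1) \<gamma>(2,3) by (auto simp: pathstart_def pathfinish_def inj_eq[OF inj_point_of])
qed

definition chord :: "endpoint \<Rightarrow> endpoint \<Rightarrow> (real \<times> real) set" where
  "chord e e' = strip_of ` open_segment (point_of e) (point_of e')"

lemma disc_of_chord:
  assumes "e \<in> boundary_ends" "e' \<in> boundary_ends"
  shows "disc_of ` chord e e' = open_segment (point_of e) (point_of e')"
proof -
  have "open_segment (point_of e) (point_of e') \<subseteq> band"
    using open_segment_sphere_subset_ball[OF norm_point_of norm_point_of, OF assms] ball_subset_band by blast
  then show ?thesis unfolding chord_def image_image using disc_of_strip_of by (force simp: image_iff)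
qed

lemma joins_chord:
  assumes "e \<in> boundary_ends" "e' \<in> boundary_ends" "e \<noteq> e'"
  shows "joins (chord e e') e e'"
proof -
  have ne: "point_of e \<noteq> point_of e'" using assms inj_point_of by (auto dest: injD)
  have "linepath (point_of e) (point_of e') ` {0<..<1} = open_segment (point_of e) (point_of e')"
    using ne by (simp add: linepath_def open_segment_image_interval)
  then show ?thesis
    using ne disc_of_chord[OF assms(1,2)] open_segment_sphere_subset_ball[OF norm_point_of norm_point_of, OF assms(1,2)]
    by (intro arc_joins[of "linepath (point_of e) (point_of e')"]) (auto simp: arc_linepath)
qed

text \<open>An isotopy keeps its ends, which each of its curves determines, and conversely common
  ends give an isotopy. So an arc carries no more information than an unordered pair of
  ends.\<close>

lemma isotopy_class_eq:
  assumes "joins C e e'" "e \<in> boundary_ends" "e' \<in> boundary_ends" "e \<noteq> e'"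
  shows "{D. isotopic C D} = {D. joins D e e'}"
proof (intro Collect_eqI iffI)
  fix D assume "isotopic C D"
  then obtain f f' H where H: "isotopy f f' H" "C = (\<lambda>t. H (0, t)) ` {0<..<1}" "D = (\<lambda>t. H (1, t)) ` {0<..<1}"
    unfolding isotopic_def by blast
  have "joins C f f'" "joins D f f'"
    using H unfolding isotopy_def joins_def by (metis atLeastAtMost_iff order_refl zero_le_one)+
  moreover have "{f, f'} = {e, e'}" using joins_ends_unique[OF assms] \<open>joins C f f'\<close> .
  ultimately show "joins D e e'"
    using joins_sym[of D f f'] assms by (metis doubleton_eq_iff)
qed (use joins_imp_isotopic assms in blast)

lemma joins_crossing:
  assumes C: "joins C e e'" and e: "e \<in> boundary_ends" "e' \<in> boundary_ends" "e \<noteq> e'"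
    and D: "joins D f f'" and f: "f \<in> boundary_ends" "f' \<in> boundary_ends" "f \<noteq> f'"
    and sep: "orient (point_of e) (point_of e') (point_of f) > 0" "orient (point_of e) (point_of e') (point_of f') < 0"
  shows "C \<inter> D \<noteq> {}"
proof -
  obtain \<gamma> where \<gamma>: "arc \<gamma>" "pathstart \<gamma> = point_of e" "pathfinish \<gamma> = point_of e'"
    "\<gamma> ` {0<..<1} \<subseteq> ball 0 1" "disc_of ` C = \<gamma> ` {0<..<1}"
    using joins_arc[OF C e] .
  obtain \<delta> where \<delta>: "arc \<delta>" "pathstart \<delta> = point_of f" "pathfinish \<delta> = point_of f'"
    "\<delta> ` {0<..<1} \<subseteq> ball 0 1" "disc_of ` D = \<delta> ` {0<..<1}"
    using joins_arc[OF D f] .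
  have "disc_of ` C \<inter> disc_of ` D \<noteq> {}"
    unfolding \<gamma>(5) \<delta>(5)
    using crosscuts_intersect[OF norm_point_of norm_point_of \<gamma>(1-4) norm_point_of norm_point_of arc_imp_path \<delta>(2-4) sep]
      e f \<delta>(1) by blast
  then show ?thesis using inj_disc_of by (metis image_Int image_empty)
qed

section \<open>Regions of a system of chords\<close>

text \<open>Points of the circle are extreme in the disc: \<open>inner z x < 1\<close> for every
  other point \<open>x\<close> of the circle, so a convex combination with value \<open>z\<close>
  gives such points no weight.\<close>

lemma norm_one_convex_combination:
  fixes z :: complex
  assumes "norm z = 1" "norm p = 1" "norm q = 1" "norm r = 1"
    and "0 \<le> a" "0 \<le> b" "0 \<le> c" "a + b + c = 1" "z = a *\<^sub>R p + b *\<^sub>R q + c *\<^sub>R r"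
  shows "z = p \<or> z = q \<or> z = r"
proof (rule ccontr)
  assume ne: "\<not> ?thesis"
  have lt: "inner z x < 1" if "norm x = 1" "z \<noteq> x" for x
  proof -
    have "(norm (z - x))\<^sup>2 = (norm z)\<^sup>2 + (norm x)\<^sup>2 - 2 * inner z x"
      by (simp add: power2_norm_eq_inner algebra_simps inner_commute)
    moreover have "(norm (z - x))\<^sup>2 > 0" using that by simp
    ultimately show ?thesis using assms(1) that by simp
  qed
  have "1 = inner z z" using assms(1) by (simp add: power2_norm_eq_inner[symmetric])
  also have "\<dots> = inner z (a *\<^sub>R p + b *\<^sub>R q + c *\<^sub>R r)" using assms(9) by simp
  also have "\<dots> = a * inner z p + b * inner z q + c * inner z r" by (simp add: inner_add_right)
  finally have *: "1 = a * inner z p + b * inner z q + c * inner z r" .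
  have "a * (1 - inner z p) \<ge> 0" "b * (1 - inner z q) \<ge> 0" "c * (1 - inner z r) \<ge> 0"
    using assms lt[of p] lt[of q] lt[of r] ne by (auto intro!: mult_nonneg_nonneg)
  moreover have "a * (1 - inner z p) + b * (1 - inner z q) + c * (1 - inner z r) = 0"
    using * assms(8) by (simp add: algebra_simps)
  ultimately have "a * (1 - inner z p) = 0" "b * (1 - inner z q) = 0" "c * (1 - inner z r) = 0" by linarith+
  then have "a = 0" "b = 0" "c = 0" using lt[of p] lt[of q] lt[of r] ne assms by auto
  then show False using assms(8) by simp
qed

text \<open>Cramer's rule: barycentric coordinates are quotients of signed areas.\<close>

lemma orient_barycentric:
  assumes "orient p q r \<noteq> 0"
  shows "z = (orient q r z / orient p q r) *\<^sub>R p + (orient r p z / orient p q r) *\<^sub>R q + (orient p q z / orient p q r) *\<^sub>R r"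
    "orient q r z / orient p q r + orient r p z / orient p q r + orient p q z / orient p q r = 1"
proof -
  have 1: "orient q r z + orient r p z + orient p q z = orient p q r"
    by (simp add: orient_def algebra_simps)
  then show "orient q r z / orient p q r + orient r p z / orient p q r + orient p q z / orient p q r = 1"
    using assms by (simp add: add_divide_distrib[symmetric])
  have "orient p q r *\<^sub>R z = orient q r z *\<^sub>R p + orient r p z *\<^sub>R q + orient p q z *\<^sub>R r"
    by (simp add: orient_def complex_eq_iff algebra_simps)
  then have "(1 / orient p q r) *\<^sub>R (orient p q r *\<^sub>R z) = (1 / orient p q r) *\<^sub>R (orient q r z *\<^sub>R p + orient r p z *\<^sub>R q + orient p q z *\<^sub>R r)"
    by simp
  then show "z = (orient q r z / orient p q r) *\<^sub>R p + (orient r p z / orient p q r) *\<^sub>R q + (orient p q z / orient p q r) *\<^sub>R r"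
    using assms by (simp add: scaleR_add_right)
qed

text \<open>For \<open>a \<le> 0\<close>, solving for \<open>q\<close> would make it a convex
  combination of the circle points \<open>z\<close>, \<open>p\<close> and \<open>r\<close>, all
  different from \<open>q\<close>.\<close>

lemma orient_neg_imp_pos_aux:
  fixes p q r z :: complex
  assumes n: "norm p = 1" "norm q = 1" "norm r = 1" "norm z = 1"
    and sum: "a + b + c = 1" and z: "z = a *\<^sub>R p + b *\<^sub>R q + c *\<^sub>R r"
    and neg: "c < 0" and ne: "q \<noteq> z" "q \<noteq> p" "q \<noteq> r"
  shows "0 < a"
proof (rule ccontr)
  assume "\<not> 0 < a"
  then have a: "a \<le> 0" by simp
  then have b: "b > 0" using sum neg by linarith
  have "b *\<^sub>R q = z + (- a) *\<^sub>R p + (- c) *\<^sub>R r" unfolding z by (simp add: algebra_simps)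
  then have "(1/b) *\<^sub>R (b *\<^sub>R q) = (1/b) *\<^sub>R (z + (- a) *\<^sub>R p + (- c) *\<^sub>R r)" by simp
  then have "q = (1/b) *\<^sub>R z + (- a / b) *\<^sub>R p + (- c / b) *\<^sub>R r"
    using b by (simp add: scaleR_add_right scaleR_diff_right)
  moreover have "1/b + (-a/b) + (-c/b) = 1"
  proof -
    have "1/b + (-a/b) + (-c/b) = (1 - a - c) / b" by (simp add: diff_divide_distrib)
    also have "1 - a - c = b" using sum by simp
    finally show ?thesis using b by simp
  qed
  ultimately have "q = z \<or> q = p \<or> q = r"
    using n a b neg by (intro norm_one_convex_combination[of q z p r "1/b" "-a/b" "-c/b"]) (auto intro: divide_nonneg_pos simp: divide_nonpos_pos)
  then show False using ne by blast
qed

lemma orient_neg_imp_pos: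
  assumes n: "norm p = 1" "norm q = 1" "norm r = 1" "norm z = 1"
    and D: "0 < orient p q r" and neg: "orient p q z < 0"
  shows "0 < orient q r z" "0 < orient r p z"
proof -
  let ?a = "orient q r z / orient p q r" and ?b = "orient r p z / orient p q r" and ?c = "orient p q z / orient p q r"
  have bar: "z = ?a *\<^sub>R p + ?b *\<^sub>R q + ?c *\<^sub>R r" "?a + ?b + ?c = 1"
    using orient_barycentric[of p q r z] D by auto
  have c: "?c < 0" using D neg by (simp add: divide_neg_pos)
  have ne: "q \<noteq> z" "p \<noteq> z" "q \<noteq> p" "q \<noteq> r" "p \<noteq> r"
    using D neg by auto
  have "0 < ?a" by (rule orient_neg_imp_pos_aux[OF n bar(2,1) c ne(1,3,4)])
  then show "0 < orient q r z" using D by (simp add: zero_less_divide_iff)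
  have "?b + ?a + ?c = 1" "z = ?b *\<^sub>R q + ?a *\<^sub>R p + ?c *\<^sub>R r" using bar by (simp_all add: add_ac)
  then have "0 < ?b" by (rule orient_neg_imp_pos_aux[OF n(2,1,3,4)]) (use c ne in auto)
  then show "0 < orient r p z" using D by (simp add: zero_less_divide_iff)
qed

lemma orient_nonneg_imp_vertex:
  assumes n: "norm p = 1" "norm q = 1" "norm r = 1" "norm z = 1"
    and D: "0 < orient p q r" and "0 \<le> orient p q z" "0 \<le> orient q r z" "0 \<le> orient r p z"
  shows "z = p \<or> z = q \<or> z = r"
  using norm_one_convex_combination[OF n(4,1-3) _ _ _ orient_barycentric(2,1)[of p q r z]] assms by simp

lemma chords_cross:
  assumes n: "norm p = 1" "norm q = 1" "norm f = 1" "norm g = 1"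
    and s: "0 < orient p q f" "orient p q g < 0"
  shows "open_segment f g \<inter> open_segment p q \<noteq> {}"
proof -
  have ne: "p \<noteq> q" "f \<noteq> g" using s by auto
  \<comment> \<open>The zero of the affine function \<open>orient p q\<close> on the segment from
    \<open>f\<close> to \<open>g\<close>.\<close>
  define u where "u = orient p q f / (orient p q f - orient p q g)"
  have u: "0 < u" "u < 1" using s by (auto simp: u_def)
  define z where "z = (1 - u) *\<^sub>R f + u *\<^sub>R g"
  have zf: "z \<in> open_segment f g" using u ne unfolding in_segment z_def by blast
  have "orient p q z = orient p q f - u * (orient p q f - orient p q g)"
    unfolding z_def orient_affine by (simp add: algebra_simps)
  also have "\<dots> = 0" using s by (simp add: u_def)
  finally have "orient p q z = 0" .
  moreover have "norm z < 1" using zf open_segment_sphere_subset_ball[OF n(3,4)] by auto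
  ultimately have "z \<in> open_segment p q"
    using orient_eq_0_ball_imp_open_segment n ne by blast
  then show ?thesis using zf by blast
qed

text \<open>Straight chords are drawn in the disc between the points of the circle that correspond
  to the ends in \<open>V\<close>.\<close>

locale chord_system =
  fixes V :: "endpoint set" and E :: "endpoint set set"
  assumes V: "V \<subseteq> boundary_ends"
    and E: "\<And>c. c \<in> E \<Longrightarrow> \<exists>e f. c = {e, f} \<and> e \<in> V \<and> f \<in> V \<and> e \<noteq> f"
    and noncrossing: "\<And>e f g h. \<lbrakk>{e, f} \<in> E; {g, h} \<in> E; {e, f} \<noteq> {g, h}\<rbrakk> \<Longrightarrow>
      open_segment (point_of e) (point_of f) \<inter> open_segment (point_of g) (point_of h) = {}"
begin

abbreviation orient_at :: "endpoint \<Rightarrow> endpoint \<Rightarrow> complex \<Rightarrow> real" where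
  "orient_at e f \<equiv> orient (point_of e) (point_of f)"

definition cut_disc :: "complex set" where
  "cut_disc = ball 0 1 - \<Union>{open_segment (point_of e) (point_of f) | e f. {e, f} \<in> E}"

text \<open>A pair outside \<open>E\<close> stands for a boundary segment, drawn as the circle arc
  to the right of the directed chord. Corners are taken counterclockwise, so this arc lies beyond
  the side.\<close>

definition disc_side :: "endpoint \<Rightarrow> endpoint \<Rightarrow> complex set" where
  "disc_side e f = (if {e, f} \<in> E then open_segment (point_of e) (point_of f)
     else {z \<in> sphere 0 1. orient_at e f z < 0})"

text \<open>The second alternative is what the argument uses of a boundary segment: no end in
  \<open>V\<close> lies strictly beyond it, and the circle arc beyond it reaches up to both
  ends.\<close>

definition good_side :: "endpoint \<Rightarrow> endpoint \<Rightarrow> bool" where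
  "good_side e f \<longleftrightarrow> {e, f} \<in> E \<or>
     (\<forall>v\<in>V. 0 \<le> orient_at e f (point_of v)) \<and>
     {point_of e, point_of f} \<subseteq> closure {z \<in> sphere 0 1. orient_at e f z < 0}"

definition good_triangle :: "endpoint \<Rightarrow> endpoint \<Rightarrow> endpoint \<Rightarrow> bool" where
  "good_triangle p q r \<longleftrightarrow> p \<in> V \<and> q \<in> V \<and> r \<in> V \<and> 0 < orient_at p q (point_of r) \<and>
     good_side p q \<and> good_side q r \<and> good_side r p"

text \<open>Only a side in \<open>E\<close> cuts off a half plane. Toward a boundary segment the
  region reaches up to the circle, so it is in general larger than the straight triangle.\<close>

definition disc_region :: "endpoint \<Rightarrow> endpoint \<Rightarrow> endpoint \<Rightarrow> complex set" where
  "disc_region p q r = {z \<in> ball 0 1. ({p,q} \<in> E \<longrightarrow> 0 < orient_at p q z) \<and>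
     ({q,r} \<in> E \<longrightarrow> 0 < orient_at q r z) \<and> ({r,p} \<in> E \<longrightarrow> 0 < orient_at r p z)}"

section \<open>Regions with three sides\<close>

lemma norm_V: "v \<in> V \<Longrightarrow> norm (point_of v) = 1"
  using V norm_point_of by blast

lemma E_in_V: "{e, f} \<in> E \<Longrightarrow> e \<in> V \<and> f \<in> V \<and> e \<noteq> f"
  using E[of "{e, f}"] by (auto simp: doubleton_eq_iff)

lemma good_triangle_cycle: "good_triangle p q r \<Longrightarrow> good_triangle q r p"
  unfolding good_triangle_def by (auto simp: orient_cycle[of "point_of q"])

lemma disc_region_cycle: "disc_region q r p = disc_region p q r"
  unfolding disc_region_def by blast

lemma disc_region_alt: "disc_region p q r = ball 0 1 \<inter> {z. {p,q} \<in> E \<longrightarrow> 0 < orient_at p q z} \<inter>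
   {z. {q,r} \<in> E \<longrightarrow> 0 < orient_at q r z} \<inter> {z. {r,p} \<in> E \<longrightarrow> 0 < orient_at r p z}"
  unfolding disc_region_def by blast

lemma halfplane_cond: "open {z. P \<longrightarrow> 0 < orient a b z}" "convex {z. P \<longrightarrow> 0 < orient a b z}"
  by (cases P; simp add: open_orient_pos convex_orient_pos)+

lemma open_disc_region: "open (disc_region p q r)"
  unfolding disc_region_alt by (intro open_Int halfplane_cond open_ball)

lemma convex_disc_region: "convex (disc_region p q r)"
  unfolding disc_region_alt by (intro convex_Int halfplane_cond convex_ball)

lemma disc_region_subset_ball: "disc_region p q r \<subseteq> ball 0 1"
  unfolding disc_region_def by blast

definition centroid :: "endpoint \<Rightarrow> endpoint \<Rightarrow> endpoint \<Rightarrow> complex" where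
  "centroid p q r = (point_of p + point_of q + point_of r) /\<^sub>R 3"

lemma orient_centroid:
  "orient_at e f (centroid p q r) = (orient_at e f (point_of p) + orient_at e f (point_of q) + orient_at e f (point_of r)) / 3"
  by (simp add: orient_def centroid_def algebra_simps field_simps)

lemma centroid_ball:
  assumes "good_triangle p q r" shows "norm (centroid p q r) < 1"
proof -
  have n: "norm (point_of p) = 1" "norm (point_of q) = 1" "norm (point_of r) = 1"
    and D: "0 < orient_at p q (point_of r)" using assms norm_V by (auto simp: good_triangle_def)
  have pq: "point_of p \<noteq> point_of q" using D by auto
  have "(point_of p + point_of q) /\<^sub>R 2 \<in> open_segment (point_of p) (point_of q)"
    using pq midpoint_in_open_segment[of "point_of p" "point_of q"] by (simp add: midpoint_def)
  then have "norm ((point_of p + point_of q) /\<^sub>R 2) < 1"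
    using open_segment_sphere_subset_ball[OF n(1,2)] by auto
  then have "norm (point_of p + point_of q) < 2" by simp
  then have "norm (point_of p + point_of q + point_of r) < 3"
    using norm_triangle_ineq[of "point_of p + point_of q" "point_of r"] n by linarith
  then show ?thesis by (simp add: centroid_def)
qed

lemma centroid_pos:
  assumes "good_triangle p q r"
  shows "0 < orient_at p q (centroid p q r)" "0 < orient_at q r (centroid p q r)" "0 < orient_at r p (centroid p q r)"
  using assms orient_cycle[of "point_of q" "point_of r" "point_of p"] orient_cycle[of "point_of r" "point_of p" "point_of q"]
  unfolding orient_centroid good_triangle_def by (auto simp: orient_cycle)

lemma centroid_in_region: "good_triangle p q r \<Longrightarrow> centroid p q r \<in> disc_region p q r"
  using centroid_ball centroid_pos unfolding disc_region_def by auto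

text \<open>Nothing in \<open>V\<close> lies beyond a good side outside \<open>E\<close>. So a
  vertex beyond none of the sides in \<open>E\<close> is on the inner side of all three, and on the
  circle this leaves only the corners.\<close>

lemma beyond_side:
  assumes t: "good_triangle p q r" and v: "v \<in> V"
  shows "v \<in> {p,q,r} \<or> {p,q} \<in> E \<and> orient_at p q (point_of v) < 0 \<or>
    {q,r} \<in> E \<and> orient_at q r (point_of v) < 0 \<or> {r,p} \<in> E \<and> orient_at r p (point_of v) < 0"
proof (rule ccontr)
  assume *: "\<not> ?thesis"
  have "0 \<le> orient_at p q (point_of v)" "0 \<le> orient_at q r (point_of v)" "0 \<le> orient_at r p (point_of v)"
    using * t v unfolding good_triangle_def good_side_def by force+
  then have "point_of v = point_of p \<or> point_of v = point_of q \<or> point_of v = point_of r"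
    using t v norm_V unfolding good_triangle_def by (intro orient_nonneg_imp_vertex) auto
  then show False using * by (auto simp: inj_eq[OF inj_point_of])
qed

text \<open>If \<open>f\<close> were on the other side, the chords would meet, so they would be
  equal; but then \<open>e\<close> would lie on the line of \<open>x\<close> and
  \<open>y\<close>.\<close>

lemma edge_beyond:
  assumes xy: "{x, y} \<in> E" and ef: "{e, f} \<in> E" and e: "orient_at x y (point_of e) < 0"
    and z: "z \<in> open_segment (point_of e) (point_of f)"
  shows "orient_at x y z \<le> 0"
proof -
  have "orient_at x y (point_of f) \<le> 0"
  proof (rule ccontr)
    assume "\<not> ?thesis"
    then have "open_segment (point_of f) (point_of e) \<inter> open_segment (point_of x) (point_of y) \<noteq> {}"
      using e E_in_V[OF xy] E_in_V[OF ef] norm_V by (intro chords_cross) auto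
    moreover have "{f, e} = {e, f}" by auto
    ultimately have "{f, e} = {x, y}" using noncrossing[of f e x y] xy ef by metis
    then have "e = x \<or> e = y" by (auto simp: doubleton_eq_iff)
    then show False using e by auto
  qed
  moreover obtain u where "0 < u" "u < 1" "z = (1 - u) *\<^sub>R point_of e + u *\<^sub>R point_of f"
    using z by (auto simp: in_segment)
  ultimately show ?thesis using e
    by (simp add: orient_affine) (smt (verit) mult_nonneg_nonneg mult_nonneg_nonpos)
qed

text \<open>A chord through the region has no end strictly beyond a side in \<open>E\<close>, so
  both of its ends are corners. Then it is one of the sides, where \<open>orient\<close>
  vanishes.\<close>

lemma disc_region_disjoint_chord:
  assumes t: "good_triangle p q r" and ef: "{e, f} \<in> E"
  shows "disc_region p q r \<inter> open_segment (point_of e) (point_of f) = {}"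
proof -
  have False if z: "z \<in> disc_region p q r" "z \<in> open_segment (point_of e) (point_of f)" for z
  proof -
    have fe: "{f, e} \<in> E" "z \<in> open_segment (point_of f) (point_of e)"
      using ef z by (simp_all add: insert_commute open_segment_commute)
    have zpos: "{p,q} \<in> E \<longrightarrow> 0 < orient_at p q z" "{q,r} \<in> E \<longrightarrow> 0 < orient_at q r z"
      "{r,p} \<in> E \<longrightarrow> 0 < orient_at r p z"
      using z(1) unfolding disc_region_def by blast+
    have corner: "g \<in> {p,q,r}" if gh: "{g, h} \<in> E" "z \<in> open_segment (point_of g) (point_of h)" for g h
    proof (rule ccontr)
      assume "g \<notin> {p,q,r}"
      then consider "{p,q} \<in> E" "orient_at p q (point_of g) < 0" | "{q,r} \<in> E" "orient_at q r (point_of g) < 0"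
        | "{r,p} \<in> E" "orient_at r p (point_of g) < 0"
        using beyond_side[OF t, of g] E_in_V[OF gh(1)] by blast
      then show False
        by cases (use zpos edge_beyond[OF _ gh(1) _ gh(2)] in \<open>fastforce dest: leD\<close>)+
    qed
    have "e \<in> {p,q,r}" "f \<in> {p,q,r}" "e \<noteq> f" using corner[OF ef z(2)] corner[OF fe] E_in_V[OF ef] by auto
    then have "{e, f} = {p,q} \<or> {e, f} = {q,r} \<or> {e, f} = {r,p}" by auto
    then have "\<exists>x y. {x,y} = {e,f} \<and> 0 < orient_at x y z"
      using zpos ef by metis
    then obtain x y where xy: "{x,y} = {e,f}" "0 < orient_at x y z" by blast
    then have "z \<in> open_segment (point_of x) (point_of y)"
      using z(2) fe(2) by (auto simp: doubleton_eq_iff)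
    then show False using xy(2) orient_open_segment by fastforce
  qed
  then show ?thesis by blast
qed

lemma disc_region_subset_cut: "good_triangle p q r \<Longrightarrow> disc_region p q r \<subseteq> cut_disc"
  using disc_region_disjoint_chord disc_region_subset_ball unfolding cut_disc_def by fastforce

lemma closure_disc_region_subset:
  "closure (disc_region p q r) \<subseteq> {z \<in> cball 0 1. ({p,q} \<in> E \<longrightarrow> 0 \<le> orient_at p q z) \<and>
     ({q,r} \<in> E \<longrightarrow> 0 \<le> orient_at q r z) \<and> ({r,p} \<in> E \<longrightarrow> 0 \<le> orient_at r p z)}"
proof (rule closure_minimal)
  have cl: "closed {z. P \<longrightarrow> 0 \<le> orient a b z}" for P a b
    by (cases P) (auto intro!: closed_Collect_le continuous_intros)
  have "{z \<in> cball 0 1. ({p,q} \<in> E \<longrightarrow> 0 \<le> orient_at p q z) \<and>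
     ({q,r} \<in> E \<longrightarrow> 0 \<le> orient_at q r z) \<and> ({r,p} \<in> E \<longrightarrow> 0 \<le> orient_at r p z)} =
     cball 0 1 \<inter> {z. {p,q} \<in> E \<longrightarrow> 0 \<le> orient_at p q z} \<inter> {z. {q,r} \<in> E \<longrightarrow> 0 \<le> orient_at q r z} \<inter>
     {z. {r,p} \<in> E \<longrightarrow> 0 \<le> orient_at r p z}" by blast
  then show "closed {z \<in> cball 0 1. ({p,q} \<in> E \<longrightarrow> 0 \<le> orient_at p q z) \<and>
     ({q,r} \<in> E \<longrightarrow> 0 \<le> orient_at q r z) \<and> ({r,p} \<in> E \<longrightarrow> 0 \<le> orient_at r p z)}"
    by (simp only:) (intro closed_Int closed_cball cl)
qed (auto simp: disc_region_def)

text \<open>On the way to the centroid all inequalities become strict at once.\<close>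

lemma in_closure_disc_region:
  assumes t: "good_triangle p q r"
    and z: "z \<in> cball 0 1" "{p,q} \<in> E \<Longrightarrow> 0 \<le> orient_at p q z"
     "{q,r} \<in> E \<Longrightarrow> 0 \<le> orient_at q r z" "{r,p} \<in> E \<Longrightarrow> 0 \<le> orient_at r p z"
  shows "z \<in> closure (disc_region p q r)"
proof -
  define o' where "o' = centroid p q r"
  have o: "norm o' < 1" "0 < orient_at p q o'" "0 < orient_at q r o'" "0 < orient_at r p o'"
    using centroid_ball[OF t] centroid_pos[OF t] by (auto simp: o'_def)
  define w where "w u = (1 - u) *\<^sub>R z + u *\<^sub>R o'" for u
  have w: "w u \<in> disc_region p q r" if "0 < u" "u < 1" for u
  proof -
    have pos: "0 < orient_at a b (w u)" if "0 \<le> orient_at a b z" "0 < orient_at a b o'" for a b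
      unfolding w_def orient_affine using that \<open>0 < u\<close> \<open>u < 1\<close>
      by (intro add_nonneg_pos mult_nonneg_nonneg mult_pos_pos) auto
    have "norm (w u) \<le> (1 - u) * norm z + u * norm o'"
      unfolding w_def using norm_triangle_ineq[of "(1 - u) *\<^sub>R z" "u *\<^sub>R o'"] that by simp
    also have "\<dots> < (1 - u) * 1 + u * 1"
      using z(1) o(1) that by (intro add_le_less_mono mult_left_mono mult_strict_left_mono) auto
    finally have "norm (w u) < 1" by simp
    then show ?thesis using pos z o unfolding disc_region_def by auto
  qed
  have "(w \<longlongrightarrow> (1 - 0) *\<^sub>R z + 0 *\<^sub>R o') (at_right 0)"
    unfolding w_def by (intro tendsto_intros)
  then have lim: "(w \<longlongrightarrow> z) (at_right 0)" by simp
  have "eventually (\<lambda>u. w u \<in> closure (disc_region p q r)) (at_right 0)"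
    unfolding eventually_at_right_field by (rule exI[of _ 1]) (use w closure_subset in force)
  then show ?thesis
    by (rule Lim_in_closed_set[OF closed_closure _ trivial_limit_at_right_real lim])
qed

lemma frontier_disc_region: "frontier (disc_region p q r) = closure (disc_region p q r) - disc_region p q r"
  by (simp add: frontier_def interior_open open_disc_region)

text \<open>A connected set that leaves the region passes through its frontier inside the open disc.
  There \<open>orient\<close> is 0 for some side in \<open>E\<close>, so the point is on a chord
  that has been removed.\<close>

lemma disc_region_component:
  assumes t: "good_triangle p q r"
  shows "disc_region p q r \<in> components cut_disc"
  unfolding in_components_maximal
proof (intro conjI allI impI)
  show "disc_region p q r \<noteq> {}" using centroid_in_region[OF t] by blast
  show "disc_region p q r \<subseteq> cut_disc" using disc_region_subset_cut[OF t] .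
  show "connected (disc_region p q r)" using convex_disc_region convex_connected by blast
  fix K assume K: "K \<noteq> {} \<and> disc_region p q r \<subseteq> K \<and> K \<subseteq> cut_disc \<and> connected K"
  have "K \<subseteq> disc_region p q r"
  proof (rule ccontr)
    assume "\<not> K \<subseteq> disc_region p q r"
    then have "K \<inter> frontier (disc_region p q r) \<noteq> {}"
      using K centroid_in_region[OF t] by (intro connected_Int_frontier) auto
    then obtain z where z: "z \<in> K" "z \<in> closure (disc_region p q r)" "z \<notin> disc_region p q r"
      unfolding frontier_disc_region by blast
    have zb: "norm z < 1" using z(1) K unfolding cut_disc_def by auto
    have "\<exists>x y. {x,y} \<in> E \<and> orient_at x y z = 0"
    proof -
      have ge: "({p,q} \<in> E \<longrightarrow> 0 \<le> orient_at p q z) \<and>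
         ({q,r} \<in> E \<longrightarrow> 0 \<le> orient_at q r z) \<and> ({r,p} \<in> E \<longrightarrow> 0 \<le> orient_at r p z)"
        using z(2) closure_disc_region_subset by blast
      have "\<not> (({p,q} \<in> E \<longrightarrow> 0 < orient_at p q z) \<and>
         ({q,r} \<in> E \<longrightarrow> 0 < orient_at q r z) \<and> ({r,p} \<in> E \<longrightarrow> 0 < orient_at r p z))"
        using z(3) zb unfolding disc_region_def by simp
      then show ?thesis using ge by (metis order_le_less)
    qed
    then obtain x y where xy: "{x,y} \<in> E" "orient_at x y z = 0" by blast
    then have "z \<in> open_segment (point_of x) (point_of y)"
      using E_in_V[OF xy(1)] norm_V zb by (intro orient_eq_0_ball_imp_open_segment) (auto simp: inj_eq[OF inj_point_of])
    then show False using z(1) K xy(1) unfolding cut_disc_def by blast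
  qed
  then show "K = disc_region p q r" using K by blast
qed

lemma disc_side_subset_frontier:
  assumes t: "good_triangle p q r"
  shows "disc_side p q \<subseteq> frontier (disc_region p q r)"
proof
  fix z assume z: "z \<in> disc_side p q"
  have n: "norm (point_of p) = 1" "norm (point_of q) = 1" "norm (point_of r) = 1"
    and D: "0 < orient_at p q (point_of r)" using t norm_V by (auto simp: good_triangle_def)
  show "z \<in> frontier (disc_region p q r)"
  proof (cases "{p,q} \<in> E")
    case True
    then have seg: "z \<in> open_segment (point_of p) (point_of q)" using z by (simp add: disc_side_def)
    then obtain u where u: "0 < u" "u < 1" "z = (1 - u) *\<^sub>R point_of p + u *\<^sub>R point_of q" by (auto simp: in_segment)
    have "norm z < 1" using seg open_segment_sphere_subset_ball[OF n(1,2)] by auto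
    moreover have "orient_at p q z = 0" using seg orient_open_segment by blast
    moreover have "0 \<le> orient_at q r z" "0 \<le> orient_at r p z"
      unfolding u(3) orient_affine using u D orient_cycle[of "point_of q" "point_of r" "point_of p"]
        orient_cycle[of "point_of r" "point_of p" "point_of q"] by auto
    ultimately show ?thesis
      unfolding frontier_disc_region using in_closure_disc_region[OF t, of z] True by (auto simp: disc_region_def)
  next
    case False
    then have z': "norm z = 1" "orient_at p q z < 0" using z by (auto simp: disc_side_def)
    then have "0 < orient_at q r z" "0 < orient_at r p z" using orient_neg_imp_pos[OF n z'(1) D z'(2)] by auto
    then show ?thesis
      unfolding frontier_disc_region using in_closure_disc_region[OF t, of z] False z' by (auto simp: disc_region_def)
  qed
qed

lemma ends_in_closure_disc_side:
  assumes "good_side e f" "e \<in> V" "f \<in> V"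
  shows "point_of e \<in> closure (disc_side e f)" "point_of f \<in> closure (disc_side e f)"
proof -
  have "{point_of e, point_of f} \<subseteq> closure (disc_side e f)"
  proof (cases "{e, f} \<in> E")
    case True
    then have "point_of e \<noteq> point_of f" using E_in_V[OF True] by (auto simp: inj_eq[OF inj_point_of])
    then show ?thesis using True by (simp add: disc_side_def closure_open_segment)
  next
    case False
    then show ?thesis using assms by (auto simp: disc_side_def good_side_def)
  qed
  then show "point_of e \<in> closure (disc_side e f)" "point_of f \<in> closure (disc_side e f)" by auto
qed

text \<open>A frontier point inside the disc is on a chord. A frontier point on the circle is a
  corner or, by \<open>orient_nonneg_imp_vertex\<close>, strictly beyond a side; that side is not in
  \<open>E\<close>, since the closure stays on the inner side of the sides in
  \<open>E\<close>.\<close>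

lemma frontier_disc_region_eq:
  assumes t: "good_triangle p q r"
  shows "frontier (disc_region p q r) = closure (disc_side p q \<union> disc_side q r \<union> disc_side r p)"
proof
  have t2: "good_triangle q r p" and t3: "good_triangle r p q" using t good_triangle_cycle by blast+
  show "closure (disc_side p q \<union> disc_side q r \<union> disc_side r p) \<subseteq> frontier (disc_region p q r)"
    using disc_side_subset_frontier[OF t] disc_side_subset_frontier[OF t2] disc_side_subset_frontier[OF t3]
    by (intro closure_minimal) (auto simp: disc_region_cycle[of p q r] disc_region_cycle[of q r p])
  show "frontier (disc_region p q r) \<subseteq> closure (disc_side p q \<union> disc_side q r \<union> disc_side r p)"
  proof
    fix z assume "z \<in> frontier (disc_region p q r)"
    then have z: "z \<in> closure (disc_region p q r)" "z \<notin> disc_region p q r" by (auto simp: frontier_disc_region)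
    have ge: "norm z \<le> 1" "{p,q} \<in> E \<Longrightarrow> 0 \<le> orient_at p q z" "{q,r} \<in> E \<Longrightarrow> 0 \<le> orient_at q r z"
       "{r,p} \<in> E \<Longrightarrow> 0 \<le> orient_at r p z"
      using z(1) closure_disc_region_subset[of p q r] by auto
    show "z \<in> closure (disc_side p q \<union> disc_side q r \<union> disc_side r p)"
    proof (cases "norm z < 1")
      case True
      have on: "z \<in> disc_side x y" if "{x,y} \<in> E" "orient_at x y z = 0" for x y
        using that True E_in_V[OF that(1)] norm_V orient_eq_0_ball_imp_open_segment
        by (simp add: disc_side_def inj_eq[OF inj_point_of])
      have "{p,q} \<in> E \<and> orient_at p q z = 0 \<or> {q,r} \<in> E \<and> orient_at q r z = 0 \<or> {r,p} \<in> E \<and> orient_at r p z = 0"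
        using z(2) True ge unfolding disc_region_def by (auto simp: order_le_less)
      then have "z \<in> disc_side p q \<union> disc_side q r \<union> disc_side r p" using on by blast
      then show ?thesis by (rule subsetD[OF closure_subset])
    next
      case False
      then have nz: "norm z = 1" using ge(1) by simp
      show ?thesis
      proof (cases "z = point_of p \<or> z = point_of q \<or> z = point_of r")
        case True
        have "point_of p \<in> closure (disc_side p q)" "point_of q \<in> closure (disc_side p q)"
          "point_of r \<in> closure (disc_side q r)"
          using t by (auto simp: good_triangle_def intro: ends_in_closure_disc_side)
        then show ?thesis using True unfolding closure_Un by auto
      next
        case False
        have "orient_at p q z < 0 \<or> orient_at q r z < 0 \<or> orient_at r p z < 0"
        proof (rule ccontr)
          assume "\<not> ?thesis"
          then show False
            using orient_nonneg_imp_vertex[of "point_of p" "point_of q" "point_of r" z] t norm_V nz False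
            unfolding good_triangle_def by auto
        qed
        then have "z \<in> disc_side p q \<union> disc_side q r \<union> disc_side r p"
          using ge nz unfolding disc_side_def by force
        then show ?thesis by (rule subsetD[OF closure_subset])
      qed
    qed
  qed
qed

end

section \<open>Fans of triangles at a vertex\<close>

context chord_system
begin

text \<open>It serves to identify, in \<open>fan_component\<close>, a component that touches a
  chord: such a component has points near the chord, which then belong to the region on one of its
  two sides.\<close>

lemma near_chord:
  assumes t: "good_triangle p q r" and z: "z \<in> open_segment (point_of p) (point_of q)"
  obtains \<epsilon> where "\<epsilon> > 0" "\<And>w. \<lbrakk>w \<in> ball z \<epsilon>; 0 < orient_at p q w\<rbrakk> \<Longrightarrow> w \<in> disc_region p q r"
proof -
  have n: "norm (point_of p) = 1" "norm (point_of q) = 1"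
    and D: "0 < orient_at p q (point_of r)" using t norm_V by (auto simp: good_triangle_def)
  define U where "U = ball 0 1 \<inter> {w. 0 < orient_at q r w} \<inter> {w. 0 < orient_at r p w}"
  have "open U" unfolding U_def by (intro open_Int open_orient_pos open_ball)
  obtain u where u: "0 < u" "u < 1" "z = (1 - u) *\<^sub>R point_of p + u *\<^sub>R point_of q" using z by (auto simp: in_segment)
  have "norm z < 1" using z open_segment_sphere_subset_ball[OF n] by auto
  moreover have "0 < orient_at q r z" "0 < orient_at r p z"
    unfolding u(3) orient_affine using u D orient_cycle[of "point_of q" "point_of r" "point_of p"]
      orient_cycle[of "point_of r" "point_of p" "point_of q"] by auto
  ultimately have "z \<in> U" by (simp add: U_def)
  then obtain \<epsilon> where "\<epsilon> > 0" "ball z \<epsilon> \<subseteq> U" using \<open>open U\<close> openE by blast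
  then show thesis by (intro that[of \<epsilon>]) (auto simp: U_def disc_region_def subset_iff)
qed

lemma near_boundary:
  assumes t: "good_triangle p q r" and "{p,q} \<notin> E" and z: "z \<in> disc_side p q"
  obtains \<epsilon> where "\<epsilon> > 0" "\<And>w. \<lbrakk>w \<in> ball z \<epsilon>; w \<in> ball 0 1\<rbrakk> \<Longrightarrow> w \<in> disc_region p q r"
proof -
  have n: "norm (point_of p) = 1" "norm (point_of q) = 1" "norm (point_of r) = 1"
    and D: "0 < orient_at p q (point_of r)" using t norm_V by (auto simp: good_triangle_def)
  define U where "U = {w. 0 < orient_at q r w} \<inter> {w. 0 < orient_at r p w}"
  have "open U" unfolding U_def by (intro open_Int open_orient_pos)
  have "norm z = 1" "orient_at p q z < 0" using z assms(2) by (auto simp: disc_side_def)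
  then have "z \<in> U" using orient_neg_imp_pos[OF n _ D] by (auto simp: U_def)
  then obtain \<epsilon> where "\<epsilon> > 0" "ball z \<epsilon> \<subseteq> U" using \<open>open U\<close> openE by blast
  then show thesis using assms(2) by (intro that[of \<epsilon>]) (auto simp: U_def disc_region_def subset_iff)
qed

text \<open>The neighbours \<open>x 0, \<dots>, x n\<close> of \<open>p\<close> are listed clockwise.\<close>

definition good_fan :: "endpoint \<Rightarrow> nat \<Rightarrow> (nat \<Rightarrow> endpoint) \<Rightarrow> bool" where
  "good_fan p n x \<longleftrightarrow> 0 < n \<and> p \<in> V \<and> (\<forall>k\<le>n. x k \<in> V) \<and>
     (\<forall>k l. k < l \<longrightarrow> l \<le> n \<longrightarrow> 0 < orient_at p (x l) (point_of (x k))) \<and>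
     (\<forall>k<n. good_side (x (Suc k)) (x k)) \<and>
     (\<forall>k. 0 < k \<longrightarrow> k < n \<longrightarrow> {p, x k} \<in> E) \<and>
     {p, x 0} \<notin> E \<and> {p, x n} \<notin> E \<and> good_side p (x n) \<and> good_side (x 0) p"

lemma good_fan_triangle:
  assumes "good_fan p n x" "k < n"
  shows "good_triangle p (x (Suc k)) (x k)"
proof -
  have "good_side p (x (Suc k))"
    using assms unfolding good_fan_def good_side_def by (cases "Suc k = n") auto
  moreover have "good_side (x k) p"
    using assms unfolding good_fan_def good_side_def by (cases "k = 0") (auto simp: insert_commute)
  ultimately show ?thesis using assms unfolding good_fan_def good_triangle_def by auto
qed

text \<open>If \<open>y\<close> is not listed, its side relative to the line from \<open>p\<close>
  to \<open>x k\<close> changes from negative at \<open>x 0\<close> to positive at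
  \<open>x n\<close>. At the first change \<open>y\<close> is in the angle between two consecutive
  directions, hence beyond the outer side of a triangle of the fan, and the edge from
  \<open>p\<close> to \<open>y\<close> crosses this side.\<close>

lemma good_fan_neighbours:
  assumes f: "good_fan p n x" and y: "{p, y} \<in> E"
  shows "\<exists>k. 0 < k \<and> k < n \<and> y = x k"
proof -
  have "\<exists>k\<le>n. y = x k"
  proof (rule ccontr)
    assume no: "\<not> (\<exists>k\<le>n. y = x k)"
    have pV: "p \<in> V" "y \<in> V" "p \<noteq> y" using E_in_V[OF y] by auto
    have xV: "x k \<in> V" "x k \<noteq> p" if "k \<le> n" for k
    proof -
      show "x k \<in> V" using f that unfolding good_fan_def by blast
      show "x k \<noteq> p"
      proof (cases "k = 0")
        case True
        then show ?thesis using f unfolding good_fan_def by (metis orient_refl(1) order.irrefl order_refl)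
      next
        case False
        then show ?thesis using f that unfolding good_fan_def by (metis gr_zeroI orient_refl(3) order.irrefl)
      qed
    qed
    have nz: "orient_at p (x k) (point_of y) \<noteq> 0" if "k \<le> n" for k
    proof
      assume "orient_at p (x k) (point_of y) = 0"
      then have "point_of y = point_of p \<or> point_of y = point_of (x k)"
        using xV[OF that] pV norm_V by (intro orient_eq_0_sphere) (auto simp: inj_eq[OF inj_point_of])
      then show False using no that pV by (auto simp: inj_eq[OF inj_point_of])
    qed
    have sn: "0 < orient_at p (x n) (point_of y)"
    proof -
      have "0 \<le> orient_at p (x n) (point_of y)"
        using f pV unfolding good_fan_def good_side_def by blast
      then show ?thesis using nz[of n] by simp
    qed
    have s0: "\<not> 0 < orient_at p (x 0) (point_of y)"
    proof -
      have "{x 0, p} = {p, x 0}" by auto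
      then have "0 \<le> orient_at (x 0) p (point_of y)"
        using f pV unfolding good_fan_def good_side_def by metis
      then show ?thesis using orient_swap[of "point_of (x 0)" "point_of p"] by simp
    qed
    define l where "l = (LEAST l. 0 < orient_at p (x l) (point_of y))"
    have l: "0 < orient_at p (x l) (point_of y)" "l \<le> n"
      unfolding l_def using sn by (rule LeastI, rule Least_le)
    then obtain k where k: "l = Suc k" using s0 by (cases l) auto
    then have "\<not> 0 < orient_at p (x k) (point_of y)" using not_less_Least[of k "\<lambda>l. 0 < orient_at p (x l) (point_of y)"] unfolding l_def by simp
    then have neg: "orient_at p (x k) (point_of y) < 0" using nz[of k] k l by force
    have tri: "good_triangle p (x (Suc k)) (x k)" using good_fan_triangle[OF f] k l by simp
    have "\<not> orient_at p (x (Suc k)) (point_of y) < 0" using l k by auto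
    moreover have "\<not> orient_at (x k) p (point_of y) < 0"
      using neg orient_swap[of "point_of (x k)" "point_of p"] by simp
    moreover have "y \<notin> {p, x (Suc k), x k}" using no pV k l by auto
    ultimately have e: "{x (Suc k), x k} \<in> E" "orient_at (x (Suc k)) (x k) (point_of y) < 0"
      using beyond_side[OF tri pV(2)] by blast+
    have "0 < orient_at (x (Suc k)) (x k) (point_of p)"
      using tri orient_cycle[of "point_of (x (Suc k))"] unfolding good_triangle_def by simp
    then have "open_segment (point_of p) (point_of y) \<inter> open_segment (point_of (x (Suc k))) (point_of (x k)) \<noteq> {}"
      using e(2) xV k l pV norm_V by (intro chords_cross) auto
    then have "{p, y} = {x (Suc k), x k}" using noncrossing[OF y e(1)] by blast
    then show False using \<open>y \<notin> {p, x (Suc k), x k}\<close> by auto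
  qed
  then obtain k where k: "k \<le> n" "y = x k" by blast
  have "k \<noteq> 0" by (rule notI) (use f y k in \<open>simp add: good_fan_def\<close>)
  moreover have "k \<noteq> n" by (rule notI) (use f y k in \<open>simp add: good_fan_def\<close>)
  ultimately show ?thesis using k by (intro exI[of _ k]) auto
qed

abbreviation fan_region :: "endpoint \<Rightarrow> (nat \<Rightarrow> endpoint) \<Rightarrow> nat \<Rightarrow> complex set" where
  "fan_region p x k \<equiv> disc_region p (x (Suc k)) (x k)"

text \<open>For \<open>k < l\<close> the edge from \<open>p\<close> to \<open>x (Suc k)\<close>
  separates the two regions: the centroid of the later triangle is not on the inner side for the
  earlier one.\<close>

lemma fan_region_inj:
  assumes f: "good_fan p n x"
  shows "inj_on (fan_region p x) {..<n}"
proof (rule linorder_inj_onI')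
  fix k l assume kl: "k \<in> {..<n}" "l \<in> {..<n}" "k < l"
  define o' where "o' = centroid p (x (Suc l)) (x l)"
  have "o' \<in> fan_region p x l"
    unfolding o'_def using kl by (intro centroid_in_region good_fan_triangle[OF f]) auto
  moreover have "o' \<notin> fan_region p x k"
  proof
    assume "o' \<in> fan_region p x k"
    moreover have "{p, x (Suc k)} \<in> E" using f kl unfolding good_fan_def by auto
    ultimately have "0 < orient_at p (x (Suc k)) o'" unfolding disc_region_def by blast
    moreover have "orient_at p (x (Suc k)) (point_of (x (Suc l))) \<le> 0"
      using f kl orient_cycle[of "point_of p" "point_of (x (Suc l))" "point_of (x (Suc k))"]
        orient_swap[of "point_of p" "point_of (x (Suc k))"]
      unfolding good_fan_def by (smt (verit) Suc_leI Suc_less_eq lessThan_iff orient_cycle orient_swap)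
    moreover have "orient_at p (x (Suc k)) (point_of (x l)) \<le> 0"
    proof (cases "l = Suc k")
      case False
      then have "0 < orient_at p (x l) (point_of (x (Suc k)))" using f kl unfolding good_fan_def by auto
      then show ?thesis by (smt (verit) orient_cycle orient_swap)
    qed simp
    ultimately show False unfolding o'_def orient_centroid by simp
  qed
  ultimately show "fan_region p x k \<noteq> fan_region p x l" by blast
qed

lemma component_eq_region:
  assumes "K \<in> components cut_disc" "good_triangle p q r" "w \<in> K" "w \<in> disc_region p q r"
  shows "K = disc_region p q r"
  using components_eq[OF assms(1) disc_region_component[OF assms(2)]] assms(3,4) by blast

text \<open>Near an inner edge at \<open>p\<close>, a component has points off the chord and so
  meets one of the two fan regions along it; near a boundary side at \<open>p\<close> it meets the
  outermost fan region. Components that meet are equal.\<close>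

lemma fan_component:
  assumes f: "good_fan p n x" and K: "K \<in> components cut_disc" and zK: "z \<in> closure K"
    and z: "(\<exists>k. 0 < k \<and> k < n \<and> z \<in> open_segment (point_of p) (point_of (x k))) \<or>
       z \<in> disc_side p (x n) \<or> z \<in> disc_side (x 0) p"
  shows "K \<in> fan_region p x ` {..<n}"
proof -
  have n: "0 < n" using f unfolding good_fan_def by blast
  have Kcut: "K \<subseteq> cut_disc" using K in_components_subset by blast
  have meet: "\<exists>w\<in>K. w \<in> ball z \<epsilon>" if "\<epsilon> > 0" for \<epsilon>
    using zK that unfolding closure_approachable by (auto simp: dist_commute)
  consider k where "0 < k" "k < n" "z \<in> open_segment (point_of p) (point_of (x k))"
    | "z \<in> disc_side p (x n)" | "z \<in> disc_side (x 0) p" using z by blast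
  then show ?thesis
  proof cases
    case 1
    have e: "{p, x k} \<in> E" using f 1 unfolding good_fan_def by blast
    have t1: "good_triangle p (x k) (x (k - 1))" using good_fan_triangle[OF f, of "k - 1"] 1 by simp
    have t2: "good_triangle (x k) p (x (Suc k))" using good_fan_triangle[OF f 1(2)] good_triangle_cycle by blast
    obtain \<epsilon>1 where \<epsilon>1: "\<epsilon>1 > 0" "\<And>w. \<lbrakk>w \<in> ball z \<epsilon>1; 0 < orient_at p (x k) w\<rbrakk> \<Longrightarrow> w \<in> disc_region p (x k) (x (k - 1))"
      using near_chord[OF t1 1(3)] by metis
    have z': "z \<in> open_segment (point_of (x k)) (point_of p)" using 1(3) by (simp add: open_segment_commute)
    obtain \<epsilon>2 where \<epsilon>2: "\<epsilon>2 > 0" "\<And>w. \<lbrakk>w \<in> ball z \<epsilon>2; 0 < orient_at (x k) p w\<rbrakk> \<Longrightarrow> w \<in> disc_region (x k) p (x (Suc k))"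
      using near_chord[OF t2 z'] by metis
    obtain w where w: "w \<in> K" "w \<in> ball z (min \<epsilon>1 \<epsilon>2)" using meet[of "min \<epsilon>1 \<epsilon>2"] \<epsilon>1(1) \<epsilon>2(1) by auto
    have "orient_at p (x k) w \<noteq> 0"
    proof
      assume "orient_at p (x k) w = 0"
      moreover have "norm w < 1" using w(1) Kcut unfolding cut_disc_def by auto
      ultimately have "w \<in> open_segment (point_of p) (point_of (x k))"
        using E_in_V[OF e] norm_V by (intro orient_eq_0_ball_imp_open_segment) (auto simp: inj_eq[OF inj_point_of])
      then show False using w(1) Kcut e unfolding cut_disc_def by blast
    qed
    then consider "0 < orient_at p (x k) w" | "0 < orient_at (x k) p w"
      using orient_swap[of "point_of (x k)" "point_of p" w] by linarith
    then show ?thesis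
    proof cases
      case a: 1
      then have "K = disc_region p (x k) (x (k - 1))" using \<epsilon>1(2) w component_eq_region[OF K t1] by auto
      then have "K = fan_region p x (k - 1)" using 1 by simp
      then show ?thesis using 1 by (intro image_eqI[of _ _ "k - 1"]) auto
    next
      case a: 2
      then have "K = disc_region (x k) p (x (Suc k))" using \<epsilon>2(2) w component_eq_region[OF K t2] by auto
      then have "K = fan_region p x k" using disc_region_cycle by blast
      then show ?thesis using 1 by blast
    qed
  next
    case 2
    have t: "good_triangle p (x n) (x (n - 1))" using good_fan_triangle[OF f, of "n - 1"] n by simp
    have "{p, x n} \<notin> E" using f unfolding good_fan_def by blast
    then obtain \<epsilon> where \<epsilon>: "\<epsilon> > 0" "\<And>w. \<lbrakk>w \<in> ball z \<epsilon>; w \<in> ball 0 1\<rbrakk> \<Longrightarrow> w \<in> disc_region p (x n) (x (n - 1))"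
      using near_boundary[OF t _ 2] by metis
    obtain w where "w \<in> K" "w \<in> ball z \<epsilon>" using meet \<epsilon>(1) by blast
    then have "K = disc_region p (x n) (x (n - 1))"
      using \<epsilon>(2) Kcut component_eq_region[OF K t] unfolding cut_disc_def by blast
    then have "K = fan_region p x (n - 1)" using n by simp
    then show ?thesis using n by (intro image_eqI[of _ _ "n - 1"]) auto
  next
    case 3
    have t: "good_triangle (x 0) p (x (Suc 0))"
      using good_fan_triangle[OF f n] good_triangle_cycle by blast
    have "{x 0, p} \<notin> E" using f unfolding good_fan_def by (metis insert_commute)
    then obtain \<epsilon> where \<epsilon>: "\<epsilon> > 0" "\<And>w. \<lbrakk>w \<in> ball z \<epsilon>; w \<in> ball 0 1\<rbrakk> \<Longrightarrow> w \<in> disc_region (x 0) p (x (Suc 0))"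
      using near_boundary[OF t _ 3] by metis
    obtain w where "w \<in> K" "w \<in> ball z \<epsilon>" using meet \<epsilon>(1) by blast
    then have "K = disc_region (x 0) p (x (Suc 0))"
      using \<epsilon>(2) Kcut component_eq_region[OF K t] unfolding cut_disc_def by blast
    then have "K = fan_region p x 0" using disc_region_cycle by blast
    then show ?thesis using n by blast
  qed
qed

end

section \<open>Friezes and paths in the Farey graph\<close>

text \<open>Two adjacent unimodular rules show that the quotient of
  \<open>m i k + m i (k - 2)\<close> by \<open>m i (k - 1)\<close> does not depend on
  \<open>i\<close>; at \<open>i = k\<close> it is \<open>m k k\<close>. Positivity allows the
  division.\<close>

lemma frieze_row_recurrence:
  assumes m: "infinite_frieze m" and "i \<le> k"
  shows "m i k + m i (k - 2) = m k k * m i (k - 1)"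
  using \<open>i \<le> k\<close>
proof (induction i rule: int_le_induct)
  case base
  have "m k (k - 2) = 0" "m k (k - 1) = 1" using m unfolding infinite_frieze_def by blast+
  then show ?case by simp
next
  case (step i)
  have r: "m i j * m (i + 1) (j + 1) - m (i + 1) j * m i (j + 1) = 1" if "i - 1 \<le> j" for i j
    using m that unfolding infinite_frieze_def by blast
  have IH: "m i k + m i (k - 2) = m k k * m i (k - 1)" using step by simp
  have 1: "m (i - 1) (k - 2) * m i (k - 1) - m i (k - 2) * m (i - 1) (k - 1) = 1"
    using r[of "i - 1" "k - 2"] step by (simp add: algebra_simps)
  have 2: "m (i - 1) (k - 1) * m i k - m i (k - 1) * m (i - 1) k = 1"
    using r[of "i - 1" "k - 1"] step by (simp add: algebra_simps)
  have pos: "m i (k - 1) > 0"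
  proof (cases "i = k")
    case True
    then have "m i (k - 1) = 1" using m unfolding infinite_frieze_def by blast
    then show ?thesis by simp
  next
    case False
    then show ?thesis using m step unfolding infinite_frieze_def by auto
  qed
  have "m i (k - 1) * (m (i - 1) k + m (i - 1) (k - 2)) = m (i - 1) (k - 1) * (m i k + m i (k - 2))"
    using 1 2 by (simp add: algebra_simps)
  also have "\<dots> = m i (k - 1) * (m k k * m (i - 1) (k - 1))" unfolding IH by simp
  finally show ?case using pos by simp
qed

text \<open>The mirror image of the row recurrence, with rows and columns exchanged.\<close>

lemma frieze_column_recurrence:
  assumes m: "infinite_frieze m" and "i \<le> k"
  shows "m i k + m (i + 2) k = m i i * m (i + 1) k"
  using \<open>i \<le> k\<close>
proof (induction k rule: int_ge_induct)
  case base
  have "m (i + 2) (i + 2 - 2) = 0" "m (i + 1) (i + 1 - 1) = 1" using m unfolding infinite_frieze_def by blast+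
  then show ?case by simp
next
  case (step k)
  have r: "m i j * m (i + 1) (j + 1) - m (i + 1) j * m i (j + 1) = 1" if "i - 1 \<le> j" for i j
    using m that unfolding infinite_frieze_def by blast
  have 1: "m i k * m (i + 1) (k + 1) - m (i + 1) k * m i (k + 1) = 1" using r[of i k] step by simp
  have 2: "m (i + 1) k * m (i + 2) (k + 1) - m (i + 2) k * m (i + 1) (k + 1) = 1"
    using r[of "i + 1" k] step by (simp add: algebra_simps)
  have pos: "m (i + 1) k > 0"
  proof (cases "i = k")
    case True
    have "m (i + 1) (i + 1 - 1) = 1" using m unfolding infinite_frieze_def by blast
    then show ?thesis using True by simp
  next
    case False
    then show ?thesis using m step unfolding infinite_frieze_def by auto
  qed
  have "m (i + 1) k * (m i (k + 1) + m (i + 2) (k + 1)) = m (i + 1) (k + 1) * (m i k + m (i + 2) k)"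
    using 1 2 by (simp add: algebra_simps)
  also have "\<dots> = m (i + 1) k * (m i i * m (i + 1) (k + 1))" unfolding step.IH by simp
  finally show ?case using pos by simp
qed

section \<open>The frieze as an array of determinants\<close>

lemma recurrence_unique:
  fixes f :: "int \<Rightarrow> int"
  assumes rec: "\<And>j. f (j + 1) + f (j - 1) = a j * f j" and "f 0 = 0" "f 1 = 0"
  shows "f j = 0"
proof -
  have "f j = 0 \<and> f (j + 1) = 0"
  proof (induction j rule: int_induct[of _ 0])
    case base
    then show ?case using assms by simp
  next
    case (step1 i)
    then show ?case using rec[of "i + 1"] by simp
  next
    case (step2 i)
    then show ?case using rec[of i] by simp
  qed
  then show ?thesis by simp
qed

definition det2 :: "int \<times> int \<Rightarrow> int \<times> int \<Rightarrow> int" where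
  "det2 u w = fst u * snd w - fst w * snd u"

lemma det2_antisym: "det2 w u = - det2 u w"
  by (simp add: det2_def)

lemma det2_Pluecker: "det2 a c * det2 b d = det2 a b * det2 c d + det2 a d * det2 b c"
  by (simp add: det2_def algebra_simps)

text \<open>By \<open>det1\<close> consecutive vectors are Farey neighbours. The normalization of
  \<open>v 0\<close> and \<open>v 1\<close> uses up the freedom of a unimodular change of basis and
  makes \<open>det2 (v 0) b\<close> the second coordinate of \<open>b\<close>, so that slopes of
  outer vectors are finite.\<close>

locale frieze_path =
  fixes v :: "int \<Rightarrow> int \<times> int" and a :: "int \<Rightarrow> int"
  assumes rec: "v (i + 1) + v (i - 1) = (a i * fst (v i), a i * snd (v i))"
    and det1: "det2 (v i) (v (i + 1)) = 1"
    and pos: "i < j \<Longrightarrow> 0 < det2 (v i) (v j)"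
    and v0: "v 0 = (1, 0)" and v1: "v 1 = (0, 1)"
    and a_pos: "0 < a i"

text \<open>An infinite frieze is the array of the determinants of a sequence of vectors
  that turns by less than a half turn.\<close>

theorem frieze_path_exists:
  assumes m: "infinite_frieze m"
  obtains v where "frieze_path v (\<lambda>i. m i i)"
proof -
  \<comment> \<open>The indices are shifted so that the row of zeros becomes the diagonal, and the
    array is continued antisymmetrically, as determinants demand.\<close>
  define d where "d i j = (if i \<le> j then m (i + 1) (j - 1) else - m (j + 1) (i - 1))" for i j
  have z: "m (i + 1) (i - 1) = 0" and o: "m (i + 1) i = 1" for i
  proof -
    have "m (i + 1) (i + 1 - 2) = 0" "m (i + 1) (i + 1 - 1) = 1" using m unfolding infinite_frieze_def by blast+
    then show "m (i + 1) (i - 1) = 0" "m (i + 1) i = 1" by (simp_all add: algebra_simps)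
  qed
  have d_anti: "d j i = - d i j" for i j using z by (auto simp: d_def)
  have d_rec: "d i (j + 1) + d i (j - 1) = m j j * d i j" for i j
  proof -
    consider "j > i" | "j = i" | "j < i" by linarith
    then show ?thesis
    proof cases
      case 1
      then show ?thesis using frieze_row_recurrence[OF m, of "i + 1" j] by (simp add: d_def algebra_simps)
    next
      case 2
      have "m j (j - 1) = 1" using m unfolding infinite_frieze_def by blast
      then show ?thesis using 2 z o by (simp add: d_def)
    next
      case 3
      then have "d i (j + 1) = - m (j + 2) (i - 1)" 
      proof (cases "i = j + 1")
        case True
        then show ?thesis using z[of "j + 1"] z[of i] by (simp add: d_def add.commute)
      next
        case False
        then show ?thesis using 3 by (simp add: d_def algebra_simps)
      qed
      then show ?thesis using 3 frieze_column_recurrence[OF m, of j "i - 1"] by (simp add: d_def algebra_simps)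
    qed
  qed
  have d01: "d 0 0 = 0" "d 1 1 = 0" "d 0 1 = 1" "d 1 0 = -1"
    using z[of 0] z[of 1] o[of 0] by (simp_all add: d_def)
  \<comment> \<open>These coordinates are forced, since \<open>det2 (1, 0) (x, y) = y\<close> and
    \<open>det2 (0, 1) (x, y) = - x\<close>.\<close>
  define v where "v j = (- d 1 j, d 0 j)" for j
  \<comment> \<open>As functions of \<open>j\<close> both terms satisfy the recurrence with
    coefficients \<open>m j j\<close>, and they agree at 0 and 1.\<close>
  have "det2 (v i) (v j) - d i j = 0" for i j
  proof (rule recurrence_unique[where a = "\<lambda>j. m j j" and f = "\<lambda>j. det2 (v i) (v j) - d i j"])
    fix j
    have "det2 (v i) (v (j + 1)) + det2 (v i) (v (j - 1)) =
      - d 1 i * (d 0 (j + 1) + d 0 (j - 1)) + d 0 i * (d 1 (j + 1) + d 1 (j - 1))"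
      by (simp add: det2_def v_def algebra_simps)
    also have "\<dots> = m j j * det2 (v i) (v j)" unfolding d_rec by (simp add: det2_def v_def algebra_simps)
    finally show "det2 (v i) (v (j + 1)) - d i (j + 1) + (det2 (v i) (v (j - 1)) - d i (j - 1)) =
        m j j * (det2 (v i) (v j) - d i j)"
      using d_rec[of i j] by (simp add: algebra_simps)
  qed (use d01 d_anti[of 0 i] d_anti[of 1 i] in \<open>simp_all add: det2_def v_def\<close>)
  then have det: "det2 (v i) (v j) = d i j" for i j by simp
  show thesis
  proof (rule that[of v], unfold_locales)
    show "v (i + 1) + v (i - 1) = (m i i * fst (v i), m i i * snd (v i))" for i
      using d_rec[of 0 i] d_rec[of 1 i] by (simp add: v_def algebra_simps)
    show "det2 (v i) (v (i + 1)) = 1" for i unfolding det using o[of i] by (simp add: d_def)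
    show "0 < det2 (v i) (v j)" if "i < j" for i j
    proof (cases "j = i + 1")
      case True
      then show ?thesis unfolding det using o[of i] by (simp add: d_def)
    next
      case False
      then show ?thesis unfolding det using m that by (simp add: d_def infinite_frieze_def)
    qed
    show "0 < m i i" for i using m unfolding infinite_frieze_def by blast
  qed (use d01 in \<open>simp_all add: v_def\<close>)
qed

section \<open>The boundary of the strip as the projective line\<close>

text \<open>The first coordinate equals \<open>(1 - t\<^sup>2) / (1 + t\<^sup>2)\<close>: this is
  the rational parametrization of the unit circle, which misses only \<open>-1\<close>.\<close>

definition circle_point :: "real \<Rightarrow> complex" where
  "circle_point t = Complex (2 / (1 + t\<^sup>2) - 1) (2 * t / (1 + t\<^sup>2))"

lemma circle_point_diff:
  "circle_point b - circle_point a =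
    Complex (2 * (a\<^sup>2 - b\<^sup>2) / ((1 + a\<^sup>2) * (1 + b\<^sup>2))) (2 * ((b - a) * (1 - a * b)) / ((1 + a\<^sup>2) * (1 + b\<^sup>2)))"
proof -
  have "1 + a\<^sup>2 \<noteq> 0" "1 + b\<^sup>2 \<noteq> 0" using one_plus_sq_pos[of a] one_plus_sq_pos[of b] by auto
  then show ?thesis
    by (simp add: circle_point_def complex_eq_iff diff_frac_eq) (simp add: algebra_simps power2_eq_square)
qed

lemma Im_cnj_mult_fraction:
  "Im (cnj (Complex (x / m) (y / m)) * Complex (x' / n) (y' / n)) = (x * y' - y * x') / (m * n)"
  by (simp add: diff_divide_distrib)

text \<open>Up to a positive factor the orientation is a Vandermonde product, so the order of the
  three parameters decides it.\<close>

lemma orient_circle_point: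
  "orient (circle_point a) (circle_point b) (circle_point c) =
    4 / ((1 + a\<^sup>2) * (1 + b\<^sup>2) * (1 + c\<^sup>2)) * ((b - a) * (c - b) * (c - a))"
proof -
  define A B C where "A = 1 + a\<^sup>2" and "B = 1 + b\<^sup>2" and "C = 1 + c\<^sup>2"
  have nz: "A \<noteq> 0" "B \<noteq> 0" "C \<noteq> 0" using one_plus_sq_pos by (auto simp: A_def B_def C_def less_le)
  have "orient (circle_point a) (circle_point b) (circle_point c) =
      (2 * (a\<^sup>2 - b\<^sup>2) * (2 * ((c - a) * (1 - a * c))) - 2 * ((b - a) * (1 - a * b)) * (2 * (a\<^sup>2 - c\<^sup>2))) / (A * B * (A * C))"
    unfolding orient_def circle_point_diff A_def[symmetric] B_def[symmetric] C_def[symmetric]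
    by (rule Im_cnj_mult_fraction)
  also have "2 * (a\<^sup>2 - b\<^sup>2) * (2 * ((c - a) * (1 - a * c))) - 2 * ((b - a) * (1 - a * b)) * (2 * (a\<^sup>2 - c\<^sup>2)) =
      4 * ((b - a) * (c - b) * (c - a)) * A"
    by (simp add: A_def algebra_simps power2_eq_square)
  also have "\<dots> / (A * B * (A * C)) = 4 / (A * B * C) * ((b - a) * (c - b) * (c - a))"
    using nz by (simp add: field_simps)
  finally show ?thesis unfolding A_def B_def C_def .
qed

text \<open>The limit of \<open>orient_circle_point\<close> as \<open>c\<close> tends to
  infinity.\<close>

lemma orient_circle_point_minus:
  "orient (circle_point a) (circle_point b) (-1) = 4 / ((1 + a\<^sup>2) * (1 + b\<^sup>2)) * (b - a)"
proof -
  define A B where "A = 1 + a\<^sup>2" and "B = 1 + b\<^sup>2"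
  have nz: "A \<noteq> 0" "B \<noteq> 0" using one_plus_sq_pos by (auto simp: A_def B_def less_le)
  have "- 1 - circle_point a = Complex (- 2 / A) (- (2 * a) / A)"
    by (simp add: circle_point_def complex_eq_iff A_def)
  then have "orient (circle_point a) (circle_point b) (-1) =
      (2 * (a\<^sup>2 - b\<^sup>2) * (- (2 * a)) - 2 * ((b - a) * (1 - a * b)) * (- 2)) / (A * B * A)"
    unfolding orient_def circle_point_diff A_def[symmetric] B_def[symmetric]
    by (simp only: Im_cnj_mult_fraction)
  also have "2 * (a\<^sup>2 - b\<^sup>2) * (- (2 * a)) - 2 * ((b - a) * (1 - a * b)) * (- 2) = 4 * (b - a) * A"
    by (simp add: A_def algebra_simps power2_eq_square)
  also have "\<dots> / (A * B * A) = 4 / (A * B) * (b - a)" using nz by (simp add: field_simps)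
  finally show ?thesis unfolding A_def B_def .
qed

text \<open>The stereographic coordinate from \<open>-1\<close>; it is meaningless at \<open>Minus_Infinity\<close>.\<close>

fun coordinate :: "endpoint \<Rightarrow> real" where
  "coordinate (Vertex p) = (2 * snd p - 1) * (sqrt (1 + (fst p)\<^sup>2) - fst p)"
| "coordinate _ = 0"

lemma sqrt_one_plus_sq_gt: "x < sqrt (1 + x\<^sup>2)"
  by (rule real_less_rsqrt) simp

lemma sqrt_one_plus_sq_diff_less:
  assumes "x < y" shows "sqrt (1 + y\<^sup>2) - y < sqrt (1 + x\<^sup>2) - x"
proof -
  define s t where "s = sqrt (1 + x\<^sup>2)" and "t = sqrt (1 + y\<^sup>2)"
  have sq: "s\<^sup>2 = 1 + x\<^sup>2" "t\<^sup>2 = 1 + y\<^sup>2" by (simp_all add: s_def t_def add_nonneg_nonneg)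
  have st: "x + y < s + t" "0 < s + t"
    using sqrt_one_plus_sq_gt[of x] sqrt_one_plus_sq_gt[of y] one_plus_sq_pos[of x] one_plus_sq_pos[of y]
    by (auto simp: s_def t_def add_pos_pos)
  have "(t - s) * (t + s) = (y - x) * (x + y)" using sq by (simp add: power2_eq_square algebra_simps)
  also have "\<dots> < (y - x) * (t + s)" using st assms by (intro mult_strict_left_mono) auto
  finally have "t - s < y - x" using st by (simp add: mult_less_cancel_right)
  then show ?thesis unfolding s_def t_def by simp
qed

text \<open>Counterclockwise from the left limit point, coordinates increase: first the lower
  boundary from left to right with negative values, then \<open>Plus_Infinity\<close> at 0, then the
  upper boundary from right to left with positive values.\<close>

lemma coordinate_lower_less: "coordinate (Vertex (x, 0)) < coordinate (Vertex (y, 0)) \<longleftrightarrow> x < y"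
  using sqrt_one_plus_sq_diff_less[of x y] sqrt_one_plus_sq_diff_less[of y x]
  by (cases x y rule: linorder_cases) auto

lemma coordinate_upper_less: "coordinate (Vertex (x, 1)) < coordinate (Vertex (y, 1)) \<longleftrightarrow> y < x"
  using sqrt_one_plus_sq_diff_less[of x y] sqrt_one_plus_sq_diff_less[of y x]
  by (cases x y rule: linorder_cases) auto

lemma coordinate_sign: "coordinate (Vertex (x, 0)) < 0" "0 < coordinate (Vertex (x, 1))"
  using sqrt_one_plus_sq_gt[of x] by auto

lemma point_of_coordinate:
  assumes "e \<in> boundary_ends" "e \<noteq> Minus_Infinity"
  shows "point_of e = circle_point (coordinate e)"
proof (cases e)
  case (Vertex p)
  obtain x y where p: "p = (x, y)" by (cases p)
  have y: "y = 0 \<or> y = 1" using assms(1) unfolding Vertex p boundary_ends_def by auto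
  define s where "s = sqrt (1 + x\<^sup>2)"
  have s: "s\<^sup>2 = 1 + x\<^sup>2" "0 < s" "0 < s - x"
    using sqrt_one_plus_sq_gt[of x] one_plus_sq_pos[of x] by (auto simp: s_def)
  have "(2 * y - 1)\<^sup>2 = 1" using y by auto
  then have t: "1 + (coordinate e)\<^sup>2 = 2 * s * (s - x)"
    unfolding Vertex p using s(1) by (simp add: s_def[symmetric] power_mult_distrib) (simp add: power2_eq_square algebra_simps)
  have "2 / (2 * s * (s - x)) - 1 = x / s"
  proof -
    have "2 - 2 * s * (s - x) = 2 * x * (s - x)" using s(1) by (simp add: power2_eq_square algebra_simps)
    then have "2 / (2 * s * (s - x)) - 1 = 2 * x * (s - x) / (2 * s * (s - x))"
      using s by (simp add: field_simps)
    then show ?thesis using s by simp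
  qed
  moreover have "2 * coordinate e / (2 * s * (s - x)) = (2 * y - 1) / s"
    unfolding Vertex p using s by (simp add: s_def[symmetric])
  ultimately show ?thesis
    unfolding circle_point_def t unfolding Vertex p by (simp add: disc_of_def s_def)
qed (use assms in \<open>auto simp: circle_point_def complex_eq_iff\<close>)

lemma orient_coordinate:
  assumes "e \<in> boundary_ends - {Minus_Infinity}" "f \<in> boundary_ends - {Minus_Infinity}" "g \<in> boundary_ends - {Minus_Infinity}"
  obtains K where "0 < K" "orient (point_of e) (point_of f) (point_of g) =
    K * ((coordinate f - coordinate e) * (coordinate g - coordinate f) * (coordinate g - coordinate e))"
proof (rule that)
  show "0 < 4 / ((1 + (coordinate e)\<^sup>2) * (1 + (coordinate f)\<^sup>2) * (1 + (coordinate g)\<^sup>2))"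
    by (intro divide_pos_pos mult_pos_pos one_plus_sq_pos) simp
  have "point_of e = circle_point (coordinate e)" "point_of f = circle_point (coordinate f)"
    "point_of g = circle_point (coordinate g)"
    using assms point_of_coordinate by blast+
  then show "orient (point_of e) (point_of f) (point_of g) =
    4 / ((1 + (coordinate e)\<^sup>2) * (1 + (coordinate f)\<^sup>2) * (1 + (coordinate g)\<^sup>2)) *
    ((coordinate f - coordinate e) * (coordinate g - coordinate f) * (coordinate g - coordinate e))"
    by (simp only: orient_circle_point)
qed

lemma orient_coordinate_minus:
  assumes "e \<in> boundary_ends - {Minus_Infinity}" "f \<in> boundary_ends - {Minus_Infinity}"
  shows "0 < orient (point_of e) (point_of f) (-1) \<longleftrightarrow> coordinate e < coordinate f"
proof -
  have "0 < 4 / ((1 + (coordinate e)\<^sup>2) * (1 + (coordinate f)\<^sup>2))"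
    by (intro divide_pos_pos mult_pos_pos one_plus_sq_pos) simp
  moreover have "orient (point_of e) (point_of f) (-1) =
      4 / ((1 + (coordinate e)\<^sup>2) * (1 + (coordinate f)\<^sup>2)) * (coordinate f - coordinate e)"
    using assms by (simp only: point_of_coordinate orient_circle_point_minus Diff_iff insert_iff empty_iff simp_thms)
  moreover have "0 < K * x \<longleftrightarrow> 0 < x" if "0 < K" for K x :: real using that by (simp add: zero_less_mult_iff)
  ultimately show ?thesis by (metis diff_gt_0_iff_gt)
qed

lemma coordinate_inj:
  assumes "e \<in> boundary_ends - {Minus_Infinity}" "f \<in> boundary_ends - {Minus_Infinity}" "coordinate e = coordinate f"
  shows "e = f"
proof -
  have "point_of e = point_of f" using assms by (simp add: point_of_coordinate)
  then show ?thesis by (simp add: inj_eq[OF inj_point_of])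
qed

text \<open>\<open>disc_of\<close> reaches every circle point in the band; outside the band only 1
  and -1 remain, which are the two limit points.\<close>

lemma sphere_point_of:
  assumes "norm z = 1"
  obtains e where "e \<in> boundary_ends" "z = point_of e"
proof (cases "z \<in> band")
  case True
  then have z: "z = disc_of (strip_of z)" by (simp add: disc_of_strip_of)
  have "(norm (disc_of (strip_of z)))\<^sup>2 = 1" using z assms by simp
  then have "snd (strip_of z) * (1 - snd (strip_of z)) = 0"
    unfolding norm_disc_of using one_plus_sq_pos[of "fst (strip_of z)"] by simp
  then have "Vertex (strip_of z) \<in> boundary_ends" by (auto simp: boundary_ends_def)
  then show thesis using that[of "Vertex (strip_of z)"] z by simp
next
  case False
  then have "\<bar>Re z\<bar> = 1" using abs_Re_le_cmod[of z] assms by (simp add: band_def)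
  then have "(Re z)\<^sup>2 = 1" by (simp add: power2_eq_1_iff abs_if split: if_splits)
  moreover have "(Re z)\<^sup>2 + (Im z)\<^sup>2 = 1" using assms by (metis cmod_power2 one_power2)
  ultimately have "Im z = 0" by simp
  then have "z = 1 \<or> z = -1" using \<open>\<bar>Re z\<bar> = 1\<close> by (auto simp: complex_eq_iff abs_if split: if_splits)
  then show thesis using that[of Plus_Infinity] that[of Minus_Infinity] by (auto simp: boundary_ends_def)
qed

section \<open>Boundary segments as arcs of the circle\<close>

lemma open_segment_horizontal:
  fixes x y h :: real
  assumes "x < y" shows "open_segment (x, h) (y, h) = {(t, h) |t. x < t \<and> t < y}"
proof
  show "open_segment (x, h) (y, h) \<subseteq> {(t, h) |t. x < t \<and> t < y}"
  proof
    fix z assume "z \<in> open_segment (x, h) (y, h)"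
    then obtain u where u: "0 < u" "u < 1" "z = (1 - u) *\<^sub>R (x, h) + u *\<^sub>R (y, h)" by (auto simp: in_segment)
    have "(1 - u) * x + u * y = x + u * (y - x)" "(1 - u) * h + u * h = h" by (simp_all add: algebra_simps)
    moreover have "0 < u * (y - x)" "u * (y - x) < 1 * (y - x)"
      using u assms by (auto intro: mult_strict_right_mono simp del: mult_1)
    ultimately show "z \<in> {(t, h) |t. x < t \<and> t < y}" unfolding u(3) by simp
  qed
  show "{(t, h) |t. x < t \<and> t < y} \<subseteq> open_segment (x, h) (y, h)"
  proof clarify
    fix t assume t: "x < t" "t < y"
    define u where "u = (t - x) / (y - x)"
    have u: "0 < u" "u < 1" "u * (y - x) = t - x" using t assms by (auto simp: u_def)
    have "(t, h) = (1 - u) *\<^sub>R (x, h) + u *\<^sub>R (y, h)"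
      using u(3) by (simp add: algebra_simps)
    then show "(t, h) \<in> open_segment (x, h) (y, h)"
      using u(1,2) assms unfolding in_segment by blast
  qed
qed

lemma circle_arc_lower:
  assumes "x < y"
  shows "{z \<in> sphere 0 1. orient (disc_of (x,0)) (disc_of (y,0)) z < 0} = disc_of ` open_segment (x,0) (y,0)"
proof -
  have b: "Vertex (t, 0) \<in> boundary_ends - {Minus_Infinity}" "Vertex (t, 1) \<in> boundary_ends - {Minus_Infinity}" for t
    by (auto simp: boundary_ends_def)
  define P Q where "P = coordinate (Vertex (x,0))" and "Q = coordinate (Vertex (y,0))"
  \<comment> \<open>Only lower boundary points have negative coordinates, so an end between
    \<open>P\<close> and \<open>Q\<close> is on the lower boundary; \<open>Minus_Infinity\<close>,
    whose coordinate is a dummy, is treated separately.\<close>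
  have PQ: "P < Q" "Q < 0" using assms coordinate_lower_less coordinate_sign by (auto simp: P_def Q_def simp del: coordinate.simps)
  have iff: "orient (disc_of (x,0)) (disc_of (y,0)) (point_of e) < 0 \<longleftrightarrow> P < coordinate e \<and> coordinate e < Q"
    if e: "e \<in> boundary_ends - {Minus_Infinity}" for e
  proof -
    obtain K where "0 < K" "orient (point_of (Vertex (x,0))) (point_of (Vertex (y,0))) (point_of e) =
      K * ((Q - P) * (coordinate e - Q) * (coordinate e - P))"
      using orient_coordinate[OF b(1)[of x] b(1)[of y] e] unfolding P_def Q_def by blast
    then show ?thesis using PQ by (auto simp: mult_less_0_iff zero_less_mult_iff)
  qed
  have "orient (disc_of (x,0)) (disc_of (y,0)) z < 0 \<longleftrightarrow> z \<in> disc_of ` open_segment (x,0) (y,0)" if z: "norm z = 1" for z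
  proof -
    obtain e where e: "e \<in> boundary_ends" "z = point_of e" using sphere_point_of[OF z] .
    have "z \<in> disc_of ` open_segment (x,0) (y,0) \<longleftrightarrow> (\<exists>t. e = Vertex (t, 0) \<and> x < t \<and> t < y)"
      unfolding open_segment_horizontal[OF assms] e(2)
      using inj_eq[OF inj_point_of, of e "Vertex (_, 0)"] by (auto simp: image_iff)
    moreover have "orient (disc_of (x,0)) (disc_of (y,0)) z < 0 \<longleftrightarrow> (\<exists>t. e = Vertex (t, 0) \<and> x < t \<and> t < y)"
    proof (cases e)
      case (Vertex p)
      then obtain t where "p = (t, 0) \<or> p = (t, 1)" using e(1) by (cases p) (auto simp: boundary_ends_def)
      then show ?thesis
        using iff[of e] b[of t] Vertex PQ coordinate_sign[of t] coordinate_lower_less[of x t] coordinate_lower_less[of t y]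
        unfolding P_def Q_def e(2) by (auto simp del: coordinate.simps)
    next
      case Plus_Infinity
      then show ?thesis using iff[of e] e PQ by (auto simp: boundary_ends_def)
    next
      case Minus_Infinity
      then show ?thesis
        using orient_coordinate_minus[OF b(1)[of x] b(1)[of y]] PQ e(2) by (auto simp: P_def Q_def)
    qed
    ultimately show ?thesis by simp
  qed
  moreover have "norm z = 1" if "z \<in> disc_of ` open_segment (x,0) (y,0)" for z
    using that unfolding open_segment_horizontal[OF assms] by (auto simp: norm_disc_of_eq_1)
  ultimately show ?thesis by auto
qed

lemma circle_arc_upper:
  assumes "x < y"
  shows "{z \<in> sphere 0 1. orient (disc_of (y,1)) (disc_of (x,1)) z < 0} = disc_of ` open_segment (x,1) (y,1)"
proof -
  have b: "Vertex (t, 0) \<in> boundary_ends - {Minus_Infinity}" "Vertex (t, 1) \<in> boundary_ends - {Minus_Infinity}" for t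
    by (auto simp: boundary_ends_def)
  define P Q where "P = coordinate (Vertex (y,1))" and "Q = coordinate (Vertex (x,1))"
  have PQ: "P < Q" "0 < P" using assms coordinate_upper_less coordinate_sign by (auto simp: P_def Q_def simp del: coordinate.simps)
  have iff: "orient (disc_of (y,1)) (disc_of (x,1)) (point_of e) < 0 \<longleftrightarrow> P < coordinate e \<and> coordinate e < Q"
    if e: "e \<in> boundary_ends - {Minus_Infinity}" for e
  proof -
    obtain K where "0 < K" "orient (point_of (Vertex (y,1))) (point_of (Vertex (x,1))) (point_of e) =
      K * ((Q - P) * (coordinate e - Q) * (coordinate e - P))"
      using orient_coordinate[OF b(2)[of y] b(2)[of x] e] unfolding P_def Q_def by blast
    then show ?thesis using PQ by (auto simp: mult_less_0_iff zero_less_mult_iff)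
  qed
  have "orient (disc_of (y,1)) (disc_of (x,1)) z < 0 \<longleftrightarrow> z \<in> disc_of ` open_segment (x,1) (y,1)" if z: "norm z = 1" for z
  proof -
    obtain e where e: "e \<in> boundary_ends" "z = point_of e" using sphere_point_of[OF z] .
    have "z \<in> disc_of ` open_segment (x,1) (y,1) \<longleftrightarrow> (\<exists>t. e = Vertex (t, 1) \<and> x < t \<and> t < y)"
      unfolding open_segment_horizontal[OF assms] e(2)
      using inj_eq[OF inj_point_of, of e "Vertex (_, 1)"] by (auto simp: image_iff)
    moreover have "orient (disc_of (y,1)) (disc_of (x,1)) z < 0 \<longleftrightarrow> (\<exists>t. e = Vertex (t, 1) \<and> x < t \<and> t < y)"
    proof (cases e)
      case (Vertex p)
      then obtain t where "p = (t, 0) \<or> p = (t, 1)" using e(1) by (cases p) (auto simp: boundary_ends_def)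
      then show ?thesis
        using iff[of e] b[of t] Vertex PQ coordinate_sign[of t] coordinate_upper_less[of y t] coordinate_upper_less[of t x]
        unfolding P_def Q_def e(2) by (auto simp del: coordinate.simps)
    next
      case Plus_Infinity
      then show ?thesis using iff[of e] e PQ by (auto simp: boundary_ends_def)
    next
      case Minus_Infinity
      then show ?thesis
        using orient_coordinate_minus[OF b(2)[of y] b(2)[of x]] PQ e(2) by (auto simp: P_def Q_def)
    qed
    ultimately show ?thesis by simp
  qed
  moreover have "norm z = 1" if "z \<in> disc_of ` open_segment (x,1) (y,1)" for z
    using that unfolding open_segment_horizontal[OF assms] by (auto simp: norm_disc_of_eq_1)
  ultimately show ?thesis by auto
qed

definition valid_ends :: "rat set \<Rightarrow> endpoint set" where
  "valid_ends A = {Plus_Infinity, Minus_Infinity} \<union> Vertex ` (lower_vertices \<union> upper_vertices A)"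

text \<open>The boundary segment is traversed counterclockwise.\<close>

definition boundary_side :: "rat set \<Rightarrow> endpoint \<Rightarrow> endpoint \<Rightarrow> bool" where
  "boundary_side A e f \<longleftrightarrow>
     (\<exists>p q. neighbouring lower_vertices p q \<and> e = Vertex p \<and> f = Vertex q) \<or>
     (\<exists>p q. neighbouring (upper_vertices A) p q \<and> e = Vertex q \<and> f = Vertex p)"

lemma valid_ends_boundary: "valid_ends A \<subseteq> boundary_ends"
  by (auto simp: valid_ends_def boundary_ends_def lower_vertices_def upper_vertices_def)

lemma boundary_side_arc:
  assumes "boundary_side A e f"
  obtains p q where "{e, f} = {Vertex p, Vertex q}"
    "neighbouring lower_vertices p q \<or> neighbouring (upper_vertices A) p q"
    "{z \<in> sphere 0 1. orient (point_of e) (point_of f) z < 0} = disc_of ` open_segment p q"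
    "\<And>r. r \<in> open_segment p q \<Longrightarrow> Vertex r \<notin> valid_ends A"
proof -
  consider (lower) p q where "neighbouring lower_vertices p q" "e = Vertex p" "f = Vertex q"
    | (upper) p q where "neighbouring (upper_vertices A) p q" "e = Vertex q" "f = Vertex p"
    using assms unfolding boundary_side_def by blast
  then show thesis
  proof cases
    case lower
    then obtain x y where xy: "p = (x, 0)" "q = (y, 0)" "x < y"
      by (auto simp: neighbouring_def lower_vertices_def)
    show thesis
    proof (rule that[of p q])
      show "{z \<in> sphere 0 1. orient (point_of e) (point_of f) z < 0} = disc_of ` open_segment p q"
        using circle_arc_lower[OF xy(3)] lower xy by simp
      show "Vertex r \<notin> valid_ends A" if "r \<in> open_segment p q" for r
        using that lower(1) unfolding xy open_segment_horizontal[OF xy(3)]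
        by (auto simp: valid_ends_def neighbouring_def upper_vertices_def)
    qed (use lower in auto)
  next
    case upper
    then obtain x y where xy: "p = (x, 1)" "q = (y, 1)" "x < y"
      by (auto simp: neighbouring_def upper_vertices_def)
    show thesis
    proof (rule that[of p q])
      show "{z \<in> sphere 0 1. orient (point_of e) (point_of f) z < 0} = disc_of ` open_segment p q"
        using circle_arc_upper[OF xy(3)] upper xy by simp
      show "Vertex r \<notin> valid_ends A" if "r \<in> open_segment p q" for r
        using that upper(1) unfolding xy open_segment_horizontal[OF xy(3)]
        by (auto simp: valid_ends_def neighbouring_def lower_vertices_def)
    qed (use upper in auto)
  qed
qed

lemma boundary_side_nonneg:
  assumes "boundary_side A e f" "v \<in> valid_ends A"
  shows "0 \<le> orient (point_of e) (point_of f) (point_of v)"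
proof (rule ccontr)
  assume neg: "\<not> ?thesis"
  obtain p q where pq: "{z \<in> sphere 0 1. orient (point_of e) (point_of f) z < 0} = disc_of ` open_segment p q"
    "\<And>r. r \<in> open_segment p q \<Longrightarrow> Vertex r \<notin> valid_ends A"
    using boundary_side_arc[OF assms(1)] by metis
  have "norm (point_of v) = 1" using assms(2) valid_ends_boundary norm_point_of by blast
  then have "point_of v \<in> disc_of ` open_segment p q" unfolding pq(1)[symmetric] using neg by simp
  then obtain r where "r \<in> open_segment p q" "point_of v = point_of (Vertex r)" by auto
  then show False using pq(2) assms(2) by (metis inj_eq inj_point_of)
qed

lemma boundary_side_closure:
  assumes "boundary_side A e f"
  shows "{point_of e, point_of f} \<subseteq> closure {z \<in> sphere 0 1. orient (point_of e) (point_of f) z < 0}"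
proof -
  obtain p q where pq: "{e, f} = {Vertex p, Vertex q}"
    "neighbouring lower_vertices p q \<or> neighbouring (upper_vertices A) p q"
    "{z \<in> sphere 0 1. orient (point_of e) (point_of f) z < 0} = disc_of ` open_segment p q"
    using boundary_side_arc[OF assms] by metis
  have "p \<noteq> q" using pq(2) by (auto simp: neighbouring_def)
  then have "p \<in> closure (open_segment p q)" "q \<in> closure (open_segment p q)"
    by (simp_all add: closure_open_segment)
  moreover have "disc_of ` closure (open_segment p q) \<subseteq> closure (disc_of ` open_segment p q)"
    by (rule image_closure_subset[OF _ closed_closure closure_subset])
      (rule continuous_on_subset[OF continuous_on_disc_of], simp)
  ultimately have "{point_of (Vertex p), point_of (Vertex q)} \<subseteq> closure (disc_of ` open_segment p q)" by auto
  moreover have "{point_of e, point_of f} = point_of ` {e, f}" by simp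
  then have "{point_of e, point_of f} = {point_of (Vertex p), point_of (Vertex q)}" unfolding pq(1) by simp
  ultimately show ?thesis unfolding pq(3) by simp
qed

lemma lower_upper_disjoint: "lower_vertices \<inter> upper_vertices A = {}"
  by (auto simp: lower_vertices_def upper_vertices_def)

lemma arc_ends_valid:
  assumes "c \<in> arc_ends A"
  shows "\<exists>e f. c = {e, f} \<and> e \<in> valid_ends A \<and> f \<in> valid_ends A \<and> e \<noteq> f"
proof -
  have V: "Vertex p \<in> valid_ends A \<longleftrightarrow> p \<in> lower_vertices \<union> upper_vertices A"
    "Plus_Infinity \<in> valid_ends A" "Minus_Infinity \<in> valid_ends A" for p
    by (auto simp: valid_ends_def)
  consider "c \<in> bridging_ends A" | "c \<in> peripheral_ends lower_vertices"
      | "c \<in> peripheral_ends (upper_vertices A)" | "c \<in> asymptotic_ends A" | "c = {Minus_Infinity, Plus_Infinity}"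
    using assms unfolding arc_ends_def by blast
  then show ?thesis
  proof cases
    case 1
    then obtain p q where "c = {Vertex p, Vertex q}" "p \<in> lower_vertices" "q \<in> upper_vertices A"
      unfolding bridging_ends_def by blast
    then show ?thesis using V(1) lower_upper_disjoint[of A] by (intro exI[of _ "Vertex p"] exI[of _ "Vertex q"]) auto
  next
    case 2
    then obtain p q where "c = {Vertex p, Vertex q}" "p \<in> lower_vertices" "q \<in> lower_vertices" "fst p < fst q"
      unfolding peripheral_ends_def by blast
    then show ?thesis using V(1) by (intro exI[of _ "Vertex p"] exI[of _ "Vertex q"]) auto
  next
    case 3
    then obtain p q where "c = {Vertex p, Vertex q}" "p \<in> upper_vertices A" "q \<in> upper_vertices A" "fst p < fst q"
      unfolding peripheral_ends_def by blast
    then show ?thesis using V(1) by (intro exI[of _ "Vertex p"] exI[of _ "Vertex q"]) auto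
  next
    case 4
    then obtain p l where "c = {Vertex p, l}" "p \<in> lower_vertices \<union> upper_vertices A" "l \<in> {Plus_Infinity, Minus_Infinity}"
      unfolding asymptotic_ends_def by blast
    then show ?thesis using V by (intro exI[of _ "Vertex p"] exI[of _ l]) auto
  next
    case 5
    then show ?thesis using V(2,3) by (intro exI[of _ Minus_Infinity] exI[of _ Plus_Infinity]) auto
  qed
qed

lemma boundary_side_not_arc:
  assumes "boundary_side A e f" shows "{e, f} \<notin> arc_ends A"
proof
  assume arc: "{e, f} \<in> arc_ends A"
  have no: "{Vertex p, Vertex q} \<notin> arc_ends A"
    if pq: "neighbouring lower_vertices p q \<or> neighbouring (upper_vertices A) p q" for p q
  proof
    assume "{Vertex p, Vertex q} \<in> arc_ends A"
    then consider "{Vertex p, Vertex q} \<in> bridging_ends A" | "{Vertex p, Vertex q} \<in> peripheral_ends lower_vertices"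
      | "{Vertex p, Vertex q} \<in> peripheral_ends (upper_vertices A)" | "{Vertex p, Vertex q} \<in> asymptotic_ends A"
      | "{Vertex p, Vertex q} = {Minus_Infinity, Plus_Infinity}"
      unfolding arc_ends_def by blast
    then show False
    proof cases
      case 1
      then show ?thesis using pq lower_upper_disjoint[of A]
        by (auto simp: bridging_ends_def doubleton_eq_iff neighbouring_def)
    next
      case 2
      then show ?thesis using pq lower_upper_disjoint[of A]
        by (auto simp: peripheral_ends_def doubleton_eq_iff neighbouring_def)
    next
      case 3
      then show ?thesis using pq lower_upper_disjoint[of A]
        by (auto simp: peripheral_ends_def doubleton_eq_iff neighbouring_def)
    qed (auto simp: asymptotic_ends_def doubleton_eq_iff)
  qed
  show False
    using boundary_side_arc[OF assms] arc no by metis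
qed

section \<open>The Farey graph on the vertices of the strip\<close>

context frieze_path
begin

text \<open>In the Farey tessellation of the projective line, \<open>outer\<close> consists of the neighbours of
  the path \<open>v\<close> that lie beyond both of its ends.\<close>

definition outer :: "(int \<times> int) set" where
  "outer = {b. (\<forall>i. 0 < det2 (v i) b) \<and> (\<exists>k. det2 (v k) b = 1)}"

text \<open>The point of the projective line given by \<open>b\<close>. For outer vectors the
  denominator is positive, so comparing slopes amounts to taking the sign of a determinant.\<close>

definition slope :: "int \<times> int \<Rightarrow> rat" where
  "slope b = of_int (fst b) / of_int (snd b)"

abbreviation A :: "rat set" where
  "A \<equiv> slope ` outer"

text \<open>A relation, not a function: two vectors that represent the same end are only known to be
  parallel (\<open>rep_same\<close>), and determinants see no more than that.\<close>

definition rep :: "endpoint \<Rightarrow> int \<times> int \<Rightarrow> bool" where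
  "rep e u \<longleftrightarrow> (\<exists>i. e = Vertex (of_int i, 0) \<and> u = v i) \<or> (u \<in> outer \<and> e = Vertex (of_rat (slope u), 1))"

lemma outer_snd: "b \<in> outer \<Longrightarrow> 0 < snd b"
proof -
  assume "b \<in> outer"
  then have "0 < det2 (v 0) b" by (simp add: outer_def)
  then show ?thesis by (simp add: v0 det2_def)
qed

lemma slope_less: "b \<in> outer \<Longrightarrow> b' \<in> outer \<Longrightarrow> slope b < slope b' \<longleftrightarrow> det2 b b' < 0"
proof -
  assume "b \<in> outer" "b' \<in> outer"
  then have s: "0 < snd b" "0 < snd b'" using outer_snd by auto
  then have "slope b < slope b' \<longleftrightarrow> of_int (fst b) * of_int (snd b') < (of_int (fst b') * of_int (snd b) :: rat)"
    by (simp add: slope_def frac_less_eq divide_less_0_iff field_simps)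
  also have "\<dots> \<longleftrightarrow> fst b * snd b' < fst b' * snd b"
    by (metis of_int_less_iff of_int_mult)
  finally show ?thesis by (simp add: det2_def)
qed

lemma rep_lower: "rep (Vertex (of_int i, 0)) (v i)"
  unfolding rep_def by blast

lemma rep_valid:
  assumes "rep e u"
  shows "e \<in> valid_ends A" "e \<in> boundary_ends - {Minus_Infinity}"
proof -
  show "e \<in> valid_ends A"
    using assms by (auto simp: rep_def valid_ends_def lower_vertices_def upper_vertices_def)
  then show "e \<in> boundary_ends - {Minus_Infinity}"
    using assms valid_ends_boundary by (auto simp: rep_def)
qed

text \<open>Counterclockwise from the left limit point, the vectors turn in one direction and by
  less than a half turn, first along the path and then through the outer vectors. An upper vertex
  never precedes a lower one, by the signs of their coordinates.\<close>

lemma rep_less: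
  assumes "rep e u" "rep f w" "coordinate e < coordinate f"
  shows "0 < det2 u w"
proof -
  consider i j where "e = Vertex (of_int i, 0)" "u = v i" "f = Vertex (of_int j, 0)" "w = v j"
    | i where "e = Vertex (of_int i, 0)" "u = v i" "f = Vertex (of_rat (slope w), 1)" "w \<in> outer"
    | j where "e = Vertex (of_rat (slope u), 1)" "f = Vertex (of_int j, 0)"
    | "e = Vertex (of_rat (slope u), 1)" "u \<in> outer" "f = Vertex (of_rat (slope w), 1)" "w \<in> outer"
    using assms(1,2) unfolding rep_def by blast
  then show ?thesis
  proof cases
    case (1 i j)
    then have "i < j" using assms(3) unfolding 1 coordinate_lower_less by simp
    then show ?thesis using pos 1 by simp
  next
    case 2
    then show ?thesis by (simp add: outer_def)
  next
    case 3
    then show ?thesis using assms(3) coordinate_sign less_asym by (metis less_trans)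
  next
    case 4
    then have "slope w < slope u" using assms(3) unfolding 4(1,3) coordinate_upper_less by (simp add: of_rat_less)
    then have "det2 w u < 0" using slope_less 4 by blast
    then show ?thesis using det2_antisym[of w u] by simp
  qed
qed

lemma rep_same: "rep e u \<Longrightarrow> rep e w \<Longrightarrow> det2 u w = 0"
proof -
  assume e: "rep e u" "rep e w"
  show ?thesis
  proof (cases "\<exists>i. e = Vertex (of_int i, 0)")
    case True
    then show ?thesis using e by (auto simp: rep_def det2_def)
  next
    case False
    then have "u \<in> outer" "w \<in> outer" "slope u = slope w" using e by (auto simp: rep_def)
    then have "\<not> det2 u w < 0" "\<not> det2 w u < 0" using slope_less by (metis less_irrefl)+
    then show ?thesis using det2_antisym[of w u] by simp
  qed
qed

lemma rep_sign:
  assumes "rep e u" "rep f w"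
  shows "0 < det2 u w \<longleftrightarrow> coordinate e < coordinate f" "det2 u w < 0 \<longleftrightarrow> coordinate f < coordinate e"
    "det2 u w = 0 \<longleftrightarrow> e = f"
proof -
  have "e = f" if "coordinate e = coordinate f"
    using coordinate_inj rep_valid(2) assms that by blast
  then show "0 < det2 u w \<longleftrightarrow> coordinate e < coordinate f" "det2 u w < 0 \<longleftrightarrow> coordinate f < coordinate e"
    "det2 u w = 0 \<longleftrightarrow> e = f"
    using rep_less[OF assms] rep_less[OF assms(2,1)] rep_same[of e u w] assms det2_antisym[of w u]
    by (cases "coordinate e" "coordinate f" rule: linorder_cases; force)+
qed

text \<open>Each vector occurs twice in the product of the three determinants, so its sign does not
  matter; this suits the fan, whose vectors are known only up to sign. With cyclic indices the
  product has the sign opposite to the Vandermonde product of the coordinates, hence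
  \<open>< 0\<close>.\<close>

lemma rep_orient:
  assumes r: "rep e u" "rep f w" "rep g t" and neg: "det2 u w * det2 w t * det2 t u < 0"
  shows "0 < orient (point_of e) (point_of f) (point_of g)"
proof -
  obtain K where K: "0 < K" "orient (point_of e) (point_of f) (point_of g) =
    K * ((coordinate f - coordinate e) * (coordinate g - coordinate f) * (coordinate g - coordinate e))"
    using orient_coordinate[OF rep_valid(2)[OF r(1)] rep_valid(2)[OF r(2)] rep_valid(2)[OF r(3)]] .
  have "0 < (coordinate f - coordinate e) * (coordinate g - coordinate f) * (coordinate g - coordinate e)"
    using neg rep_sign[OF r(1,2)] rep_sign[OF r(2,3)] rep_sign[OF r(3,1)]
    by (auto simp: mult_less_0_iff zero_less_mult_iff)
  then show ?thesis using K by simp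
qed

text \<open>The vectors of neighbouring lower vertices, for example, also have determinant 1, but
  such a pair is a boundary segment; the restriction to \<open>arc_ends A\<close> removes
  it.\<close>

definition frieze_edges :: "endpoint set set" where
  "frieze_edges = {c \<in> arc_ends A. \<exists>e f u w. c = {e, f} \<and> rep e u \<and> rep f w \<and> \<bar>det2 u w\<bar> = 1}"

lemma frieze_edge_oriented:
  assumes "{e, f} \<in> frieze_edges"
  obtains e' f' u w where "{e, f} = {e', f'}" "rep e' u" "rep f' w" "det2 u w = 1" "coordinate e' < coordinate f'"
proof -
  obtain e' f' u w where *: "{e, f} = {e', f'}" "rep e' u" "rep f' w" "\<bar>det2 u w\<bar> = 1"
    using assms unfolding frieze_edges_def by blast
  show thesis
  proof (cases "det2 u w = 1")
    case True
    then show thesis using that[OF *(1-3)] rep_sign(1)[OF *(2,3)] by simp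
  next
    case False
    then have "det2 w u = 1" using *(4) det2_antisym[of w u] by simp
    moreover have "{e, f} = {f', e'}" using *(1) by auto
    ultimately show thesis using that[of f' e' w u] * rep_sign(1)[OF *(3,2)] by simp
  qed
qed

text \<open>If two Farey edges crossed, the coordinates of their ends would interleave. The Pluecker
  relation would then express 1, the product of the two edge determinants, as a sum of two products
  of positive integers.\<close>

lemma frieze_edges_noncrossing:
  assumes ef: "{e, f} \<in> frieze_edges" and gh: "{g, h} \<in> frieze_edges" and ne: "{e, f} \<noteq> {g, h}"
  shows "open_segment (point_of e) (point_of f) \<inter> open_segment (point_of g) (point_of h) = {}"
proof (rule ccontr)
  assume "\<not> ?thesis"
  then obtain z where z: "z \<in> open_segment (point_of e) (point_of f)" "z \<in> open_segment (point_of g) (point_of h)" by blast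
  obtain e' f' u w where e': "{e, f} = {e', f'}" "rep e' u" "rep f' w" "det2 u w = 1" "coordinate e' < coordinate f'"
    using frieze_edge_oriented[OF ef] .
  obtain g' h' s t where g': "{g, h} = {g', h'}" "rep g' s" "rep h' t" "det2 s t = 1" "coordinate g' < coordinate h'"
    using frieze_edge_oriented[OF gh] .
  have z1: "z \<in> open_segment (point_of e') (point_of f')"
    using z(1) e'(1) by (auto simp: doubleton_eq_iff open_segment_commute)
  have z2: "z \<in> open_segment (point_of g') (point_of h')"
    using z(2) g'(1) by (auto simp: doubleton_eq_iff open_segment_commute)
  obtain r where r: "0 < r" "r < 1" "z = (1 - r) *\<^sub>R point_of g' + r *\<^sub>R point_of h'" using z2 by (auto simp: in_segment)
  note b = rep_valid(2)[OF e'(2)] rep_valid(2)[OF e'(3)] rep_valid(2)[OF g'(2)] rep_valid(2)[OF g'(3)]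
  define G H where "G = orient (point_of e') (point_of f') (point_of g')"
    and "H = orient (point_of e') (point_of f') (point_of h')"
  have zero: "(1 - r) * G + r * H = 0"
    using orient_open_segment[OF z1] unfolding r(3) orient_affine G_def H_def .
  define ce cf cg ch where "ce = coordinate e'" and "cf = coordinate f'" and "cg = coordinate g'" and "ch = coordinate h'"
  obtain K where K: "0 < K" "G = K * ((cf - ce) * (cg - cf) * (cg - ce))"
    using orient_coordinate[OF b(1,2,3)] unfolding G_def ce_def cf_def cg_def by blast
  obtain L where L: "0 < L" "H = L * ((cf - ce) * (ch - cf) * (ch - ce))"
    using orient_coordinate[OF b(1,2,4)] unfolding H_def ce_def cf_def ch_def by blast
  have lt: "ce < cf" "cg < ch" using e'(5) g'(5) by (simp_all add: ce_def cf_def cg_def ch_def)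
  \<comment> \<open>At \<open>z\<close>, inside the segment from \<open>g'\<close> to
    \<open>h'\<close>, an affine function vanishes, so its values at the two ends are opposite in
    sign or both 0.\<close>
  have signs: "0 < G \<and> H < 0 \<or> G < 0 \<and> 0 < H \<or> G = 0 \<and> H = 0"
  proof -
    have "0 < 1 - r" using r by simp
    then have "(1 - r) * G = - (r * H)" "0 < G \<longleftrightarrow> 0 < (1 - r) * G" "0 < H \<longleftrightarrow> 0 < r * H"
      "G < 0 \<longleftrightarrow> (1 - r) * G < 0" "H < 0 \<longleftrightarrow> r * H < 0"
      using zero r by (auto simp: zero_less_mult_iff mult_less_0_iff)
    then show ?thesis by linarith
  qed
  have Gs: "(0 < G \<longleftrightarrow> cg < ce \<or> cf < cg) \<and> (G < 0 \<longleftrightarrow> ce < cg \<and> cg < cf)"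
    unfolding K(2) using K(1) lt by (auto simp: zero_less_mult_iff mult_less_0_iff)
  have Hs: "(0 < H \<longleftrightarrow> ch < ce \<or> cf < ch) \<and> (H < 0 \<longleftrightarrow> ce < ch \<and> ch < cf)"
    unfolding L(2) using L(1) lt by (auto simp: zero_less_mult_iff mult_less_0_iff)
  consider "cg < ce" "ce < ch" "ch < cf" | "ce < cg" "cg < cf" "cf < ch" | "cg = ce" "ch = cf"
    using signs Gs Hs lt by linarith
  then show False
  proof cases
    case 1
    then have "0 < det2 s u" "0 < det2 u t" "0 < det2 t w" "0 < det2 s w"
      using rep_less e' g' lt unfolding ce_def cf_def cg_def ch_def by (meson less_trans)+
    then have "1 \<le> det2 s u * det2 t w" "1 \<le> det2 s w * det2 u t"
      by (simp_all add: int_one_le_iff_zero_less)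
    then show False using det2_Pluecker[of s t u w] e'(4) g'(4) by simp
  next
    case 2
    then have "0 < det2 u s" "0 < det2 s w" "0 < det2 w t" "0 < det2 u t"
      using rep_less e' g' lt unfolding ce_def cf_def cg_def ch_def by (meson less_trans)+
    then have "1 \<le> det2 u s * det2 w t" "1 \<le> det2 u t * det2 s w"
      by (simp_all add: int_one_le_iff_zero_less)
    then show False using det2_Pluecker[of u w s t] e'(4) g'(4) by simp
  next
    case 3
    then have "g' = e'" "h' = f'" using coordinate_inj b unfolding ce_def cf_def cg_def ch_def by blast+
    then show False using e'(1) g'(1) ne by simp
  qed
qed

text \<open>Up to sign these are the Farey neighbours of \<open>v i\<close>, and consecutive ones
  are neighbours of each other. By the recurrence they run from \<open>- v (i - 1)\<close> at
  \<open>k = 0\<close> to \<open>v (i + 1)\<close> at \<open>k = a i\<close>, so the fan has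
  \<open>a i\<close> triangles.\<close>

definition fan_vector :: "int \<Rightarrow> int \<Rightarrow> int \<times> int" where
  "fan_vector i k = (k * fst (v i) - fst (v (i - 1)), k * snd (v i) - snd (v (i - 1)))"

lemma v_prev_next:
  "fst (v (i + 1)) = a i * fst (v i) - fst (v (i - 1))" "snd (v (i + 1)) = a i * snd (v i) - snd (v (i - 1))"
  using rec[of i] by (simp_all add: prod_eq_iff)

lemma det1': "det2 (v (i - 1)) (v i) = 1"
  using det1[of "i - 1"] by simp

lemma det2_fan_vector:
  "det2 (v i) (fan_vector i k) = 1" "det2 (v (i - 1)) (fan_vector i k) = k"
  "det2 (v (i + 1)) (fan_vector i k) = a i - k" "det2 (fan_vector i l) (fan_vector i k) = l - k"
proof -
  have 1: "fst (v (i - 1)) * snd (v i) = 1 + fst (v i) * snd (v (i - 1))"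
    using det1'[of i] by (simp add: det2_def)
  show "det2 (v i) (fan_vector i k) = 1" "det2 (v (i - 1)) (fan_vector i k) = k"
    "det2 (fan_vector i l) (fan_vector i k) = l - k"
    using 1 by (simp_all add: det2_def fan_vector_def algebra_simps)
  show "det2 (v (i + 1)) (fan_vector i k) = a i - k"
    unfolding det2_def fan_vector_def v_prev_next using 1 by (simp add: algebra_simps)
qed

lemma fan_vector_ends: "fan_vector i (a i) = v (i + 1)" "fan_vector i 0 = - v (i - 1)"
  by (simp_all add: fan_vector_def v_prev_next prod_eq_iff)

lemma det2_basis: "det2 x b = det2 b (v (i + 1)) * det2 x (v i) + det2 (v i) b * det2 x (v (i + 1))"
proof -
  have "det2 (v i) (v (i + 1)) * det2 x b = det2 b (v (i + 1)) * det2 x (v i) + det2 (v i) b * det2 x (v (i + 1))"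
    by (simp add: det2_def algebra_simps)
  then show ?thesis by (simp add: det1)
qed

text \<open>Cramer's rule in the unimodular basis \<open>v i\<close>,
  \<open>v (i + 1)\<close>.\<close>

lemma vector_basis:
  "b = (det2 b (v (i + 1)) * fst (v i) + det2 (v i) b * fst (v (i + 1)),
        det2 b (v (i + 1)) * snd (v i) + det2 (v i) b * snd (v (i + 1)))"
proof -
  have 1: "fst (v i) * snd (v (i + 1)) = 1 + fst (v (i + 1)) * snd (v i)"
    using det1[of i] by (simp add: det2_def)
  have "fst b * (fst (v i) * snd (v (i + 1)) - fst (v (i + 1)) * snd (v i)) =
      det2 b (v (i + 1)) * fst (v i) + det2 (v i) b * fst (v (i + 1))"
    "snd b * (fst (v i) * snd (v (i + 1)) - fst (v (i + 1)) * snd (v i)) =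
      det2 b (v (i + 1)) * snd (v i) + det2 (v i) b * snd (v (i + 1))"
    by (simp_all add: det2_def algebra_simps)
  then show ?thesis using 1 by (simp add: prod_eq_iff)
qed

text \<open>Follow the path from \<open>v i\<close> upward to the first \<open>j + 1\<close> where
  the determinant with \<open>b\<close> is no longer positive. Then \<open>b\<close> is
  \<open>t\<close> times \<open>v j\<close> plus \<open>s\<close> times \<open>v (j + 1)\<close>
  with \<open>t \<ge> 0\<close> and \<open>s \<ge> 1\<close>, and \<open>det2 (v i) b = 1\<close>
  leaves only \<open>t = 0\<close> and \<open>s = 1\<close>, so \<open>b\<close> is on the path.
  Downward the same argument puts \<open>- b\<close> on the path. If neither happens, all
  determinants are positive and \<open>b\<close> is outer.\<close>

lemma fan_vector_cases:
  assumes k: "0 < k" "k < a i"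
  shows "(\<exists>j. fan_vector i k = v j) \<or> (\<exists>j. - fan_vector i k = v j) \<or> fan_vector i k \<in> outer"
proof (rule ccontr)
  assume no: "\<not> ?thesis"
  define b where "b = fan_vector i k"
  have b: "det2 (v i) b = 1" "0 < det2 (v (i - 1)) b" "0 < det2 (v (i + 1)) b"
    using det2_fan_vector k by (simp_all add: b_def)
  have up: "0 < det2 (v j) b" if "i + 1 \<le> j" for j
    using that
  proof (induction j rule: int_ge_induct)
    case (step j)
    show ?case
    proof (rule ccontr)
      assume neg: "\<not> 0 < det2 (v (j + 1)) b"
      define s t where "s = det2 (v j) b" and "t = det2 b (v (j + 1))"
      have st: "1 \<le> s" "0 \<le> t" using step neg det2_antisym[of "v (j + 1)" b] by (auto simp: s_def t_def)
      have d: "1 \<le> det2 (v i) (v j)" "1 \<le> det2 (v i) (v (j + 1))" using pos[of i j] pos[of i "j + 1"] step by auto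
      have "1 = t * det2 (v i) (v j) + s * det2 (v i) (v (j + 1))"
        using det2_basis[of "v i" b j] b(1) by (simp add: s_def t_def)
      moreover have "t \<le> t * det2 (v i) (v j)" "s \<le> s * det2 (v i) (v (j + 1))"
        using st d by (simp_all add: mult_le_cancel_left1)
      ultimately have "t = 0" "s = 1" using st by linarith+
      then have "b = v (j + 1)" using vector_basis[of b j] by (simp add: s_def t_def)
      then show False using no b_def by metis
    qed
  qed (use b in simp)
  have down: "0 < det2 (v j) b" if "j \<le> i - 1" for j
    using that
  proof (induction j rule: int_le_induct)
    case (step j)
    show ?case
    proof (rule ccontr)
      assume neg: "\<not> 0 < det2 (v (j - 1)) b"
      define s t where "s = det2 (v j) b" and "t = - det2 (v (j - 1)) b"
      have st: "1 \<le> s" "0 \<le> t" using step neg by (auto simp: s_def t_def)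
      have d: "1 \<le> det2 (v j) (v i)" "1 \<le> det2 (v (j - 1)) (v i)" using pos[of j i] pos[of "j - 1" i] step by auto
      have "1 = s * det2 (v (j - 1)) (v i) + t * det2 (v j) (v i)"
        using det2_basis[of "v i" b "j - 1"] b(1) det2_antisym[of b "v j"] det2_antisym[of "v i" "v j"]
          det2_antisym[of "v i" "v (j - 1)"] by (simp add: s_def t_def)
      moreover have "t \<le> t * det2 (v j) (v i)" "s \<le> s * det2 (v (j - 1)) (v i)"
        using st d by (simp_all add: mult_le_cancel_left1)
      ultimately have "t = 0" "s = 1" using st by linarith+
      then have "det2 (v (j - 1)) b = 0" "det2 b (v j) = -1" using det2_antisym[of b "v j"] by (simp_all add: s_def t_def)
      then have "b = - v (j - 1)" using vector_basis[of b "j - 1"] by (simp add: prod_eq_iff)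
      then have "- b = v (j - 1)" by simp
      then show False using no b_def by metis
    qed
  qed (use b in simp)
  have "0 < det2 (v j) b" for j using up[of j] down[of j] b(1) by (cases "j = i") force+
  then have "b \<in> outer" using b(1) unfolding outer_def by blast
  then show False using no b_def by blast
qed

text \<open>The inner ends are chosen up to the sign of the vector, which is all that
  \<open>fan_vector_cases\<close> determines. The first and the last end are the lower neighbours of
  the vertex and are given explicitly.\<close>

definition fan_end :: "int \<Rightarrow> nat \<Rightarrow> endpoint" where
  "fan_end i k = (if k = 0 then Vertex (of_int (i - 1), 0) else if int k = a i then Vertex (of_int (i + 1), 0)
     else SOME e. rep e (fan_vector i k) \<or> rep e (- fan_vector i k))"

lemma fan_end_rep:
  assumes "int k \<le> a i"
  obtains u where "rep (fan_end i k) u" "u = fan_vector i k \<or> u = - fan_vector i k"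
proof -
  have "rep (fan_end i k) (fan_vector i k) \<or> rep (fan_end i k) (- fan_vector i k)"
  proof -
    consider "k = 0" | "int k = a i" "k \<noteq> 0" | "0 < int k" "int k < a i" using assms by linarith
    then show ?thesis
    proof cases
      case 1
      then show ?thesis using rep_lower[of "i - 1"] by (simp add: fan_end_def fan_vector_ends)
    next
      case 2
      then show ?thesis using rep_lower[of "i + 1"] by (simp add: fan_end_def fan_vector_ends)
    next
      case 3
      have "\<exists>e. rep e (fan_vector i k) \<or> rep e (- fan_vector i k)"
        using fan_vector_cases[OF 3] rep_lower unfolding rep_def by metis
      from someI_ex[OF this] show ?thesis using 3 by (simp add: fan_end_def)
    qed
  qed
  then show thesis using that by blast
qed

text \<open>The unknown signs of \<open>u\<close> and \<open>w\<close> cancel in the product of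
  determinants, which is \<open>k - l\<close>.\<close>

lemma fan_end_orient:
  assumes "k < l" "int l \<le> a i"
  shows "0 < orient (point_of (Vertex (of_int i, 0))) (point_of (fan_end i l)) (point_of (fan_end i k))"
proof -
  obtain u where u: "rep (fan_end i l) u" "u = fan_vector i l \<or> u = - fan_vector i l"
    using fan_end_rep assms by metis
  obtain w where w: "rep (fan_end i k) w" "w = fan_vector i k \<or> w = - fan_vector i k"
    using fan_end_rep[of k i] assms by auto
  have neg: "det2 (- x) y = - det2 x y" "det2 x (- y) = - det2 x y" for x y by (simp_all add: det2_def)
  have "det2 (v i) u * det2 u w * det2 w (v i) = - (int l - int k)"
    using u(2) w(2) det2_fan_vector[of i] det2_antisym[of "fan_vector i k" "v i"] by (auto simp: neg)
  then show ?thesis using assms by (intro rep_orient[OF rep_lower u(1) w(1)]) simp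
qed

lemma edge_or_boundary_side:
  assumes "rep e u" "rep f w" "\<bar>det2 u w\<bar> = 1"
  shows "{e, f} \<in> frieze_edges \<or> boundary_side A e f \<or> boundary_side A f e"
proof -
  have ne: "e \<noteq> f" using rep_sign(3)[OF assms(1,2)] assms(3) by auto
  have "{e, f} \<in> arc_ends A \<or> boundary_side A e f \<or> boundary_side A f e"
  proof -
    obtain p q where pq: "e = Vertex p" "f = Vertex q" "p \<in> lower_vertices \<union> upper_vertices A" "q \<in> lower_vertices \<union> upper_vertices A"
      using assms(1,2) unfolding rep_def lower_vertices_def upper_vertices_def by blast
    have swap: "{Vertex q, Vertex p} = {Vertex p, Vertex q}" by auto
    consider "p \<in> lower_vertices" "q \<in> upper_vertices A" | "q \<in> lower_vertices" "p \<in> upper_vertices A"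
      | "p \<in> lower_vertices" "q \<in> lower_vertices" | "p \<in> upper_vertices A" "q \<in> upper_vertices A" using pq by blast
    then show ?thesis
    proof cases
      case 1
      then show ?thesis unfolding pq arc_ends_def bridging_ends_def by blast
    next
      case 2
      then show ?thesis unfolding pq swap[symmetric] arc_ends_def bridging_ends_def by blast
    next
      case 3
      then have "fst p < fst q \<or> fst q < fst p" using ne pq by (auto simp: lower_vertices_def)
      then show ?thesis
        using 3 swap unfolding pq arc_ends_def peripheral_ends_def boundary_side_def by blast
    next
      case 4
      then have "fst p < fst q \<or> fst q < fst p" using ne pq by (auto simp: upper_vertices_def)
      then show ?thesis
        using 4 swap unfolding pq arc_ends_def peripheral_ends_def boundary_side_def by blast
    qed
  qed
  then show ?thesis using assms unfolding frieze_edges_def by blast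
qed

lemma neighbouring_lower_iff:
  "neighbouring lower_vertices p q \<longleftrightarrow> (\<exists>i::int. p = (of_int i, 0) \<and> q = (of_int (i + 1), 0))"
proof
  assume n: "neighbouring lower_vertices p q"
  then obtain i j :: int where ij: "p = (of_int i, 0)" "q = (of_int j, 0)" "i < j"
    by (auto simp: neighbouring_def lower_vertices_def)
  have "\<not> i + 1 < j"
  proof
    assume "i + 1 < j"
    then have "of_int (i + 1) < fst q" unfolding ij(2) fst_conv of_int_less_iff .
    moreover have "fst p < of_int (i + 1)" using ij(1) by simp
    moreover have "(real_of_int (i + 1), 0) \<in> lower_vertices" unfolding lower_vertices_def by blast
    ultimately show False using n unfolding neighbouring_def by (metis fst_conv)
  qed
  then show "\<exists>i::int. p = (of_int i, 0) \<and> q = (of_int (i + 1), 0)" using ij by (intro exI[of _ i]) auto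
next
  assume "\<exists>i::int. p = (of_int i, 0) \<and> q = (of_int (i + 1), 0)"
  then obtain i :: int where i: "p = (of_int i, 0)" "q = (of_int (i + 1), 0)" by blast
  have "\<not> (real_of_int i < of_int k \<and> of_int k < real_of_int (i + 1))" for k :: int
    unfolding of_int_less_iff by linarith
  then have "\<not> (\<exists>r\<in>lower_vertices. fst p < fst r \<and> fst r < fst q)"
    unfolding i lower_vertices_def by auto
  moreover have "p \<in> lower_vertices" "q \<in> lower_vertices" unfolding i lower_vertices_def by blast+
  ultimately show "neighbouring lower_vertices p q" unfolding neighbouring_def using i by simp
qed

lemma boundary_side_lower:
  "boundary_side A (Vertex (of_int i, 0)) f \<longleftrightarrow> f = Vertex (of_int (i + 1), 0)"
  "boundary_side A e (Vertex (of_int i, 0)) \<longleftrightarrow> e = Vertex (of_int (i - 1), 0)"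
proof -
  have up: "\<not> neighbouring (upper_vertices A) p (of_int i, 0)" "\<not> neighbouring (upper_vertices A) (of_int i, 0) p" for p
    by (auto simp: neighbouring_def upper_vertices_def)
  show "boundary_side A (Vertex (of_int i, 0)) f \<longleftrightarrow> f = Vertex (of_int (i + 1), 0)"
    using up by (auto simp: boundary_side_def neighbouring_lower_iff)
  have "(\<exists>j::int. p = (of_int j, 0) \<and> i = j + 1) \<longleftrightarrow> p = (of_int (i - 1), 0)" for p :: "real \<times> real"
    by (auto intro: exI[of _ "i - 1"])
  then show "boundary_side A e (Vertex (of_int i, 0)) \<longleftrightarrow> e = Vertex (of_int (i - 1), 0)"
    using up by (auto simp: boundary_side_def neighbouring_lower_iff intro!: exI[of _ "i - 1"])
qed

end

text \<open>\<open>E\<close> will be the maximal family from Zorn's lemma; its maximality enters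
  through the hypothesis of \<open>strip_triangulation_T\<close>.\<close>

locale frieze_triangulation = frieze_path +
  fixes E :: "endpoint set set"
  assumes edges: "frieze_edges \<subseteq> E" "E \<subseteq> arc_ends A"
    and noncross: "\<And>e f g h. \<lbrakk>{e, f} \<in> E; {g, h} \<in> E; {e, f} \<noteq> {g, h}\<rbrakk> \<Longrightarrow>
      open_segment (point_of e) (point_of f) \<inter> open_segment (point_of g) (point_of h) = {}"
begin

sublocale chord_system "valid_ends A" E
proof
  show "valid_ends A \<subseteq> boundary_ends" by (rule valid_ends_boundary)
  show "\<exists>e f. c = {e, f} \<and> e \<in> valid_ends A \<and> f \<in> valid_ends A \<and> e \<noteq> f" if "c \<in> E" for c
    using that edges arc_ends_valid by blast
qed (rule noncross)

lemma boundary_side_good: "boundary_side A e f \<Longrightarrow> good_side e f"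
  unfolding good_side_def using boundary_side_nonneg boundary_side_closure by blast

text \<open>Consecutive fan vectors have determinant 1 up to sign, so their ends form an edge or a
  boundary segment. A boundary segment in the wrong direction would have the vertex \<open>p\<close>
  of the fan strictly beyond it.\<close>

lemma fan_side:
  assumes k: "int k < a i"
  shows "{fan_end i (Suc k), fan_end i k} \<in> E \<or> boundary_side A (fan_end i (Suc k)) (fan_end i k)"
proof -
  define p where "p = Vertex (of_int i, 0)"
  have neg: "det2 (- x) y = - det2 x y" "det2 x (- y) = - det2 x y" for x y by (simp_all add: det2_def)
  have k': "int (Suc k) \<le> a i" "int k \<le> a i" using k by auto
  obtain u where u: "rep (fan_end i (Suc k)) u" "u = fan_vector i (Suc k) \<or> u = - fan_vector i (Suc k)"
    using fan_end_rep[OF k'(1)] by blast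
  obtain w where w: "rep (fan_end i k) w" "w = fan_vector i k \<or> w = - fan_vector i k"
    using fan_end_rep[OF k'(2)] by blast
  have "\<bar>det2 u w\<bar> = 1" using u(2) w(2) det2_fan_vector(4)[of i "int (Suc k)" "int k"] by (auto simp: neg)
  then consider "{fan_end i (Suc k), fan_end i k} \<in> frieze_edges" | "boundary_side A (fan_end i (Suc k)) (fan_end i k)"
    | "boundary_side A (fan_end i k) (fan_end i (Suc k))"
    using edge_or_boundary_side[OF u(1) w(1)] by blast
  then show ?thesis
  proof cases
    case 3
    have "p \<in> valid_ends A" unfolding p_def by (rule rep_valid(1)[OF rep_lower])
    then have "0 \<le> orient_at (fan_end i k) (fan_end i (Suc k)) (point_of p)"
      by (rule boundary_side_nonneg[OF 3])
    moreover have "0 < orient_at p (fan_end i (Suc k)) (point_of (fan_end i k))"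
      unfolding p_def by (rule fan_end_orient[OF _ k'(1)]) simp
    ultimately show ?thesis
      using orient_cycle[of "point_of (fan_end i (Suc k))" "point_of (fan_end i k)" "point_of p"]
        orient_swap[of "point_of (fan_end i (Suc k))" "point_of (fan_end i k)"] by simp
  qed (use edges in auto)
qed

lemma frieze_fan: "good_fan (Vertex (of_int i, 0)) (nat (a i)) (fan_end i)"
proof -
  define p where "p = Vertex (of_int i, 0)"
  define n where "n = nat (a i)"
  have n: "int n = a i" "0 < n" using a_pos[of i] by (auto simp: n_def)
  have x0: "fan_end i 0 = Vertex (of_int (i - 1), 0)" and xn: "fan_end i n = Vertex (of_int (i + 1), 0)"
    using n by (auto simp: fan_end_def)
  have orient: "0 < orient_at p (fan_end i l) (point_of (fan_end i k))" if "k < l" "l \<le> n" for k l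
    using fan_end_orient[of k l i] that n unfolding p_def by simp
  have b0: "boundary_side A (fan_end i 0) p" and bn: "boundary_side A p (fan_end i n)"
    unfolding x0 xn p_def using boundary_side_lower by blast+
  have neg: "det2 (- x) y = - det2 x y" "det2 x (- y) = - det2 x y" for x y by (simp_all add: det2_def)
  have side: "good_side (fan_end i (Suc k)) (fan_end i k)" if "k < n" for k
    using fan_side[of k i] boundary_side_good that n(1) by (auto simp: good_side_def)
  \<comment> \<open>The pair is not a boundary segment: on the lower boundary \<open>p\<close> has
    only the first and the last end of the fan as neighbours, and strict orientation keeps
    \<open>fan_end i k\<close> apart from both.\<close>
  have spoke: "{p, fan_end i k} \<in> E" if "0 < k" "k < n" for k
  proof -
    obtain w where w: "rep (fan_end i k) w" "w = fan_vector i k \<or> w = - fan_vector i k"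
    proof -
      have "int k \<le> a i" using n \<open>k < n\<close> by linarith
      then show thesis using fan_end_rep that by blast
    qed
    have "\<bar>det2 (v i) w\<bar> = 1" using w(2) det2_fan_vector(1)[of i "int k"] by (auto simp: neg)
    then consider "{p, fan_end i k} \<in> frieze_edges" | "boundary_side A p (fan_end i k)" | "boundary_side A (fan_end i k) p"
      using edge_or_boundary_side[OF rep_lower w(1)] unfolding p_def by blast
    then show ?thesis
    proof cases
      case 1
      then show ?thesis using edges by blast
    next
      case 2
      then have "fan_end i k = fan_end i n" unfolding xn p_def by (rule boundary_side_lower(1)[THEN iffD1])
      then show ?thesis using orient[of k n] that by simp
    next
      case 3
      then have "fan_end i k = fan_end i 0" unfolding x0 p_def by (rule boundary_side_lower(2)[THEN iffD1])
      then show ?thesis using orient[of 0 k] that by simp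
    qed
  qed
  have valid: "fan_end i k \<in> valid_ends A" if "k \<le> n" for k
  proof -
    obtain w where "rep (fan_end i k) w"
    proof -
      have "int k \<le> a i" using n \<open>k \<le> n\<close> by linarith
      then show thesis using fan_end_rep that by blast
    qed
    then show ?thesis by (rule rep_valid(1))
  qed
  have "{p, fan_end i 0} \<notin> E" "{p, fan_end i n} \<notin> E"
    using boundary_side_not_arc[OF b0] boundary_side_not_arc[OF bn] edges(2) by (metis insert_commute subsetD)+
  moreover have "p \<in> valid_ends A" unfolding p_def by (rule rep_valid(1)[OF rep_lower])
  ultimately show ?thesis
    unfolding good_fan_def n_def[symmetric] p_def[symmetric]
    using n(2) boundary_side_good[OF b0] boundary_side_good[OF bn]
    by (intro conjI allI impI orient side spoke valid)
qed

end

section \<open>Triangulations that contain the Farey edges\<close>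

definition pair_class :: "endpoint set \<Rightarrow> (real \<times> real) set set" where
  "pair_class c = {D. \<exists>e f. c = {e, f} \<and> joins D e f}"

text \<open>The union is over both orders of the two ends, which yield the same chord.\<close>

definition pair_chord :: "endpoint set \<Rightarrow> (real \<times> real) set" where
  "pair_chord c = \<Union>{chord e f | e f. c = {e, f}}"

lemma pair_class_eq:
  assumes "e \<in> boundary_ends" "f \<in> boundary_ends" "e \<noteq> f"
  shows "pair_class {e, f} = {D. joins D e f}"
  unfolding pair_class_def using joins_sym[OF _ assms(2,1)] joins_sym[OF _ assms(1,2)] assms(3)
  by (auto simp: doubleton_eq_iff)

lemma pair_chord_eq: "pair_chord {e, f} = chord e f"
  unfolding pair_chord_def by (auto simp: doubleton_eq_iff chord_def open_segment_commute)

lemma valid_pair: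
  assumes "c \<in> arc_ends A"
  obtains e f where "c = {e, f}" "e \<in> boundary_ends" "f \<in> boundary_ends" "e \<noteq> f"
  using arc_ends_valid[OF assms] valid_ends_boundary by blast

lemma pair_chord_in_class:
  assumes "c \<in> arc_ends A" shows "pair_chord c \<in> pair_class c"
proof -
  obtain e f where c: "c = {e, f}" "e \<in> boundary_ends" "f \<in> boundary_ends" "e \<noteq> f" using valid_pair[OF assms] .
  then show ?thesis unfolding c(1) pair_chord_eq pair_class_eq[OF c(2-4)] using joins_chord by simp
qed

lemma pair_class_ends:
  assumes c: "c \<in> arc_ends A" and "C \<in> pair_class c" "joins C e f"
  shows "c = {e, f}"
proof -
  obtain e' f' where c: "c = {e', f'}" "e' \<in> boundary_ends" "f' \<in> boundary_ends" "e' \<noteq> f'" using valid_pair[OF c] .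
  then show ?thesis using assms(2,3) joins_ends_unique unfolding c(1) pair_class_eq[OF c(2-4)] by fastforce
qed

lemma inj_on_pair_class: "inj_on pair_class (arc_ends A)"
proof (rule inj_onI)
  fix c d assume cd: "c \<in> arc_ends A" "d \<in> arc_ends A" "pair_class c = pair_class d"
  obtain e f where c: "c = {e, f}" "e \<in> boundary_ends" "f \<in> boundary_ends" "e \<noteq> f" using valid_pair[OF cd(1)] .
  have "chord e f \<in> pair_class d" using pair_chord_in_class[OF cd(1)] cd(3) by (simp add: c(1) pair_chord_eq)
  then show "c = d" using pair_class_ends[OF cd(2) _ joins_chord[OF c(2-4)]] c(1) by simp
qed

lemma arcs_eq: "arcs A = pair_class ` arc_ends A"
proof
  show "arcs A \<subseteq> pair_class ` arc_ends A"
  proof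
    fix t assume "t \<in> arcs A"
    then obtain C e f where t: "t = {D. isotopic C D}" "joins C e f" "{e, f} \<in> arc_ends A"
      unfolding arcs_def by blast
    have "e \<in> boundary_ends" "f \<in> boundary_ends" "e \<noteq> f"
      using arc_ends_valid[OF t(3)] valid_ends_boundary by (auto simp: doubleton_eq_iff)
    then have "t = pair_class {e, f}" unfolding t(1) using isotopy_class_eq t(2) pair_class_eq by simp
    then show "t \<in> pair_class ` arc_ends A" using t(3) by blast
  qed
  show "pair_class ` arc_ends A \<subseteq> arcs A"
  proof clarify
    fix c assume arc: "c \<in> arc_ends A"
    obtain e f where c: "c = {e, f}" "e \<in> boundary_ends" "f \<in> boundary_ends" "e \<noteq> f" using valid_pair[OF arc] .
    have "pair_class c = {D. isotopic (chord e f) D}"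
      unfolding c(1) pair_class_eq[OF c(2-4)] using isotopy_class_eq[OF joins_chord[OF c(2-4)] c(2-4)] by simp
    then show "pair_class c \<in> arcs A" unfolding arcs_def using joins_chord[OF c(2-4)] arc c(1) by blast
  qed
qed

lemma chord_Int_iff:
  assumes "e \<in> boundary_ends" "f \<in> boundary_ends" "g \<in> boundary_ends" "h \<in> boundary_ends"
  shows "chord e f \<inter> chord g h = {} \<longleftrightarrow>
    open_segment (point_of e) (point_of f) \<inter> open_segment (point_of g) (point_of h) = {}"
  unfolding disc_of_chord[OF assms(1,2), symmetric] disc_of_chord[OF assms(3,4), symmetric]
  using inj_disc_of by (simp add: image_Int[symmetric])

text \<open>If the chords met, the ends of one would be strictly on opposite sides of the other, or
  both on its line. In the first case the curves cross by \<open>joins_crossing\<close>, and in the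
  second the two pairs of ends coincide.\<close>

lemma joins_disjoint_imp_chords_disjoint:
  assumes C: "joins C e f" and D: "joins D g h" and CD: "C \<inter> D = {}"
    and e: "e \<in> boundary_ends" "f \<in> boundary_ends" "e \<noteq> f"
    and g: "g \<in> boundary_ends" "h \<in> boundary_ends" "g \<noteq> h" and ne: "{e, f} \<noteq> {g, h}"
  shows "open_segment (point_of e) (point_of f) \<inter> open_segment (point_of g) (point_of h) = {}"
proof (rule ccontr)
  assume "\<not> ?thesis"
  then obtain z where z: "z \<in> open_segment (point_of e) (point_of f)" "z \<in> open_segment (point_of g) (point_of h)" by blast
  obtain r where r: "0 < r" "r < 1" "z = (1 - r) *\<^sub>R point_of g + r *\<^sub>R point_of h" using z(2) by (auto simp: in_segment)
  define G H where "G = orient (point_of e) (point_of f) (point_of g)"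
    and "H = orient (point_of e) (point_of f) (point_of h)"
  have zero: "(1 - r) * G + r * H = 0"
    using orient_open_segment[OF z(1)] unfolding r(3) orient_affine G_def H_def .
  have "0 < G \<and> H < 0 \<or> G < 0 \<and> 0 < H \<or> G = 0 \<and> H = 0"
  proof -
    have "0 < 1 - r" using r by simp
    then have "(1 - r) * G = - (r * H)" "0 < G \<longleftrightarrow> 0 < (1 - r) * G" "0 < H \<longleftrightarrow> 0 < r * H"
      "G < 0 \<longleftrightarrow> (1 - r) * G < 0" "H < 0 \<longleftrightarrow> r * H < 0"
      using zero r by (auto simp: zero_less_mult_iff mult_less_0_iff)
    then show ?thesis by linarith
  qed
  then consider "0 < G" "H < 0" | "G < 0" "0 < H" | "G = 0" "H = 0" by blast
  then show False
  proof cases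
    case 1
    then show ?thesis using joins_crossing[OF C e D g] CD unfolding G_def H_def by blast
  next
    case 2
    have "h \<noteq> g" using g(3) by simp
    then show ?thesis using joins_crossing[OF C e joins_sym[OF D g] g(2,1)] 2 CD unfolding G_def H_def by blast
  next
    case 3
    have pne: "point_of e \<noteq> point_of f" using e(3) by (simp add: inj_eq[OF inj_point_of])
    have "point_of k = point_of e \<or> point_of k = point_of f"
      if "k \<in> boundary_ends" "orient (point_of e) (point_of f) (point_of k) = 0" for k
      using orient_eq_0_sphere[OF _ _ _ pne that(2)] norm_point_of e that by blast
    then have "g = e \<or> g = f" "h = e \<or> h = f"
      using 3 g unfolding G_def H_def by (auto simp: inj_eq[OF inj_point_of])
    then show ?thesis using ne g(3) by auto
  qed
qed

lemma homeomorphism_components: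
  assumes h: "homeomorphism S T f g" and C: "C \<in> components S"
  shows "f ` C \<in> components T"
  unfolding in_components_maximal
proof (intro conjI allI impI)
  have fg: "continuous_on S f" "f ` S = T" "continuous_on T g" "\<And>x. x \<in> S \<Longrightarrow> g (f x) = x" "\<And>y. y \<in> T \<Longrightarrow> f (g y) = y" "g ` T = S"
    using h by (auto simp: homeomorphism_def)
  have C': "C \<noteq> {}" "C \<subseteq> S" "connected C"
    and max: "\<forall>D. D \<noteq> {} \<and> C \<subseteq> D \<and> D \<subseteq> S \<and> connected D \<longrightarrow> D = C"
    using C unfolding in_components_maximal by simp_all
  show "f ` C \<noteq> {}" "f ` C \<subseteq> T" using C' fg(2) by auto
  show "connected (f ` C)" by (rule connected_continuous_image[OF continuous_on_subset[OF fg(1) C'(2)] C'(3)])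
  fix D assume D: "D \<noteq> {} \<and> f ` C \<subseteq> D \<and> D \<subseteq> T \<and> connected D"
  have "connected (g ` D)" using D by (intro connected_continuous_image continuous_on_subset[OF fg(3)]) simp_all
  moreover have "C \<subseteq> g ` D"
  proof
    fix x assume "x \<in> C"
    then have "x = g (f x)" "f x \<in> D" using fg(4) C'(2) D by auto
    then show "x \<in> g ` D" by blast
  qed
  moreover have "g ` D \<subseteq> S" using D fg(6) by blast
  ultimately have "g ` D = C" using max[rule_format, of "g ` D"] D by simp
  moreover have "f ` g ` D = D"
  proof -
    have "f ` g ` D = (\<lambda>y. y) ` D" unfolding image_image by (rule image_cong) (use D fg(5) in auto)
    then show ?thesis by simp
  qed
  ultimately show "D = f ` C" by simp
qed

lemma disc_of_image_strip_of: "F \<subseteq> ball 0 1 \<Longrightarrow> disc_of ` strip_of ` F = F"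
proof -
  assume "F \<subseteq> ball 0 1"
  then have "disc_of (strip_of z) = z" if "z \<in> F" for z
    using that ball_subset_band disc_of_strip_of by blast
  then have "disc_of ` strip_of ` F = (\<lambda>z. z) ` F" unfolding image_image by (rule image_cong[OF refl])
  then show ?thesis by simp
qed

lemma homeomorphism_strip_unit_disc: "homeomorphism open_strip (ball 0 1) disc_of strip_of"
proof (rule homeomorphismI)
  show "continuous_on open_strip disc_of" by (rule continuous_on_subset[OF continuous_on_disc_of]) simp
  show "continuous_on (ball 0 1) strip_of" by (rule continuous_on_subset[OF continuous_on_strip_of ball_subset_band])
  show "disc_of ` open_strip \<subseteq> ball 0 1" using norm_disc_of_less_1 by auto
  have "disc_of (strip_of z) = z" if "z \<in> ball 0 1" for z using that ball_subset_band disc_of_strip_of by blast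
  then show "strip_of ` ball 0 1 \<subseteq> open_strip" "\<And>z. z \<in> ball 0 1 \<Longrightarrow> disc_of (strip_of z) = z"
    using norm_disc_of_less_1 by (metis image_subsetI mem_ball_0, blast)
qed simp

text \<open>Closures are taken in the whole plane, so that vertices count. The backward direction
  rests on the continuity of \<open>strip_of\<close> on the open band, which contains the image of
  the plane.\<close>

lemma disc_of_closure_iff: "disc_of x \<in> closure (disc_of ` X) \<longleftrightarrow> x \<in> closure X"
proof
  assume "x \<in> closure X"
  moreover have "disc_of ` closure X \<subseteq> closure (disc_of ` X)"
    by (rule image_closure_subset[OF _ closed_closure closure_subset])
      (rule continuous_on_subset[OF continuous_on_disc_of], simp)
  ultimately show "disc_of x \<in> closure (disc_of ` X)" by blast
next
  assume "disc_of x \<in> closure (disc_of ` X)"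
  then obtain s where s: "\<And>n. s n \<in> disc_of ` X" "s \<longlonglongrightarrow> disc_of x" unfolding closure_sequential by blast
  have "isCont strip_of (disc_of x)"
    using continuous_on_strip_of open_band disc_of_in_band by (simp add: continuous_on_eq_continuous_at)
  then have "(\<lambda>n. strip_of (s n)) \<longlonglongrightarrow> strip_of (disc_of x)" using s(2) isCont_tendsto_compose by blast
  moreover have "strip_of (s n) \<in> X" for n using s(1)[of n] by auto
  ultimately show "x \<in> closure X"
    unfolding closure_sequential by (intro exI[of _ "\<lambda>n. strip_of (s n)"]) simp
qed

section \<open>Arcs and regions of the chord drawing\<close>

context frieze_triangulation
begin

definition T :: "(real \<times> real) set set set" where
  "T = pair_class ` E"

definition R :: "(real \<times> real) set set \<Rightarrow> (real \<times> real) set" where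
  "R t = pair_chord (inv_into E pair_class t)"

lemma inj_on_E: "inj_on pair_class E"
  using inj_on_subset[OF inj_on_pair_class edges(2)] .

lemma R_pair_class: "c \<in> E \<Longrightarrow> R (pair_class c) = pair_chord c"
  by (simp add: R_def inv_into_f_f[OF inj_on_E])

lemma E_ends:
  assumes "{e, f} \<in> E"
  shows "e \<in> boundary_ends" "f \<in> boundary_ends" "e \<noteq> f"
  using E_in_V[OF assms] valid_ends_boundary by auto

lemma pair_chords_disjoint:
  assumes "c \<in> E" "d \<in> E" "c \<noteq> d" shows "pair_chord c \<inter> pair_chord d = {}"
proof -
  obtain e f where c: "c = {e, f}" using arc_ends_valid edges(2) assms(1) by blast
  obtain g h where d: "d = {g, h}" using arc_ends_valid edges(2) assms(2) by blast
  show ?thesis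
    using noncross[of e f g h] chord_Int_iff E_ends assms unfolding c d pair_chord_eq by simp
qed

lemma drawing_T: "drawing T R"
  unfolding drawing_def
proof (intro conjI ballI impI)
  show "R t \<in> t" if "t \<in> T" for t
    using that pair_chord_in_class edges(2) R_pair_class unfolding T_def by auto
  show "R s \<inter> R t = {}" if st: "s \<in> T" "t \<in> T" "s \<noteq> t" for s t
  proof -
    obtain c d where "c \<in> E" "d \<in> E" "s = pair_class c" "t = pair_class d" using st unfolding T_def by blast
    then show ?thesis using pair_chords_disjoint[of c d] R_pair_class st(3) by auto
  qed
qed

lemma compatible_T: "pairwise compatible T"
  unfolding pairwise_def compatible_def using drawing_T unfolding drawing_def by metis

lemma incident_arc_iff:
  assumes "c \<in> E" shows "incident_arc (pair_class c) e \<longleftrightarrow> e \<in> c"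
proof
  assume "incident_arc (pair_class c) e"
  then show "e \<in> c" using pair_class_ends assms edges(2) unfolding incident_arc_def by blast
next
  assume "e \<in> c"
  then obtain f where c: "c = {e, f}" using arc_ends_valid edges(2) assms by blast
  have "joins (chord e f) e f" using joins_chord E_ends assms unfolding c by blast
  then show "incident_arc (pair_class c) e"
    unfolding incident_arc_def using pair_chord_in_class[of c A] edges(2) assms unfolding c pair_chord_eq by blast
qed

text \<open>The arcs at a lower vertex end at the finitely many ends of its fan, whatever has been
  added to the Farey edges.\<close>

lemma admissible_T: "admissible T"
  unfolding admissible_def
proof
  fix q assume "q \<in> lower_vertices"
  then obtain i where q: "q = (of_int i, 0)" by (auto simp: lower_vertices_def)
  have "{t \<in> T. incident_arc t (Vertex q)} \<subseteq> (\<lambda>k. pair_class {Vertex q, fan_end i k}) ` {..<nat (a i)}"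
  proof
    fix t assume "t \<in> {t \<in> T. incident_arc t (Vertex q)}"
    then obtain c where c: "c \<in> E" "t = pair_class c" "Vertex q \<in> c" using incident_arc_iff unfolding T_def by auto
    then obtain f where f: "c = {Vertex q, f}" using arc_ends_valid edges(2) by blast
    then obtain k where "k < nat (a i)" "f = fan_end i k"
      using good_fan_neighbours[OF frieze_fan[of i], of f] c(1) q by auto
    then show "t \<in> (\<lambda>k. pair_class {Vertex q, fan_end i k}) ` {..<nat (a i)}" using c f by blast
  qed
  then show "finite {t \<in> T. incident_arc t (Vertex q)}" by (rule finite_subset) simp
qed

lemma cut_strip: "homeomorphism (open_strip - (\<Union>t\<in>T. R t)) cut_disc disc_of strip_of"
proof (rule homeomorphism_of_subsets[OF homeomorphism_strip_unit_disc])
  show "cut_disc \<subseteq> ball 0 1" unfolding cut_disc_def by blast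
  have chords: "disc_of ` (\<Union>t\<in>T. R t) = \<Union>{open_segment (point_of e) (point_of f) | e f. {e, f} \<in> E}"
  proof -
    have "disc_of ` (\<Union>t\<in>T. R t) = (\<Union>c\<in>E. disc_of ` pair_chord c)"
      unfolding T_def using R_pair_class by auto
    also have "\<dots> = \<Union>{open_segment (point_of e) (point_of f) | e f. {e, f} \<in> E}"
    proof
      show "(\<Union>c\<in>E. disc_of ` pair_chord c) \<subseteq> \<Union>{open_segment (point_of e) (point_of f) | e f. {e, f} \<in> E}"
      proof
        fix z assume "z \<in> (\<Union>c\<in>E. disc_of ` pair_chord c)"
        then obtain c where c: "c \<in> E" "z \<in> disc_of ` pair_chord c" by blast
        obtain e f where ef: "c = {e, f}" using arc_ends_valid edges(2) c(1) by blast
        then have "z \<in> open_segment (point_of e) (point_of f)"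
          using c disc_of_chord E_ends unfolding ef pair_chord_eq by blast
        then show "z \<in> \<Union>{open_segment (point_of e) (point_of f) | e f. {e, f} \<in> E}" using c(1) ef by blast
      qed
      show "\<Union>{open_segment (point_of e) (point_of f) | e f. {e, f} \<in> E} \<subseteq> (\<Union>c\<in>E. disc_of ` pair_chord c)"
      proof clarify
        fix z e f assume z: "{e, f} \<in> E" "z \<in> open_segment (point_of e) (point_of f)"
        then have "z \<in> disc_of ` pair_chord {e, f}" using disc_of_chord E_ends unfolding pair_chord_eq by blast
        then show "z \<in> (\<Union>c\<in>E. disc_of ` pair_chord c)" using z(1) by blast
      qed
    qed
    finally show ?thesis .
  qed
  have "disc_of ` open_strip = ball 0 1" using homeomorphism_strip_unit_disc by (simp add: homeomorphism_def)
  then show "disc_of ` (open_strip - (\<Union>t\<in>T. R t)) = cut_disc"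
    unfolding cut_disc_def chords[symmetric] using image_set_diff[OF inj_disc_of] by simp
qed auto

lemma regions_iff: "D \<in> regions T R \<longleftrightarrow> (\<exists>K\<in>components cut_disc. D = strip_of ` K)"
proof
  assume "D \<in> regions T R"
  then have "disc_of ` D \<in> components cut_disc" unfolding regions_def by (rule homeomorphism_components[OF cut_strip])
  moreover have "D = strip_of ` disc_of ` D" by (simp add: image_image)
  ultimately show "\<exists>K\<in>components cut_disc. D = strip_of ` K" by blast
next
  assume "\<exists>K\<in>components cut_disc. D = strip_of ` K"
  then show "D \<in> regions T R"
    unfolding regions_def using homeomorphism_components[OF homeomorphism_symD[OF cut_strip]] by blast
qed

lemma disc_side_boundary:
  assumes b: "boundary_side A e f" and u: "{e, f} = {Vertex u, Vertex w}"
  shows "disc_side e f = disc_of ` open_segment u w"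
proof -
  obtain p q where pq: "{e, f} = {Vertex p, Vertex q}"
    "{z \<in> sphere 0 1. orient (point_of e) (point_of f) z < 0} = disc_of ` open_segment p q"
    using boundary_side_arc[OF b] by metis
  have "{e, f} \<notin> E" using boundary_side_not_arc[OF b] edges(2) by blast
  then have "disc_side e f = disc_of ` open_segment p q" unfolding disc_side_def pq(2) by (simp only: if_False)
  also have "open_segment p q = open_segment u w"
    using u pq(1) by (auto simp: doubleton_eq_iff open_segment_commute)
  finally show ?thesis .
qed

lemma side_exists:
  assumes "{e, f} \<in> E \<or> boundary_side A e f"
  obtains S where "side A T R e f S" "disc_of ` S = disc_side e f"
proof (cases "{e, f} \<in> E")
  case True
  have "side A T R e f (chord e f)"
    unfolding side_def
  proof (intro disjI1 bexI conjI)
    show "chord e f = R (pair_class {e, f})" using R_pair_class[OF True] pair_chord_eq by simp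
    show "joins (chord e f) e f" using joins_chord E_ends[OF True] by blast
    show "pair_class {e, f} \<in> T" using True unfolding T_def by blast
  qed
  then show thesis using that[of "chord e f"] disc_of_chord E_ends[OF True] True by (simp add: disc_side_def)
next
  case False
  then have b: "boundary_side A e f" using assms by blast
  obtain p q where pq: "{e, f} = {Vertex p, Vertex q}"
    "neighbouring lower_vertices p q \<or> neighbouring (upper_vertices A) p q"
    using boundary_side_arc[OF b] by metis
  have "side A T R e f (open_segment p q)" unfolding side_def using pq by blast
  then show thesis using that disc_side_boundary[OF b pq(1)] by simp
qed

lemma fan_region_triangle:
  assumes k: "int k < a i"
  defines "p \<equiv> Vertex (of_int i, 0)"
  shows "triangle A T R p (fan_end i (Suc k)) (fan_end i k) (strip_of ` fan_region p (fan_end i) k)"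
proof -
  define n where "n = nat (a i)"
  have n: "int n = a i" "k < n" using k by (auto simp: n_def)
  have fan: "good_fan p n (fan_end i)" using frieze_fan[of i] by (simp add: p_def n_def)
  have x0: "fan_end i 0 = Vertex (of_int (i - 1), 0)" and xn: "fan_end i n = Vertex (of_int (i + 1), 0)"
    using n by (auto simp: fan_end_def)
  have tri: "good_triangle p (fan_end i (Suc k)) (fan_end i k)" using good_fan_triangle[OF fan n(2)] .
  have s1: "{p, fan_end i (Suc k)} \<in> E \<or> boundary_side A p (fan_end i (Suc k))"
  proof (cases "Suc k = n")
    case True
    then show ?thesis using xn boundary_side_lower(1)[of i] by (simp add: p_def)
  next
    case False
    then show ?thesis using fan n(2) unfolding good_fan_def by auto
  qed
  have s3: "{fan_end i k, p} \<in> E \<or> boundary_side A (fan_end i k) p"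
  proof (cases "k = 0")
    case True
    then show ?thesis using x0 boundary_side_lower(2)[of _ i] by (simp add: p_def)
  next
    case False
    then show ?thesis using fan n(2) unfolding good_fan_def by (auto simp: insert_commute)
  qed
  obtain S1 where S1: "side A T R p (fan_end i (Suc k)) S1" "disc_of ` S1 = disc_side p (fan_end i (Suc k))"
    using side_exists[OF s1] .
  obtain S2 where S2: "side A T R (fan_end i (Suc k)) (fan_end i k) S2" "disc_of ` S2 = disc_side (fan_end i (Suc k)) (fan_end i k)"
    using side_exists[OF fan_side[OF k]] .
  obtain S3 where S3: "side A T R (fan_end i k) p S3" "disc_of ` S3 = disc_side (fan_end i k) p"
    using side_exists[OF s3] .
  define F where "F = fan_region p (fan_end i) k"
  define D where "D = strip_of ` F"
  have FD: "disc_of ` D = F"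
    unfolding D_def F_def by (rule disc_of_image_strip_of[OF disc_region_subset_ball])
  \<comment> \<open>Written as a preimage, \<open>D\<close> is open, and with
    \<open>disc_of_closure_iff\<close> its frontier can be compared with that of \<open>F\<close>
    point by point.\<close>
  have D_vimage: "D = disc_of -` F"
    using FD inj_disc_of by (metis inj_vimage_image_eq)
  have "open D"
    unfolding D_vimage F_def by (rule open_vimage[OF open_disc_region continuous_on_disc_of])
  have "x \<in> frontier D \<longleftrightarrow> x \<in> closure (S1 \<union> S2 \<union> S3)" for x
  proof -
    have "x \<in> frontier D \<longleftrightarrow> disc_of x \<in> closure F \<and> disc_of x \<notin> F"
      using \<open>open D\<close> disc_of_closure_iff[of x D] unfolding FD
      by (simp add: frontier_def interior_open D_vimage)
    also have "\<dots> \<longleftrightarrow> disc_of x \<in> frontier F" unfolding F_def frontier_disc_region by blast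
    also have "frontier F = closure (disc_of ` (S1 \<union> S2 \<union> S3))"
      unfolding F_def frontier_disc_region_eq[OF tri] image_Un S1(2) S2(2) S3(2) ..
    finally show ?thesis using disc_of_closure_iff by blast
  qed
  then have front: "frontier D = closure (S1 \<union> S2 \<union> S3)" by blast
  have "D \<in> regions T R" unfolding regions_iff D_def F_def using disc_region_component[OF tri] by blast
  moreover have "distinct [p, fan_end i (Suc k), fan_end i k]"
    using tri unfolding good_triangle_def by auto
  ultimately show ?thesis
    unfolding triangle_def F_def[symmetric] D_def[symmetric] using S1(1) S2(1) S3(1) front by blast
qed

text \<open>A triangle at \<open>p i\<close> has a side ending there: an inner edge of the fan or
  one of the two boundary segments. One point of that side, being in the closure of the region,
  identifies the region by \<open>fan_component\<close>.\<close>

lemma triangle_at_lower_imp_fan_region: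
  defines "p \<equiv> \<lambda>i. Vertex (of_int i, 0)"
  assumes t: "triangle A T R (p i) e f D"
  shows "\<exists>k. int k < a i \<and> D = strip_of ` fan_region (p i) (fan_end i) k"
proof -
  define n where "n = nat (a i)"
  have n: "int n = a i" using a_pos[of i] by (simp add: n_def)
  have fan: "good_fan (p i) n (fan_end i)" using frieze_fan[of i] by (simp add: p_def n_def)
  have x0: "fan_end i 0 = p (i - 1)" and xn: "fan_end i n = p (i + 1)"
    using n a_pos[of i] by (auto simp: fan_end_def p_def)
  obtain S S2 S3 where S: "side A T R (p i) e S" and "frontier D = closure (S \<union> S2 \<union> S3)"
    using t unfolding triangle_def by blast
  then have S_frontier: "S \<subseteq> frontier D" using closure_subset[of "S \<union> S2 \<union> S3"] by simp
  obtain K where K: "K \<in> components cut_disc" "D = strip_of ` K"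
    using t unfolding triangle_def regions_iff by blast
  have KD: "disc_of ` D = K"
  proof -
    have "K \<subseteq> ball 0 1" using in_components_subset[OF K(1)] unfolding cut_disc_def by blast
    then show ?thesis unfolding K(2) by (rule disc_of_image_strip_of)
  qed
  have touch: "disc_of x \<in> closure K" if "x \<in> S" for x
    using subsetD[OF S_frontier that] disc_of_closure_iff[of x D] unfolding KD frontier_def by simp
  have "\<exists>x\<in>S. (\<exists>k. 0 < k \<and> k < n \<and> disc_of x \<in> open_segment (point_of (p i)) (point_of (fan_end i k))) \<or>
       disc_of x \<in> disc_side (p i) (fan_end i n) \<or> disc_of x \<in> disc_side (fan_end i 0) (p i)"
  proof -
    consider (arc) t where "t \<in> T" "S = R t" "joins S (p i) e"
      | (bd) u w where "{p i, e} = {Vertex u, Vertex w}"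
         "neighbouring lower_vertices u w \<or> neighbouring (upper_vertices A) u w" "S = open_segment u w"
      using S unfolding side_def by blast
    then show ?thesis
    proof cases
      case arc
      then obtain c where c: "c \<in> E" "S = pair_chord c" using R_pair_class unfolding T_def by auto
      have "c \<in> arc_ends A" using c(1) edges(2) by blast
      then have ce: "c = {p i, e}" using pair_class_ends[of c A S] pair_chord_in_class[of c A] arc(3) c by simp
      then obtain k where k: "0 < k" "k < n" "e = fan_end i k" using good_fan_neighbours[OF fan, of e] c(1) by blast
      have pe: "p i \<in> boundary_ends" "e \<in> boundary_ends" "p i \<noteq> e" using E_ends[of "p i" e] c(1) ce by simp_all
      have "disc_of ` S = open_segment (point_of (p i)) (point_of e)"
        unfolding c(2) ce pair_chord_eq by (rule disc_of_chord[OF pe(1,2)])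
      moreover have "open_segment (point_of (p i)) (point_of e) \<noteq> {}" using pe(3) by (simp add: inj_eq[OF inj_point_of])
      ultimately show ?thesis using k by blast
    next
      case bd
      have "\<not> neighbouring (upper_vertices A) u w"
        using bd(1) by (auto simp: doubleton_eq_iff p_def neighbouring_def upper_vertices_def)
      then obtain j :: int where j: "u = (of_int j, 0)" "w = (of_int (j + 1), 0)"
        using bd(2) neighbouring_lower_iff by blast
      have "u \<noteq> w" using j by simp
      then have "S \<noteq> {}" unfolding bd(3) by simp
      then obtain x where x: "x \<in> S" by blast
      have "i = j \<or> i = j + 1" using bd(1) unfolding j p_def by (auto simp: doubleton_eq_iff)
      then show ?thesis
      proof
        assume "i = j"
        then have "disc_side (p i) (fan_end i n) = disc_of ` open_segment u w"
          using j xn boundary_side_lower(1)[of i] by (intro disc_side_boundary) (simp_all add: p_def)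
        then show ?thesis using x bd(3) by blast
      next
        assume "i = j + 1"
        then have "disc_side (fan_end i 0) (p i) = disc_of ` open_segment u w"
          using j x0 boundary_side_lower(2)[of _ i] by (intro disc_side_boundary) (simp_all add: p_def)
        then show ?thesis using x bd(3) by blast
      qed
    qed
  qed
  then obtain x where "x \<in> S" and x: "(\<exists>k. 0 < k \<and> k < n \<and> disc_of x \<in> open_segment (point_of (p i)) (point_of (fan_end i k))) \<or>
       disc_of x \<in> disc_side (p i) (fan_end i n) \<or> disc_of x \<in> disc_side (fan_end i 0) (p i)" by blast
  have "K \<in> fan_region (p i) (fan_end i) ` {..<n}"
    by (rule fan_component[OF fan K(1) touch[OF \<open>x \<in> S\<close>] x])
  then obtain k where k: "k < n" "K = fan_region (p i) (fan_end i) k" by blast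
  then have "int k < a i" using n by linarith
  then show ?thesis using K(2) k(2) by blast
qed

lemma triangles_at_lower:
  "finite (triangles_at A T R (Vertex (of_int i, 0)))"
  "int (card (triangles_at A T R (Vertex (of_int i, 0)))) = a i"
proof -
  define p where "p = Vertex (of_int i, 0)"
  have eq: "triangles_at A T R p = (\<lambda>k. strip_of ` fan_region p (fan_end i) k) ` {..<nat (a i)}"
  proof (intro set_eqI iffI)
    fix D assume "D \<in> triangles_at A T R p"
    then obtain e f where "triangle A T R p e f D" unfolding triangles_at_def by blast
    then obtain k where "int k < a i" "D = strip_of ` fan_region p (fan_end i) k"
      using triangle_at_lower_imp_fan_region[of i e f D] unfolding p_def by blast
    then show "D \<in> (\<lambda>k. strip_of ` fan_region p (fan_end i) k) ` {..<nat (a i)}" by auto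
  next
    fix D assume "D \<in> (\<lambda>k. strip_of ` fan_region p (fan_end i) k) ` {..<nat (a i)}"
    then obtain k where k: "k < nat (a i)" "D = strip_of ` fan_region p (fan_end i) k" by blast
    then have "int k < a i" by linarith
    then show "D \<in> triangles_at A T R p"
      using fan_region_triangle[of k i] unfolding triangles_at_def k(2) p_def by blast
  qed
  have "inj_on (\<lambda>k. strip_of ` fan_region p (fan_end i) k) {..<nat (a i)}"
  proof (rule inj_onI)
    fix k l assume kl: "k \<in> {..<nat (a i)}" "l \<in> {..<nat (a i)}"
      "strip_of ` fan_region p (fan_end i) k = strip_of ` fan_region p (fan_end i) l"
    have "fan_region p (fan_end i) k = fan_region p (fan_end i) l"
      using arg_cong[OF kl(3), of "image disc_of"]
      by (simp only: disc_of_image_strip_of[OF disc_region_subset_ball])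
    then show "k = l" using inj_onD[OF fan_region_inj[OF frieze_fan[of i]]] kl(1,2) unfolding p_def by blast
  qed
  then have "card (triangles_at A T R p) = nat (a i)" unfolding eq by (simp add: card_image)
  then show "int (card (triangles_at A T R (Vertex (of_int i, 0)))) = a i" using a_pos[of i] by (simp add: p_def)
  show "finite (triangles_at A T R (Vertex (of_int i, 0)))" using eq by (simp add: p_def)
qed

text \<open>An arc compatible with all of \<open>T\<close> has curves disjoint from curves of these
  arcs, so its chord is disjoint from their chords; thus maximality among chords passes to
  arcs.\<close>

lemma strip_triangulation_T:
  assumes max: "\<And>c. c \<in> arc_ends A \<Longrightarrow>
     (\<And>e f g h. c = {e, f} \<Longrightarrow> {g, h} \<in> E \<Longrightarrow> c \<noteq> {g, h} \<Longrightarrow>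
        open_segment (point_of e) (point_of f) \<inter> open_segment (point_of g) (point_of h) = {}) \<Longrightarrow> c \<in> E"
  shows "strip_triangulation A T"
  unfolding strip_triangulation_def
proof (intro conjI allI impI)
  show "T \<subseteq> arcs A" unfolding T_def arcs_eq using edges(2) by blast
  show "pairwise compatible T" by (rule compatible_T)
  fix T' assume T': "T \<subseteq> T' \<and> T' \<subseteq> arcs A \<and> pairwise compatible T'"
  have "t \<in> T" if t: "t \<in> T'" for t
  proof -
    obtain c where c: "c \<in> arc_ends A" "t = pair_class c" using t T' unfolding arcs_eq by blast
    have "c \<in> E"
    proof (rule max[OF c(1)])
      fix e f g h assume ef: "c = {e, f}" and gh: "{g, h} \<in> E" and ne: "c \<noteq> {g, h}"
      have arc: "{g, h} \<in> arc_ends A" using gh edges(2) by blast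
      have e: "e \<in> boundary_ends" "f \<in> boundary_ends" "e \<noteq> f"
        using arc_ends_valid[OF c(1)] valid_ends_boundary unfolding ef by (auto simp: doubleton_eq_iff)
      note g = E_ends[OF gh]
      have "t \<noteq> pair_class {g, h}" using inj_onD[OF inj_on_pair_class _ c(1) arc] c(2) ne by blast
      moreover have "pair_class {g, h} \<in> T'" using gh T' unfolding T_def by blast
      ultimately have "compatible t (pair_class {g, h})" using t T' unfolding pairwise_def by blast
      then obtain C D where "joins C e f" "joins D g h" "C \<inter> D = {}"
        unfolding compatible_def c(2) ef pair_class_eq[OF e] pair_class_eq[OF g] by blast
      then show "open_segment (point_of e) (point_of f) \<inter> open_segment (point_of g) (point_of h) = {}"
        using joins_disjoint_imp_chords_disjoint e g ne ef by blast
    qed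
    then show ?thesis unfolding T_def c(2) by blast
  qed
  then show "T' = T" using T' by blast
qed

end

theorem theorem5p2:
  fixes m :: "int \<Rightarrow> int \<Rightarrow> int"
  assumes "infinite_frieze m"
  shows "\<exists>(A :: rat set) T. strip_triangulation A T \<and> admissible T \<and>
           (\<exists>R. drawing T R \<and>
             (\<forall>i. finite (triangles_at A T R (Vertex (of_int i, 0))) \<and>
                  int (card (triangles_at A T R (Vertex (of_int i, 0)))) = quiddity_row m i))"
proof -
  obtain v where "frieze_path v (\<lambda>i. m i i)" using frieze_path_exists[OF assms] .
  then interpret frieze_path v "\<lambda>i. m i i" .
  define noncrossing where "noncrossing E \<longleftrightarrow> (\<forall>e f g h. {e, f} \<in> E \<longrightarrow> {g, h} \<in> E \<longrightarrow> {e, f} \<noteq> {g, h} \<longrightarrow>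
      open_segment (point_of e) (point_of f) \<inter> open_segment (point_of g) (point_of h) = {})" for E
  define \<F> where "\<F> = {E. frieze_edges \<subseteq> E \<and> E \<subseteq> arc_ends A \<and> noncrossing E}"
  have "\<exists>M\<in>\<F>. \<forall>X\<in>\<F>. M \<subseteq> X \<longrightarrow> X = M"
  proof (rule subset_Zorn_nonempty)
    have "frieze_edges \<in> \<F>"
      using frieze_edges_noncrossing unfolding \<F>_def noncrossing_def by (auto simp: frieze_edges_def)
    then show "\<F> \<noteq> {}" by blast
    fix C assume C: "C \<noteq> {}" "subset.chain \<F> C"
    \<comment> \<open>A crossing involves only two edges, and some member of the chain contains
      both.\<close>
    have "noncrossing (\<Union>C)"
      unfolding noncrossing_def
    proof (intro allI impI)
      fix e f g h assume *: "{e, f} \<in> \<Union>C" "{g, h} \<in> \<Union>C" "{e, f} \<noteq> {g, h}"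
      then obtain X Y where XY: "X \<in> C" "Y \<in> C" "{e, f} \<in> X" "{g, h} \<in> Y" by blast
      then have "X \<subseteq> Y \<or> Y \<subseteq> X" using C(2) unfolding subset.chain_def by blast
      then obtain Z where "Z \<in> C" "{e, f} \<in> Z" "{g, h} \<in> Z" using XY by blast
      moreover have "noncrossing Z" using C(2) \<open>Z \<in> C\<close> unfolding subset.chain_def \<F>_def by blast
      ultimately show "open_segment (point_of e) (point_of f) \<inter> open_segment (point_of g) (point_of h) = {}"
        using *(3) unfolding noncrossing_def by blast
    qed
    then show "\<Union>C \<in> \<F>" using C unfolding subset.chain_def \<F>_def by blast
  qed
  then obtain E where E_in: "E \<in> \<F>" and E_max: "\<forall>X\<in>\<F>. E \<subseteq> X \<longrightarrow> X = E" ..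
  have M: "frieze_edges \<subseteq> E" "E \<subseteq> arc_ends A" "noncrossing E" using E_in unfolding \<F>_def by simp_all
  have max: "X = E" if "frieze_edges \<subseteq> X" "X \<subseteq> arc_ends A" "noncrossing X" "E \<subseteq> X" for X
    using E_max that unfolding \<F>_def by simp
  interpret frieze_triangulation v "\<lambda>i. m i i" E
    by unfold_locales (fact M(1), fact M(2), use M(3) in \<open>simp add: noncrossing_def\<close>)
  have "strip_triangulation A T"
  proof (rule strip_triangulation_T)
    fix c assume c: "c \<in> arc_ends A" and disj: "\<And>e f g h. c = {e, f} \<Longrightarrow> {g, h} \<in> E \<Longrightarrow> c \<noteq> {g, h} \<Longrightarrow>
        open_segment (point_of e) (point_of f) \<inter> open_segment (point_of g) (point_of h) = {}"
    \<comment> \<open>An arc whose chord misses all other chords of \<open>E\<close> can be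
      inserted, so by maximality it is already in \<open>E\<close>.\<close>
    have "noncrossing (insert c E)"
      unfolding noncrossing_def
    proof (intro allI impI)
      fix e f g h assume *: "{e, f} \<in> insert c E" "{g, h} \<in> insert c E" "{e, f} \<noteq> {g, h}"
      then consider "{e, f} = c" "{g, h} \<in> E" | "{g, h} = c" "{e, f} \<in> E" | "{e, f} \<in> E" "{g, h} \<in> E" by blast
      then show "open_segment (point_of e) (point_of f) \<inter> open_segment (point_of g) (point_of h) = {}"
      proof cases
        case 1
        then show ?thesis using disj[of e f g h] *(3) by simp
      next
        case 2
        then show ?thesis using disj[of g h e f] *(3) by auto
      next
        case 3
        then show ?thesis using M(3) *(3) unfolding noncrossing_def by blast
      qed
    qed
    then have "insert c E = E" using max[of "insert c E"] M(1,2) c by blast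
    then show "c \<in> E" by blast
  qed
  then show ?thesis
    using admissible_T drawing_T triangles_at_lower unfolding quiddity_row_def by blast
qed

end
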